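(* Assume that $(M,d,\mu,L)$ satisfies $(H)$ and the volume doubling property (there is $C>0$ with $V(x,2r)\le C\,V(x,r)$ for all $x\in M$, $r>0$), and that $v:M\times\mathbb{R}_+\to\mathbb{R}_+$ satisfies $(A)$ and $(D'_v)$. Then, for all $q>2$, conditions $(GN_q^v)$, $(KGN_q^v)$ and $(LS_q^v)$ are equivalent.
   Context: $B(x,r)$ denotes the open ball of the metric $d$, and $V(x,r):=\mu(B(x,r))$, assumed finite and positive for all $x\in M,r>0$. $(H)$: $(M,d,\mu)$ is a locally compact, separable and complete metric space endowed with a Borel measure $\mu$ which is finite on compact sets and strictly positive on non-empty open sets; $L$ is a non-negative self-adjoint operator on $L^2(M,\mu)$ whose associated quadratic form $\mathcal{E}$, $\mathcal{E}(f)=\|L^{1/2}f\|_2^2$ with domain $\mathcal{F}$, is a strongly local and regular Dirichlet form, with energy measure $d\Gamma$ (so $\mathcal{E}(f,g)=\int_M d\Gamma(f,g)$ for $f,g\in\mathcal{F}$); and for every $x\in M$ the function $d_x(y):=d(x,y)$ belongs to $\mathcal{F}_{loc}$ (the functions that coincide locally with elements of $\mathcal F$) and satisfies $d\Gamma(d_x,d_x)\le d\mu$. Conditions on $v$ (write $v_r(x)=v(x,r)$): - $(A)$: $v(x,r)$ is measurable in $x$, a.e. finite and positive, and non-decreasing in $r$ for a.e. fixed $x$. - $(D'_v)$: there is $C>0$ with $v(y,r)\le C\,v(x,r)$ for all $x,y\in M$, $r>0$ with $d(x,y)\le r$. $\mathcal{F}_c(B)$ is the set of functions in $\mathcal{F}$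 compactly supported in $B$. Inequalities (constants $C>0$ independent of $r,x,f$; an inequality with infinite right-hand side is regarded as true): - $(GN_q^v)$: $\|f v_r^{\frac12-\frac1q}\|_q^2\le C\left(\|f\|_2^2+r^2\mathcal{E}(f)\right)$ for all $r>0$, $f\in\mathcal{F}$. - $(KGN_q^v)$: $\left(\inf_{z\in\mathrm{supp}(f)}v_r^{1-\frac2q}(z)\right)\|f\|_q^2\le C\left(\|f\|_2^2+r^2\mathcal{E}(f)\right)$ for all $r>0$, $f\in\mathcal{F}$. - $(LS_q^v)$: for every ball $B=B(x,r)$ and every $f\in\mathcal{F}_c(B)$, $\|f\|_q^2\le \dfrac{C}{v_r^{1-\frac2q}(x)}\left(\|f\|_2^2+r^2\mathcal{E}(f)\right)$. *)

theory Defs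
  imports "HOL-Analysis.Analysis"
begin

section \<open>Real \<open>L\<close>-spaces and unbounded operators\<close>

text \<open>
  Elements of \<open>L\<^sup>2(M, \<mu>)\<close> are represented by Borel functions.  Every set of functions or operator
  graph below is required to be saturated under equality almost everywhere.
\<close>

definition L2 :: "'a measure \<Rightarrow> ('a \<Rightarrow> real) set" where
  "L2 \<mu> = {f \<in> borel_measurable \<mu>. integrable \<mu> (\<lambda>x. (f x)\<^sup>2)}"

definition l2_inner :: "'a measure \<Rightarrow> ('a \<Rightarrow> real) \<Rightarrow> ('a \<Rightarrow> real) \<Rightarrow> real" where
  "l2_inner \<mu> f g = (\<integral>x. f x * g x \<partial>\<mu>)"

definition lp_norm :: "'a measure \<Rightarrow> real \<Rightarrow> ('a \<Rightarrow> real) \<Rightarrow> ennreal" where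
  "lp_norm \<mu> q f =
     (let I = (\<integral>\<^sup>+x. ennreal (\<bar>f x\<bar> powr q) \<partial>\<mu>)
      in if I = \<infinity> then \<infinity> else ennreal (enn2real I powr (1 / q)))"

definition l2_subspace :: "'a measure \<Rightarrow> ('a \<Rightarrow> real) set \<Rightarrow> bool" where
  "l2_subspace \<mu> F \<longleftrightarrow>
     F \<subseteq> L2 \<mu> \<and> (\<lambda>_. 0) \<in> F \<and>
     (\<forall>f\<in>F. \<forall>g\<in>F. \<forall>a. (\<lambda>x. a * f x + g x) \<in> F) \<and>
     (\<forall>f\<in>F. \<forall>g\<in>borel_measurable \<mu>. (AE x in \<mu>. f x = g x) \<longrightarrow> g \<in> F)"

definition l2_dense :: "'a measure \<Rightarrow> ('a \<Rightarrow> real) set \<Rightarrow> bool" where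
  "l2_dense \<mu> F \<longleftrightarrow>
     (\<forall>f\<in>L2 \<mu>. \<forall>e>0. \<exists>g\<in>F. l2_inner \<mu> (\<lambda>x. f x - g x) (\<lambda>x. f x - g x) < e)"

text \<open>An unbounded operator \<open>T\<close> is identified with its graph: \<open>(f, h) \<in> T\<close> means \<open>f \<in> dom T\<close> and
  \<open>T f = h\<close> almost everywhere.\<close>

definition l2_operator :: "'a measure \<Rightarrow> (('a \<Rightarrow> real) \<times> ('a \<Rightarrow> real)) set \<Rightarrow> bool" where
  "l2_operator \<mu> T \<longleftrightarrow>
     T \<subseteq> L2 \<mu> \<times> L2 \<mu> \<and> (\<lambda>_. 0, \<lambda>_. 0) \<in> T \<and>
     (\<forall>f h f' h' a. (f, h) \<in> T \<longrightarrow> (f', h') \<in> T \<longrightarrow>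
        (\<lambda>x. a * f x + f' x, \<lambda>x. a * h x + h' x) \<in> T) \<and>
     (\<forall>f h. \<forall>f'\<in>borel_measurable \<mu>. \<forall>h'\<in>borel_measurable \<mu>. (f, h) \<in> T \<longrightarrow>
        (AE x in \<mu>. f x = f' x) \<longrightarrow> (AE x in \<mu>. h x = h' x) \<longrightarrow> (f', h') \<in> T) \<and>
     (\<forall>f h h'. (f, h) \<in> T \<longrightarrow> (f, h') \<in> T \<longrightarrow> (AE x in \<mu>. h x = h' x))"

definition l2_adjoint ::
  "'a measure \<Rightarrow> (('a \<Rightarrow> real) \<times> ('a \<Rightarrow> real)) set \<Rightarrow> (('a \<Rightarrow> real) \<times> ('a \<Rightarrow> real)) set" where
  "l2_adjoint \<mu> T =
     {(g, k) \<in> L2 \<mu> \<times> L2 \<mu>. \<forall>(f, h)\<in>T. l2_inner \<mu> h g = l2_inner \<mu> f k}"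

definition nonneg_self_adjoint :: "'a measure \<Rightarrow> (('a \<Rightarrow> real) \<times> ('a \<Rightarrow> real)) set \<Rightarrow> bool" where
  "nonneg_self_adjoint \<mu> T \<longleftrightarrow>
     l2_operator \<mu> T \<and> l2_dense \<mu> (Domain T) \<and> l2_adjoint \<mu> T = T \<and>
     (\<forall>(f, h)\<in>T. l2_inner \<mu> h f \<ge> 0)"

text \<open>A non-negative self-adjoint operator has exactly one non-negative self-adjoint square root;
  the composition of graphs carries the natural domain.\<close>

definition op_sqrt ::
  "'a measure \<Rightarrow> (('a \<Rightarrow> real) \<times> ('a \<Rightarrow> real)) set \<Rightarrow> (('a \<Rightarrow> real) \<times> ('a \<Rightarrow> real)) set" where
  "op_sqrt \<mu> L = (THE S. nonneg_self_adjoint \<mu> S \<and> S O S = L)"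

definition form_domain :: "'a measure \<Rightarrow> (('a \<Rightarrow> real) \<times> ('a \<Rightarrow> real)) set \<Rightarrow> ('a \<Rightarrow> real) set" where
  "form_domain \<mu> L = Domain (op_sqrt \<mu> L)"

definition form_of ::
  "'a measure \<Rightarrow> (('a \<Rightarrow> real) \<times> ('a \<Rightarrow> real)) set \<Rightarrow> ('a \<Rightarrow> real) \<Rightarrow> ('a \<Rightarrow> real) \<Rightarrow> real" where
  "form_of \<mu> L f g =
     l2_inner \<mu> (SOME h. (f, h) \<in> op_sqrt \<mu> L) (SOME h. (g, h) \<in> op_sqrt \<mu> L)"


section \<open>Dirichlet forms\<close>

definition sym_bilinear_on ::
  "('a \<Rightarrow> real) set \<Rightarrow> (('a \<Rightarrow> real) \<Rightarrow> ('a \<Rightarrow> real) \<Rightarrow> real) \<Rightarrow> bool" where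
  "sym_bilinear_on F B \<longleftrightarrow>
     (\<forall>f\<in>F. \<forall>g\<in>F. B f g = B g f) \<and>
     (\<forall>f\<in>F. \<forall>g\<in>F. \<forall>h\<in>F. \<forall>a. B (\<lambda>x. a * f x + g x) h = a * B f h + B g h)"

definition form_norm_sq ::
  "'a measure \<Rightarrow> (('a \<Rightarrow> real) \<Rightarrow> ('a \<Rightarrow> real) \<Rightarrow> real) \<Rightarrow> ('a \<Rightarrow> real) \<Rightarrow> real" where
  "form_norm_sq \<mu> E f = l2_inner \<mu> f f + E f f"

definition dirichlet_form ::
  "'a measure \<Rightarrow> ('a \<Rightarrow> real) set \<Rightarrow> (('a \<Rightarrow> real) \<Rightarrow> ('a \<Rightarrow> real) \<Rightarrow> real) \<Rightarrow> bool" where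
  "dirichlet_form \<mu> F E \<longleftrightarrow>
     l2_subspace \<mu> F \<and> l2_dense \<mu> F \<and> sym_bilinear_on F E \<and>
     (\<forall>f\<in>F. E f f \<ge> 0) \<and>
     (\<forall>f\<in>F. \<forall>f'\<in>F. \<forall>g\<in>F. (AE x in \<mu>. f x = f' x) \<longrightarrow> E f g = E f' g) \<and>
     \<comment> \<open>closedness\<close>
     (\<forall>u :: nat \<Rightarrow> 'a \<Rightarrow> real. (\<forall>n. u n \<in> F) \<longrightarrow>
        (\<forall>e>0. \<exists>N. \<forall>m\<ge>N. \<forall>n\<ge>N. form_norm_sq \<mu> E (\<lambda>x. u m x - u n x) < e) \<longrightarrow>
        (\<exists>f\<in>F. (\<lambda>n. form_norm_sq \<mu> E (\<lambda>x. u n x - f x)) \<longlonglongrightarrow> 0)) \<and>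
     \<comment> \<open>the unit contraction operates\<close>
     (\<forall>f\<in>F. (\<lambda>x. min 1 (max 0 (f x))) \<in> F \<and>
        E (\<lambda>x. min 1 (max 0 (f x))) (\<lambda>x. min 1 (max 0 (f x))) \<le> E f f)"

definition Cc :: "('a::topological_space \<Rightarrow> real) set" where
  "Cc = {\<phi>. continuous_on UNIV \<phi> \<and> compact (closure {x. \<phi> x \<noteq> 0})}"

definition regular_form ::
  "'a::topological_space measure \<Rightarrow> ('a \<Rightarrow> real) set \<Rightarrow> (('a \<Rightarrow> real) \<Rightarrow> ('a \<Rightarrow> real) \<Rightarrow> real) \<Rightarrow> bool" where
  "regular_form \<mu> F E \<longleftrightarrow>
     (\<forall>f\<in>F. \<forall>e>0. \<exists>\<phi>\<in>F \<inter> Cc. form_norm_sq \<mu> E (\<lambda>x. f x - \<phi> x) < e) \<and>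
     (\<forall>\<psi>\<in>Cc. \<forall>e>0. \<exists>\<phi>\<in>F \<inter> Cc. \<forall>x. \<bar>\<psi> x - \<phi> x\<bar> < e)"

text \<open>The support of a class of functions modulo \<open>\<mu>\<close> is the support of the measure \<open>\<bar>f\<bar> d\<mu>\<close>.\<close>

definition ess_supp :: "'a::topological_space measure \<Rightarrow> ('a \<Rightarrow> real) \<Rightarrow> 'a set" where
  "ess_supp \<mu> f = - \<Union>{U. open U \<and> (AE x in \<mu>. x \<in> U \<longrightarrow> f x = 0)}"

definition strongly_local ::
  "'a::topological_space measure \<Rightarrow> ('a \<Rightarrow> real) set \<Rightarrow> (('a \<Rightarrow> real) \<Rightarrow> ('a \<Rightarrow> real) \<Rightarrow> real) \<Rightarrow> bool" where
  "strongly_local \<mu> F E \<longleftrightarrow>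
     (\<forall>f\<in>F. \<forall>g\<in>F. compact (ess_supp \<mu> f) \<longrightarrow> compact (ess_supp \<mu> g) \<longrightarrow>
        (\<exists>U c. open U \<and> ess_supp \<mu> f \<subseteq> U \<and> (AE x in \<mu>. x \<in> U \<longrightarrow> g x = c)) \<longrightarrow>
        E f g = 0)"

text \<open>
  \<open>\<Gamma> f\<close> stands for the measure \<open>d\<Gamma>(f, f)\<close>; the signed measure \<open>d\<Gamma>(f, g)\<close> is recovered by
  polarization.  The energy measure is the symmetric bilinear form on \<open>F\<close> with values in the signed
  measures that represents the Dirichlet form and is given, for bounded \<open>f\<close>, by
  \<open>\<integral> \<phi> d\<Gamma>(f, f) = E(f, \<phi> f) - E(f\<^sup>2, \<phi>) / 2\<close>.  These properties determine it: bounded functions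
  are dense in \<open>F\<close>.  There is no factor \<open>1/2\<close> in \<open>E(f, f) = \<integral> d\<Gamma>(f, f)\<close>.
\<close>

definition energy_pair ::
  "(('a \<Rightarrow> real) \<Rightarrow> 'a measure) \<Rightarrow> ('a \<Rightarrow> real) \<Rightarrow> ('a \<Rightarrow> real) \<Rightarrow> 'a set \<Rightarrow> real" where
  "energy_pair \<Gamma> f g A = (measure (\<Gamma> (\<lambda>x. f x + g x)) A - measure (\<Gamma> (\<lambda>x. f x - g x)) A) / 4"

definition energy_measure ::
  "'a::topological_space measure \<Rightarrow> ('a \<Rightarrow> real) set \<Rightarrow> (('a \<Rightarrow> real) \<Rightarrow> ('a \<Rightarrow> real) \<Rightarrow> real) \<Rightarrow>
   (('a \<Rightarrow> real) \<Rightarrow> 'a measure) \<Rightarrow> bool" where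
  "energy_measure \<mu> F E \<Gamma> \<longleftrightarrow>
     (\<forall>f\<in>F. sets (\<Gamma> f) = sets borel \<and> finite_measure (\<Gamma> f)) \<and>
     (\<forall>A\<in>sets borel. sym_bilinear_on F (\<lambda>f g. energy_pair \<Gamma> f g A) \<and>
        (\<forall>f\<in>F. energy_pair \<Gamma> f f A = measure (\<Gamma> f) A)) \<and>
     (\<forall>f\<in>F. \<forall>g\<in>F. E f g = energy_pair \<Gamma> f g UNIV) \<and>
     (\<forall>f\<in>F. \<forall>\<phi>\<in>F \<inter> Cc. (\<exists>K. AE x in \<mu>. \<bar>f x\<bar> \<le> K) \<longrightarrow>
        (\<integral>x. \<phi> x \<partial>\<Gamma> f) = E f (\<lambda>x. \<phi> x * f x) - E (\<lambda>x. (f x)\<^sup>2) \<phi> / 2)"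

definition F_loc :: "'a::topological_space measure \<Rightarrow> ('a \<Rightarrow> real) set \<Rightarrow> ('a \<Rightarrow> real) set" where
  "F_loc \<mu> F = {f \<in> borel_measurable \<mu>. \<forall>G. open G \<longrightarrow> compact (closure G) \<longrightarrow>
     (\<exists>g\<in>F. AE x in \<mu>. x \<in> G \<longrightarrow> f x = g x)}"

text \<open>For \<open>f \<in> F_loc\<close>, the measure \<open>d\<Gamma>(f, f)\<close> is obtained by gluing the measures \<open>d\<Gamma>(g, g)\<close> of the
  elements \<open>g\<close> of \<open>F\<close> that coincide with \<open>f\<close> on relatively compact open sets.\<close>

definition loc_energy_measure ::
  "'a::topological_space measure \<Rightarrow> ('a \<Rightarrow> real) set \<Rightarrow> (('a \<Rightarrow> real) \<Rightarrow> 'a measure) \<Rightarrow>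
   ('a \<Rightarrow> real) \<Rightarrow> 'a measure \<Rightarrow> bool" where
  "loc_energy_measure \<mu> F \<Gamma> f \<nu> \<longleftrightarrow> sets \<nu> = sets borel \<and>
     (\<forall>G. open G \<longrightarrow> compact (closure G) \<longrightarrow>
       (\<forall>g\<in>F. (AE x in \<mu>. x \<in> G \<longrightarrow> f x = g x) \<longrightarrow>
         (\<forall>A\<in>sets borel. A \<subseteq> G \<longrightarrow> emeasure \<nu> A = emeasure (\<Gamma> g) A)))"


section \<open>Standing assumptions\<close>

text \<open>Completeness and separability of the metric space are part of the class \<open>polish_space\<close>.\<close>

definition condition_H ::
  "'a::polish_space measure \<Rightarrow> (('a \<Rightarrow> real) \<times> ('a \<Rightarrow> real)) set \<Rightarrow>
   (('a \<Rightarrow> real) \<Rightarrow> 'a measure) \<Rightarrow> bool" where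
  "condition_H \<mu> L \<Gamma> \<longleftrightarrow>
     locally compact (UNIV :: 'a set) \<and>
     sets \<mu> = sets borel \<and>
     (\<forall>K. compact K \<longrightarrow> emeasure \<mu> K < \<infinity>) \<and>
     (\<forall>U. open U \<longrightarrow> U \<noteq> {} \<longrightarrow> emeasure \<mu> U > 0) \<and>
     nonneg_self_adjoint \<mu> L \<and>
     dirichlet_form \<mu> (form_domain \<mu> L) (form_of \<mu> L) \<and>
     strongly_local \<mu> (form_domain \<mu> L) (form_of \<mu> L) \<and>
     regular_form \<mu> (form_domain \<mu> L) (form_of \<mu> L) \<and>
     energy_measure \<mu> (form_domain \<mu> L) (form_of \<mu> L) \<Gamma> \<and>
     (\<forall>x. (\<lambda>y. dist x y) \<in> F_loc \<mu> (form_domain \<mu> L) \<and>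
        (\<exists>\<nu>. loc_energy_measure \<mu> (form_domain \<mu> L) \<Gamma> (\<lambda>y. dist x y) \<nu> \<and>
             (\<forall>A\<in>sets borel. emeasure \<nu> A \<le> emeasure \<mu> A)))"

definition volume :: "'a::metric_space measure \<Rightarrow> 'a \<Rightarrow> real \<Rightarrow> ennreal" where
  "volume \<mu> x r = emeasure \<mu> (ball x r)"

definition volume_finite_pos :: "'a::metric_space measure \<Rightarrow> bool" where
  "volume_finite_pos \<mu> \<longleftrightarrow> (\<forall>x. \<forall>r>0. 0 < volume \<mu> x r \<and> volume \<mu> x r < \<infinity>)"

definition volume_doubling :: "'a::metric_space measure \<Rightarrow> bool" where
  "volume_doubling \<mu> \<longleftrightarrow>
     (\<exists>C>0. \<forall>x. \<forall>r>0. volume \<mu> x (2 * r) \<le> ennreal C * volume \<mu> x r)"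

text \<open>\<open>v\<close> takes finite values, so ``a.e. finite'' carries no further content.\<close>

definition condition_A :: "'a measure \<Rightarrow> ('a \<Rightarrow> real \<Rightarrow> real) \<Rightarrow> bool" where
  "condition_A \<mu> v \<longleftrightarrow>
     (\<forall>x. \<forall>r>0. 0 \<le> v x r) \<and>
     (\<forall>r>0. (\<lambda>x. v x r) \<in> borel_measurable \<mu>) \<and>
     (\<forall>r>0. AE x in \<mu>. 0 < v x r) \<and>
     (AE x in \<mu>. \<forall>r s. 0 < r \<longrightarrow> r \<le> s \<longrightarrow> v x r \<le> v x s)"

definition condition_D' :: "('a::metric_space \<Rightarrow> real \<Rightarrow> real) \<Rightarrow> bool" where
  "condition_D' v \<longleftrightarrow> (\<exists>C>0. \<forall>x y. \<forall>r>0. dist x y \<le> r \<longrightarrow> v y r \<le> C * v x r)"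


section \<open>The three inequalities\<close>

definition GN ::
  "'a::topological_space measure \<Rightarrow> ('a \<Rightarrow> real) set \<Rightarrow> (('a \<Rightarrow> real) \<Rightarrow> ('a \<Rightarrow> real) \<Rightarrow> real) \<Rightarrow>
   ('a \<Rightarrow> real \<Rightarrow> real) \<Rightarrow> real \<Rightarrow> bool" where
  "GN \<mu> F E v q \<longleftrightarrow> (\<exists>C>0. \<forall>r>0. \<forall>f\<in>F.
     (lp_norm \<mu> q (\<lambda>x. f x * v x r powr (1/2 - 1/q)))\<^sup>2
       \<le> ennreal (C * (l2_inner \<mu> f f + r\<^sup>2 * E f f)))"

text \<open>In \<open>ennreal\<close> the infimum over the empty support of \<open>f = 0\<close> is \<open>\<infinity>\<close>, and \<open>\<infinity> * 0 = 0\<close>.\<close>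

definition KGN ::
  "'a::topological_space measure \<Rightarrow> ('a \<Rightarrow> real) set \<Rightarrow> (('a \<Rightarrow> real) \<Rightarrow> ('a \<Rightarrow> real) \<Rightarrow> real) \<Rightarrow>
   ('a \<Rightarrow> real \<Rightarrow> real) \<Rightarrow> real \<Rightarrow> bool" where
  "KGN \<mu> F E v q \<longleftrightarrow> (\<exists>C>0. \<forall>r>0. \<forall>f\<in>F.
     (INF z\<in>ess_supp \<mu> f. ennreal (v z r powr (1 - 2/q))) * (lp_norm \<mu> q f)\<^sup>2
       \<le> ennreal (C * (l2_inner \<mu> f f + r\<^sup>2 * E f f)))"

definition F_c :: "'a::topological_space measure \<Rightarrow> ('a \<Rightarrow> real) set \<Rightarrow> 'a set \<Rightarrow> ('a \<Rightarrow> real) set" where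
  "F_c \<mu> F B = {f \<in> F. compact (ess_supp \<mu> f) \<and> ess_supp \<mu> f \<subseteq> B}"

text \<open>The quotient is taken in \<open>ennreal\<close>, so that it is \<open>\<infinity>\<close> if \<open>v x r = 0\<close>.\<close>

definition LS ::
  "'a::metric_space measure \<Rightarrow> ('a \<Rightarrow> real) set \<Rightarrow> (('a \<Rightarrow> real) \<Rightarrow> ('a \<Rightarrow> real) \<Rightarrow> real) \<Rightarrow>
   ('a \<Rightarrow> real \<Rightarrow> real) \<Rightarrow> real \<Rightarrow> bool" where
  "LS \<mu> F E v q \<longleftrightarrow> (\<exists>C>0. \<forall>x. \<forall>r>0. \<forall>f\<in>F_c \<mu> F (ball x r).
     (lp_norm \<mu> q f)\<^sup>2
       \<le> ennreal C / ennreal (v x r powr (1 - 2/q)) * ennreal (l2_inner \<mu> f f + r\<^sup>2 * E f f))"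

end

theory Submission
  imports Defs
begin

text \<open>
  The step from \<open>LS\<close> to \<open>GN\<close> localizes: cover by balls \<open>B(x\<^sub>i, r/4)\<close> with bounded overlap, apply \<open>LS\<close>
  to \<open>f \<phi>\<^sub>i\<close> with tents \<open>\<phi>\<^sub>i\<close> of radius \<open>r/2\<close>, and sum, which needs
  \<open>E(f \<phi>) \<le> 2 \<integral> \<phi>\<^sup>2 d\<Gamma>(f) + 2 \<integral> f\<^sup>2 d\<Gamma>(\<phi>)\<close> on the algebra \<open>A\<close> of continuous compactly supported elements
  of the form domain.  Through \<open>\<integral> \<psi> d\<Gamma>(f) = E(f, \<psi> f) - E(f\<^sup>2, \<psi>) / 2\<close> the Leibniz rule behind this bound is
  the polarization of \<open>4 E(f, f\<^sup>3) = 3 E(f\<^sup>2, f\<^sup>2)\<close>, and that identity follows from strong locality by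
  cutting \<open>f\<close> repeatedly at half its height.
\<close>

section \<open>Non-negative forms and lower semicontinuity of the energy\<close>

text \<open>The hypotheses contain no chain rule: \<open>energy_measure\<close> only ties \<Gamma>
  to the form, tested against functions in \<open>F \<inter> Cc\<close>, and strong locality only
  says that certain mixed energies vanish. Every calculus fact is therefore extracted from vanishing
  mixed energies of truncations, and products enter the form domain as limits of sums of
  truncations. Cutting at a height suits non-negative functions, so signed functions are reached
  through positive and negative parts, and the whole form domain through density. Doubling has two
  roles: with completeness it makes closed balls compact, so that distance functions can be cut off,
  and it makes the cover of a compact support finite with bounded overlap. The local bounds can be
  added because q/2 > 1, and \<open>condition_D'\<close> moves the weight from a point to a nearby
  centre. The implications from \<open>GN\<close> to \<open>KGN\<close> to \<open>LS\<close> only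
  compare the weight with its infimum on the support and with its value at the centre.\<close>

lemma L2_comb:
  assumes "f \<in> L2 \<mu>" "g \<in> L2 \<mu>"
  shows "(\<lambda>x. a * f x + g x) \<in> L2 \<mu>"
proof -
  have m: "f \<in> borel_measurable \<mu>" "g \<in> borel_measurable \<mu>"
    and i: "integrable \<mu> (\<lambda>x. (f x)\<^sup>2)" "integrable \<mu> (\<lambda>x. (g x)\<^sup>2)"
    using assms by (auto simp: L2_def)
  have "integrable \<mu> (\<lambda>x. (a * f x + g x)\<^sup>2)"
  proof (rule Bochner_Integration.integrable_bound)
    show "integrable \<mu> (\<lambda>x. 2 * a\<^sup>2 * (f x)\<^sup>2 + 2 * (g x)\<^sup>2)" using i by auto
    have "(a * s + t)\<^sup>2 \<le> 2 * a\<^sup>2 * s\<^sup>2 + 2 * t\<^sup>2" for s t :: real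
      using zero_le_power2[of "a * s - t"] by (simp add: power2_eq_square algebra_simps)
    then show "AE x in \<mu>. norm ((a * f x + g x)\<^sup>2) \<le> norm (2 * a\<^sup>2 * (f x)\<^sup>2 + 2 * (g x)\<^sup>2)"
      by (auto intro!: AE_I2)
  qed (use m in measurable)
  then show ?thesis using m by (auto simp: L2_def)
qed

lemma L2_integrable_mult:
  assumes "f \<in> L2 \<mu>" "g \<in> L2 \<mu>"
  shows "integrable \<mu> (\<lambda>x. f x * g x)"
proof -
  have m: "f \<in> borel_measurable \<mu>" "g \<in> borel_measurable \<mu>"
    and i: "integrable \<mu> (\<lambda>x. (f x)\<^sup>2)" "integrable \<mu> (\<lambda>x. (g x)\<^sup>2)"
    using assms by (auto simp: L2_def)
  show ?thesis
  proof (rule Bochner_Integration.integrable_bound)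
    show "integrable \<mu> (\<lambda>x. (f x)\<^sup>2 + (g x)\<^sup>2)" using i by auto
    have "\<bar>s * t\<bar> \<le> s\<^sup>2 + t\<^sup>2" for s t :: real
    proof -
      have "2 * \<bar>s * t\<bar> \<le> s\<^sup>2 + t\<^sup>2"
        using zero_le_power2[of "\<bar>s\<bar> - \<bar>t\<bar>"] by (simp add: power2_diff abs_mult)
      then show ?thesis using abs_ge_zero[of "s * t"] by linarith
    qed
    then show "AE x in \<mu>. norm (f x * g x) \<le> norm ((f x)\<^sup>2 + (g x)\<^sup>2)"
      by (auto intro!: AE_I2)
  qed (use m in measurable)
qed

text \<open>Cauchy-Schwarz and the parallelogram law serve five forms: the L2 product, the energy on
  \<open>F\<close> and on \<open>A\<close>, \<open>energy_pair\<close> on a fixed Borel set, and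
  \<open>weighted_form a\<close> for non-negative a. All may be degenerate, hence a locale for
  semi-definite forms.\<close>

locale nonneg_form =
  fixes V :: "('a \<Rightarrow> real) set" and B :: "('a \<Rightarrow> real) \<Rightarrow> ('a \<Rightarrow> real) \<Rightarrow> real"
  assumes zero_mem: "(\<lambda>_. 0) \<in> V"
    and comb_mem: "\<And>f g a. f \<in> V \<Longrightarrow> g \<in> V \<Longrightarrow> (\<lambda>x. a * f x + g x) \<in> V"
    and bilinear: "sym_bilinear_on V B"
    and nonneg: "\<And>f. f \<in> V \<Longrightarrow> 0 \<le> B f f"
begin

lemma sym: "f \<in> V \<Longrightarrow> g \<in> V \<Longrightarrow> B f g = B g f"
  using bilinear by (auto simp: sym_bilinear_on_def)

lemma comb_left: "f \<in> V \<Longrightarrow> g \<in> V \<Longrightarrow> h \<in> V \<Longrightarrow> B (\<lambda>x. a * f x + g x) h = a * B f h + B g h"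
  using bilinear by (auto simp: sym_bilinear_on_def)

lemma cmult_mem: "f \<in> V \<Longrightarrow> (\<lambda>x. a * f x) \<in> V"
  using comb_mem[of f "\<lambda>_. 0" a] zero_mem by simp

lemma add_mem: "f \<in> V \<Longrightarrow> g \<in> V \<Longrightarrow> (\<lambda>x. f x + g x) \<in> V"
  using comb_mem[of f g 1] by simp

lemma diff_mem: "f \<in> V \<Longrightarrow> g \<in> V \<Longrightarrow> (\<lambda>x. f x - g x) \<in> V"
  using comb_mem[of g f "-1"] by simp

lemma add_left: "f \<in> V \<Longrightarrow> g \<in> V \<Longrightarrow> h \<in> V \<Longrightarrow> B (\<lambda>x. f x + g x) h = B f h + B g h"
  using comb_left[of f g h 1] by simp

lemma zero_left: "h \<in> V \<Longrightarrow> B (\<lambda>x. 0) h = 0"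
  using add_left[of "\<lambda>_. 0" "\<lambda>_. 0" h] zero_mem by simp

lemma cmult_left: "f \<in> V \<Longrightarrow> h \<in> V \<Longrightarrow> B (\<lambda>x. a * f x) h = a * B f h"
  using comb_left[of f "\<lambda>_. 0" h a] zero_left zero_mem by simp

lemma diff_left: "f \<in> V \<Longrightarrow> g \<in> V \<Longrightarrow> h \<in> V \<Longrightarrow> B (\<lambda>x. f x - g x) h = B f h - B g h"
  using comb_left[of g f h "-1"] by simp

lemma zero_right: "h \<in> V \<Longrightarrow> B h (\<lambda>x. 0) = 0"
  using zero_left[of h] sym[of h "\<lambda>x. 0"] zero_mem by simp

lemma add_right: "f \<in> V \<Longrightarrow> g \<in> V \<Longrightarrow> h \<in> V \<Longrightarrow> B h (\<lambda>x. f x + g x) = B h f + B h g"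
  using add_left[of f g h] sym[of h "\<lambda>x. f x + g x"] sym[of h f] sym[of h g] add_mem[of f g] by simp

lemma cmult_right: "f \<in> V \<Longrightarrow> h \<in> V \<Longrightarrow> B h (\<lambda>x. a * f x) = a * B h f"
  using cmult_left[of f h a] sym[of h "\<lambda>x. a * f x"] sym[of h f] cmult_mem[of f a] by simp

lemma diff_right: "f \<in> V \<Longrightarrow> g \<in> V \<Longrightarrow> h \<in> V \<Longrightarrow> B h (\<lambda>x. f x - g x) = B h f - B h g"
  using diff_left[of f g h] sym[of h "\<lambda>x. f x - g x"] sym[of h f] sym[of h g] diff_mem[of f g] by simp

lemmas mems = cmult_mem add_mem diff_mem zero_mem
lemmas lins = add_left add_right cmult_left cmult_right diff_left diff_right zero_left zero_right

lemma Cauchy_Schwarz: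
  assumes "f \<in> V" "g \<in> V"
  shows "\<bar>B f g\<bar> \<le> sqrt (B f f) * sqrt (B g g)"
proof -
  have q: "0 \<le> B f f + 2 * t * B f g + t\<^sup>2 * B g g" for t
  proof -
    have "0 \<le> B (\<lambda>x. f x + t * g x) (\<lambda>x. f x + t * g x)"
      using assms by (intro nonneg mems)
    also have "\<dots> = B f f + 2 * t * B f g + t\<^sup>2 * B g g"
      using assms sym[of g f] by (simp add: lins mems power2_eq_square algebra_simps)
    finally show ?thesis .
  qed
  have "(B f g)\<^sup>2 \<le> B f f * B g g"
  proof (cases "B g g = 0")
    case True
    have "B f g = 0"
    proof (rule ccontr)
      assume "B f g \<noteq> 0"
      \<comment> \<open>With \<open>B g g = 0\<close> the expression in \<open>q\<close> is affine
        in t, and this t makes it equal to -1.\<close>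
      then show False using q[of "- (B f f + 1) / (2 * B f g)"] True by (simp add: field_simps)
    qed
    then show ?thesis by (simp add: True)
  next
    case False
    then have p: "0 < B g g" using nonneg[of g] assms by simp
    have "0 \<le> B f f - (B f g)\<^sup>2 / B g g"
      using q[of "- B f g / B g g"] p by (simp add: field_simps power2_eq_square)
    then show ?thesis using p by (simp add: field_simps)
  qed
  then have "sqrt ((B f g)\<^sup>2) \<le> sqrt (B f f * B g g)" by (rule real_sqrt_le_mono)
  then show ?thesis by (simp add: real_sqrt_mult)
qed

lemma sqrt_add_le:
  assumes "f \<in> V" "g \<in> V"
  shows "sqrt (B (\<lambda>x. f x + g x) (\<lambda>x. f x + g x)) \<le> sqrt (B f f) + sqrt (B g g)"
proof (rule real_le_lsqrt)
  show "0 \<le> sqrt (B f f) + sqrt (B g g)" using assms nonneg by simp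
  have "B (\<lambda>x. f x + g x) (\<lambda>x. f x + g x) = B f f + 2 * B f g + B g g"
    using assms sym[of g f] by (simp add: lins mems)
  also have "\<dots> \<le> B f f + 2 * (sqrt (B f f) * sqrt (B g g)) + B g g"
    using Cauchy_Schwarz[OF assms] by linarith
  also have "\<dots> = (sqrt (B f f) + sqrt (B g g))\<^sup>2"
    using assms nonneg by (simp add: power2_sum)
  finally show "B (\<lambda>x. f x + g x) (\<lambda>x. f x + g x) \<le> (sqrt (B f f) + sqrt (B g g))\<^sup>2" .
qed

lemma sqrt_cmult: "f \<in> V \<Longrightarrow> sqrt (B (\<lambda>x. a * f x) (\<lambda>x. a * f x)) = \<bar>a\<bar> * sqrt (B f f)"
  by (simp add: lins mems real_sqrt_mult)

lemma sqrt_diff_le: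
  assumes "f \<in> V" "g \<in> V"
  shows "sqrt (B (\<lambda>x. f x - g x) (\<lambda>x. f x - g x)) \<le> sqrt (B f f) + sqrt (B g g)"
  using sqrt_add_le[of f "\<lambda>x. - 1 * g x"] sqrt_cmult[of g "-1"] cmult_mem[of g "-1"] assms by simp

lemma parallelogram:
  assumes "f \<in> V" "g \<in> V"
  shows "B (\<lambda>x. f x + g x) (\<lambda>x. f x + g x) + B (\<lambda>x. f x - g x) (\<lambda>x. f x - g x) = 2 * B f f + 2 * B g g"
  using assms by (simp add: lins mems)

lemma cmult_both: "f \<in> V \<Longrightarrow> B (\<lambda>x. a * f x) (\<lambda>x. a * f x) = a\<^sup>2 * B f f"
  by (simp add: lins mems power2_eq_square)

end

lemma nonneg_form_L2: "nonneg_form (L2 \<mu>) (l2_inner \<mu>)"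
proof
  show "(\<lambda>_. 0) \<in> L2 \<mu>" by (simp add: L2_def)
  show "sym_bilinear_on (L2 \<mu>) (l2_inner \<mu>)"
    unfolding sym_bilinear_on_def l2_inner_def
    by (auto simp: mult.commute) (auto simp: distrib_left mult.left_commute mult.commute L2_integrable_mult)
  show "0 \<le> l2_inner \<mu> f f" for f by (simp add: l2_inner_def)
qed (rule L2_comb)

interpretation L2: nonneg_form "L2 \<mu>" "l2_inner \<mu>" for \<mu> :: "'a measure"
  by (rule nonneg_form_L2)

lemma l2_inner_eq_0_AE:
  assumes "f \<in> L2 \<mu>" "l2_inner \<mu> f f = 0"
  shows "AE x in \<mu>. f x = 0"
proof -
  have "AE x in \<mu>. f x * f x = 0"
    using integral_nonneg_eq_0_iff_AE[OF L2_integrable_mult[OF assms(1,1)]] assms(2)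
    by (auto simp: l2_inner_def)
  then show ?thesis by simp
qed

section \<open>Closedness and lower semicontinuity of the Dirichlet form\<close>

locale strongly_local_form =
  fixes \<mu> :: "'a::polish_space measure"
    and F :: "('a \<Rightarrow> real) set" and E :: "('a \<Rightarrow> real) \<Rightarrow> ('a \<Rightarrow> real) \<Rightarrow> real"
  assumes sets_mu: "sets \<mu> = sets borel"
    and finite_compact: "\<And>K. compact K \<Longrightarrow> emeasure \<mu> K < \<infinity>"
    and dirichlet: "dirichlet_form \<mu> F E"
    and strong_locality: "strongly_local \<mu> F E"
    and regular: "regular_form \<mu> F E"
begin

lemma subspace: "l2_subspace \<mu> F"
  using dirichlet unfolding dirichlet_form_def by (elim conjE)

sublocale nonneg_form F E
proof
  show "sym_bilinear_on F E" using dirichlet unfolding dirichlet_form_def by (elim conjE)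
  show "0 \<le> E f f" if "f \<in> F" for f
    using dirichlet that unfolding dirichlet_form_def by (elim conjE) (erule (1) bspec)
  show "(\<lambda>_. 0) \<in> F" using subspace unfolding l2_subspace_def by (elim conjE)
  show "(\<lambda>x. a * f x + g x) \<in> F" if "f \<in> F" "g \<in> F" for f g a
    using subspace that unfolding l2_subspace_def by blast
qed

lemma F_L2: "f \<in> F \<Longrightarrow> f \<in> L2 \<mu>"
  using subspace unfolding l2_subspace_def by blast

lemma F_AE_cong:
  "f \<in> F \<Longrightarrow> g \<in> borel_measurable \<mu> \<Longrightarrow> (AE x in \<mu>. f x = g x) \<Longrightarrow> g \<in> F"
  using subspace unfolding l2_subspace_def by blast

lemma E_AE_cong: 
  assumes "f \<in> F" "f' \<in> F" "AE x in \<mu>. f x = f' x"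
  shows "E f f = E f' f'"
proof -
  have "E f g = E f' g" if "g \<in> F" for g
    using dirichlet assms that unfolding dirichlet_form_def by blast
  from this[OF assms(1)] this[OF assms(2)] show ?thesis
    using sym[OF assms(1,2)] by simp
qed

lemma L2_AE_limit_unique:
  assumes "f \<in> L2 \<mu>" "f' \<in> L2 \<mu>" "\<And>n. g n \<in> L2 \<mu>"
    and lim: "(\<lambda>n. l2_inner \<mu> (\<lambda>x. g n x - f x) (\<lambda>x. g n x - f x)) \<longlonglongrightarrow> 0"
      "(\<lambda>n. l2_inner \<mu> (\<lambda>x. g n x - f' x) (\<lambda>x. g n x - f' x)) \<longlonglongrightarrow> 0"
  shows "AE x in \<mu>. f x = f' x"
proof -
  let ?N = "\<lambda>h. sqrt (l2_inner \<mu> h h)"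
  have le: "?N (\<lambda>x. f' x - f x) \<le> ?N (\<lambda>x. g n x - f x) + ?N (\<lambda>x. g n x - f' x)" for n
    using L2.sqrt_diff_le[of "\<lambda>x. g n x - f x" \<mu> "\<lambda>x. g n x - f' x"] assms
    by (simp add: L2.mems)
  have "(\<lambda>n. ?N (\<lambda>x. g n x - f x) + ?N (\<lambda>x. g n x - f' x)) \<longlonglongrightarrow> sqrt 0 + sqrt 0"
    using lim by (intro tendsto_intros)
  then have "?N (\<lambda>x. f' x - f x) \<le> sqrt 0 + sqrt 0"
    by (rule LIMSEQ_le_const) (use le in auto)
  then have "l2_inner \<mu> (\<lambda>x. f' x - f x) (\<lambda>x. f' x - f x) = 0"
    using L2.nonneg[of "\<lambda>x. f' x - f x" \<mu>] assms by (simp add: L2.mems)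
  then have "AE x in \<mu>. f' x - f x = 0"
    using assms by (intro l2_inner_eq_0_AE) (simp_all add: L2.mems)
  then show ?thesis by (auto elim: AE_mp)
qed

lemma closedness:
  assumes "\<And>n. u n \<in> F"
    and "\<And>e. e > 0 \<Longrightarrow> \<exists>N. \<forall>m\<ge>N. \<forall>n\<ge>N. form_norm_sq \<mu> E (\<lambda>x. u m x - u n x) < e"
  obtains f where "f \<in> F" "(\<lambda>n. form_norm_sq \<mu> E (\<lambda>x. u n x - f x)) \<longlonglongrightarrow> 0"
  using dirichlet assms unfolding dirichlet_form_def by blast

text \<open>Minimising the energy over the convex sets of those \<open>g\<close> that lie \<open>e\<close>-close to \<open>f\<close> in
  \<open>L\<^sup>2\<close> produces, by the parallelogram law, a Cauchy sequence for the form norm.\<close>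

lemma energy_lsc:
  assumes f: "f \<in> L2 \<mu>"
    and approx: "\<And>e. e > 0 \<Longrightarrow> \<exists>g\<in>F. l2_inner \<mu> (\<lambda>x. g x - f x) (\<lambda>x. g x - f x) \<le> e \<and> E g g \<le> K"
  shows "f \<in> F" "E f f \<le> K"
proof -
  let ?n2 = "\<lambda>g. l2_inner \<mu> (\<lambda>x. g x - f x) (\<lambda>x. g x - f x)"
  define C where "C n = {g \<in> F. ?n2 g \<le> inverse (real (Suc n)) \<and> E g g \<le> K}" for n
  define d where "d n = (INF g\<in>C n. E g g)" for n
  have ne: "C n \<noteq> {}" for n using approx[of "inverse (real (Suc n))"] by (auto simp: C_def)
  have bdd: "bdd_below ((\<lambda>g. E g g) ` C n)" for n
    by (rule bdd_belowI[of _ 0]) (auto simp: C_def nonneg)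
  have sub: "C m \<subseteq> C n" if "n \<le> m" for m n
  proof -
    have "inverse (real (Suc m)) \<le> inverse (real (Suc n))" using that by (intro le_imp_inverse_le) auto
    then show ?thesis unfolding C_def using order_trans by blast
  qed
  have d_le: "d n \<le> E g g" if "g \<in> C n" for g n
    unfolding d_def by (rule cINF_lower[OF bdd that])
  have d_mono: "d n \<le> d m" if "n \<le> m" for m n
    unfolding d_def by (rule cINF_superset_mono[OF ne bdd sub[OF that]]) auto
  have dK: "d n \<le> K" for n
  proof -
    obtain g where "g \<in> C n" using ne by blast
    then show ?thesis using d_le[of g n] by (auto simp: C_def)
  qed
  have "\<exists>g\<in>C n. E g g < d n + inverse (real (Suc n))" for n
  proof -
    have "Inf ((\<lambda>g. E g g) ` C n) < d n + inverse (real (Suc n))" by (simp add: d_def)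
    then show ?thesis using cInf_lessD[of "(\<lambda>g. E g g) ` C n"] ne by fastforce
  qed
  then obtain g where gC: "\<And>n. g n \<in> C n" and gd: "\<And>n. E (g n) (g n) < d n + inverse (real (Suc n))"
    by metis
  have gF: "g n \<in> F" for n using gC by (auto simp: C_def)
  have gL: "g n \<in> L2 \<mu>" for n using gF F_L2 by auto
  have g2: "?n2 (g n) \<le> inverse (real (Suc n))" for n using gC by (auto simp: C_def)
  \<comment> \<open>For n \<le> m the value \<open>b n m\<close> collects 4 / (n + 1) from the L2
    part and 2 d m - 2 d n + 4 / (n + 1) from the energy part; it is small for large n because d is
    increasing and bounded.\<close>
  define b where "b N n = (2 * d n - 2 * d N + 8 * inverse (real (Suc N)))" for N n
  have key: "form_norm_sq \<mu> E (\<lambda>x. g m x - g n x) \<le> b n m" if "n \<le> m" for m n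
  proof -
    let ?i = "inverse (real (Suc n))"
    have im: "inverse (real (Suc m)) \<le> ?i" using that by (intro le_imp_inverse_le) auto
    \<comment> \<open>The midpoint again belongs to \<open>C n\<close>, so its energy is at least
      \<open>d n\<close>; with this lower bound the parallelogram law for E bounds the energy of the
      difference.\<close>
    let ?h = "\<lambda>x. (1/2) * (g m x + g n x)"
    have hF: "?h \<in> F" using gF by (intro mems) auto
    have par: "l2_inner \<mu> (\<lambda>x. g m x + g n x - 2 * f x) (\<lambda>x. g m x + g n x - 2 * f x)
         + l2_inner \<mu> (\<lambda>x. g m x - g n x) (\<lambda>x. g m x - g n x) = 2 * ?n2 (g m) + 2 * ?n2 (g n)"
      using L2.parallelogram[of "\<lambda>x. g m x - f x" \<mu> "\<lambda>x. g n x - f x"] gL f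
      by (simp add: L2.mems algebra_simps)
    have "?n2 ?h = l2_inner \<mu> (\<lambda>x. (1/2) * (g m x + g n x - 2 * f x)) (\<lambda>x. (1/2) * (g m x + g n x - 2 * f x))"
      by (simp add: algebra_simps)
    also have "\<dots> = (1/4) * l2_inner \<mu> (\<lambda>x. g m x + g n x - 2 * f x) (\<lambda>x. g m x + g n x - 2 * f x)"
      using L2.cmult_both[of "\<lambda>x. g m x + g n x - 2 * f x" \<mu> "1/2"] gL f
      by (simp add: L2.mems power2_eq_square)
    finally have h2: "?n2 ?h = (1/4) * l2_inner \<mu> (\<lambda>x. g m x + g n x - 2 * f x) (\<lambda>x. g m x + g n x - 2 * f x)" .
    have p1: "0 \<le> l2_inner \<mu> (\<lambda>x. g m x - g n x) (\<lambda>x. g m x - g n x)"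
      and p2: "0 \<le> l2_inner \<mu> (\<lambda>x. g m x + g n x - 2 * f x) (\<lambda>x. g m x + g n x - 2 * f x)"
      using gL f by (intro L2.nonneg L2.mems; simp)+
    have l1: "?n2 ?h \<le> ?i" using h2 par p1 g2[of m] g2[of n] im by linarith
    have l2: "l2_inner \<mu> (\<lambda>x. g m x - g n x) (\<lambda>x. g m x - g n x) \<le> 4 * ?i"
      using par p2 g2[of m] g2[of n] im by linarith
    have Epar: "4 * E ?h ?h + E (\<lambda>x. g m x - g n x) (\<lambda>x. g m x - g n x) = 2 * E (g m) (g m) + 2 * E (g n) (g n)"
      using parallelogram[of "g m" "g n"] cmult_both[of "\<lambda>x. g m x + g n x" "1/2"] gF
      by (simp add: mems power2_eq_square)
    have "0 \<le> E (\<lambda>x. g m x - g n x) (\<lambda>x. g m x - g n x)" using gF by (intro nonneg mems)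
    then have "E ?h ?h \<le> K" using Epar gC[of m] gC[of n] by (auto simp: C_def)
    then have "?h \<in> C n" using l1 hF by (auto simp: C_def)
    then have "d n \<le> E ?h ?h" by (rule d_le)
    then have "E (\<lambda>x. g m x - g n x) (\<lambda>x. g m x - g n x) \<le> 2 * d m - 2 * d n + 4 * ?i"
      using Epar gd[of m] gd[of n] im by linarith
    then show ?thesis unfolding form_norm_sq_def b_def using l2 by linarith
  qed
  have fn_sym: "form_norm_sq \<mu> E (\<lambda>x. g m x - g n x) = form_norm_sq \<mu> E (\<lambda>x. g n x - g m x)" for m n
    using gF gL by (simp add: form_norm_sq_def lins mems L2.lins L2.mems)
  have "0 \<le> d n" for n
    unfolding d_def by (rule cINF_greatest[OF ne]) (auto simp: C_def nonneg)
  then have "Bseq d" using dK by (intro BseqI'[of _ K]) simp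
  then have "convergent d" by (rule Bseq_monoseq_convergent) (auto simp: monoseq_def d_mono)
  then have "Cauchy d" by (simp add: convergent_Cauchy)
  have cau: "\<exists>N. \<forall>m\<ge>N. \<forall>n\<ge>N. form_norm_sq \<mu> E (\<lambda>x. g m x - g n x) < e" if "e > 0" for e
  proof -
    obtain N1 where N1: "\<And>m n. m \<ge> N1 \<Longrightarrow> n \<ge> N1 \<Longrightarrow> \<bar>d m - d n\<bar> < e / 4"
      using \<open>Cauchy d\<close> \<open>e > 0\<close> unfolding Cauchy_def dist_real_def by (metis divide_pos_pos zero_less_numeral)
    obtain N2 where N2: "inverse (real (Suc N2)) < e / 16"
      using reals_Archimedean[of "e / 16"] \<open>e > 0\<close> by auto
    have main: "form_norm_sq \<mu> E (\<lambda>x. g m x - g n x) < e" if "n \<ge> max N1 N2" "m \<ge> n" for m n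
    proof -
      have "inverse (real (Suc n)) \<le> inverse (real (Suc N2))"
        using that by (intro le_imp_inverse_le) auto
      moreover have "\<bar>d m - d n\<bar> < e / 4" using N1[of m n] that by simp
      ultimately have "b n m < e" using N2 unfolding b_def by linarith
      then show ?thesis using key[OF that(2)] by linarith
    qed
    show ?thesis using main fn_sym by (metis nle_le)
  qed
  obtain f' where f': "f' \<in> F" and lim: "(\<lambda>n. form_norm_sq \<mu> E (\<lambda>x. g n x - f' x)) \<longlonglongrightarrow> 0"
    using closedness[of g] gF cau by auto
  have f'L: "f' \<in> L2 \<mu>" using f' F_L2 by auto
  have lim2: "(\<lambda>n. l2_inner \<mu> (\<lambda>x. g n x - f' x) (\<lambda>x. g n x - f' x)) \<longlonglongrightarrow> 0"
    by (rule tendsto_sandwich[OF _ _ tendsto_const lim]; rule always_eventually; rule allI)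
       (use gF f' gL f'L in \<open>auto simp: form_norm_sq_def nonneg L2.nonneg mems L2.mems\<close>)
  have limE: "(\<lambda>n. E (\<lambda>x. g n x - f' x) (\<lambda>x. g n x - f' x)) \<longlonglongrightarrow> 0"
    by (rule tendsto_sandwich[OF _ _ tendsto_const lim]; rule always_eventually; rule allI)
       (use gF f' gL f'L in \<open>auto simp: form_norm_sq_def nonneg L2.nonneg mems L2.mems\<close>)
  have lim1: "(\<lambda>n. ?n2 (g n)) \<longlonglongrightarrow> 0"
    by (rule tendsto_sandwich[OF _ _ tendsto_const LIMSEQ_inverse_real_of_nat]; rule always_eventually; rule allI)
       (use gL f g2 in \<open>auto simp: L2.nonneg L2.mems\<close>)
  \<comment> \<open>f' and f are both L2 limits of \<open>g\<close>, so they agree almost everywhere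
    and f inherits membership in \<open>F\<close>.\<close>
  have ae: "AE x in \<mu>. f' x = f x"
    by (rule L2_AE_limit_unique[OF f'L f gL lim2 lim1])
  show fF: "f \<in> F" by (rule F_AE_cong[OF f' _ ae]) (use f in \<open>auto simp: L2_def\<close>)
  have "sqrt (E f' f') \<le> sqrt K + sqrt (E (\<lambda>x. g n x - f' x) (\<lambda>x. g n x - f' x))" for n
  proof -
    have "sqrt (E f' f') \<le> sqrt (E (g n) (g n)) + sqrt (E (\<lambda>x. g n x - f' x) (\<lambda>x. g n x - f' x))"
      using sqrt_diff_le[of "g n" "\<lambda>x. g n x - f' x"] gF f' by (simp add: mems)
    moreover have "E (g n) (g n) \<le> K" using gC by (auto simp: C_def)
    ultimately show ?thesis by (meson add_mono_thms_linordered_semiring(3) order_trans real_sqrt_le_mono)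
  qed
  moreover have "(\<lambda>n. sqrt K + sqrt (E (\<lambda>x. g n x - f' x) (\<lambda>x. g n x - f' x))) \<longlonglongrightarrow> sqrt K + sqrt 0"
    using limE by (intro tendsto_intros)
  ultimately have "sqrt (E f' f') \<le> sqrt K + sqrt 0"
    by (intro LIMSEQ_le_const) auto
  then show "E f f \<le> K" using E_AE_cong[OF f' fF ae] by simp
qed

end


section \<open>Contractions, products and strong locality\<close>

text \<open>t^2 is twice the integral of max 0 (t - s) over s \<ge> 0, and the sum is a left Riemann
  sum of mesh h. With a = max 0 (t - k h) and b = max 0 (a - h), each summand 2 h a differs from a^2
  - b^2 by at most 2 h (a - b), and both differences telescope. This form serves
  \<open>square\<close>, since the energy of such excesses is under control.\<close>

lemma Riemann_sum_square:
  fixes t h :: real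
  assumes "0 \<le> t" "0 < h" "t \<le> real n * h"
  shows "\<bar>2 * h * (\<Sum>k<n. max 0 (t - real k * h)) - t * t\<bar> \<le> 2 * h * t"
proof -
  let ?p = "\<lambda>k. max 0 (t - real k * h)"
  have step: "0 \<le> 2 * h * a - (a * a - b * b)" "2 * h * a - (a * a - b * b) \<le> 2 * h * (a - b)"
    if "0 \<le> a" "b = max 0 (a - h)" for a b
  proof -
    have "0 \<le> 2 * h * a - (a * a - b * b) \<and> 2 * h * a - (a * a - b * b) \<le> 2 * h * (a - b)"
    proof (cases "h \<le> a")
      case True
      then have b: "b = a - h" using that by simp
      have "0 \<le> h * h" by simp
      then show ?thesis unfolding b by (simp add: algebra_simps)
    next
      case False
      then have "a * a \<le> h * a" "0 \<le> h * a" using that by (auto intro: mult_right_mono)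
      moreover have "b = 0" using that False by simp
      moreover have "2 * h * a = h * a + h * a" "2 * h * (a - b) = 2 * h * a" using \<open>b = 0\<close> by auto
      ultimately show ?thesis by simp
    qed
    then show "0 \<le> 2 * h * a - (a * a - b * b)" "2 * h * a - (a * a - b * b) \<le> 2 * h * (a - b)" by auto
  qed
  have p: "0 \<le> ?p k" "?p (Suc k) = max 0 (?p k - h)" for k
    using assms(2) by (auto simp: algebra_simps max_def)
  have tel: "(\<Sum>k<n. ?p k * ?p k - ?p (Suc k) * ?p (Suc k)) = t * t"
    "(\<Sum>k<n. ?p k - ?p (Suc k)) = t"
    using sum_lessThan_telescope'[of "\<lambda>k. ?p k * ?p k" n] sum_lessThan_telescope'[of ?p n] assms
    by auto
  have "2 * h * (\<Sum>k<n. ?p k) - t * t = (\<Sum>k<n. 2 * h * ?p k - (?p k * ?p k - ?p (Suc k) * ?p (Suc k)))"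
    unfolding sum_subtractf[of "\<lambda>k. 2 * h * ?p k"] tel by (simp add: sum_distrib_left)
  moreover have "0 \<le> (\<Sum>k<n. 2 * h * ?p k - (?p k * ?p k - ?p (Suc k) * ?p (Suc k)))"
    by (rule sum_nonneg, rule step(1)[OF p])
  moreover have "(\<Sum>k<n. 2 * h * ?p k - (?p k * ?p k - ?p (Suc k) * ?p (Suc k)))
      \<le> (\<Sum>k<n. 2 * h * (?p k - ?p (Suc k)))"
    by (rule sum_mono, rule step(2)[OF p])
  moreover have "(\<Sum>k<n. 2 * h * (?p k - ?p (Suc k))) = 2 * h * t"
    by (simp only: sum_distrib_left[symmetric] tel(2))
  ultimately show ?thesis by linarith
qed

lemma (in nonneg_form) sum_bound:
  assumes "\<And>k. u k \<in> V" "\<And>k. sqrt (B (u k) (u k)) \<le> b"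
  shows "(\<lambda>x. \<Sum>k<n. u k x) \<in> V \<and>
    sqrt (B (\<lambda>x. \<Sum>k<n. u k x) (\<lambda>x. \<Sum>k<n. u k x)) \<le> real n * b"
proof (induction n)
  case 0
  then show ?case by (simp add: zero_mem zero_left)
next
  case (Suc n)
  then show ?case
    using sqrt_add_le[of "\<lambda>x. \<Sum>k<n. u k x" "u n"] add_mem[of "\<lambda>x. \<Sum>k<n. u k x" "u n"]
      assms(1)[of n] assms(2)[of n]
    by (simp add: algebra_simps)
qed

lemma L2_dominated:
  assumes "h \<in> borel_measurable \<mu>" "g \<in> L2 \<mu>" "\<And>x. \<bar>h x\<bar> \<le> c * \<bar>g x\<bar>"
  shows "h \<in> L2 \<mu>" "l2_inner \<mu> h h \<le> c\<^sup>2 * l2_inner \<mu> g g"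
proof -
  have g: "integrable \<mu> (\<lambda>x. g x * g x)" by (rule L2_integrable_mult[OF assms(2,2)])
  have le: "h x * h x \<le> c\<^sup>2 * (g x * g x)" for x
    using mult_mono'[OF assms(3) assms(3), of x x] by (simp add: power2_eq_square algebra_simps)
  have i: "integrable \<mu> (\<lambda>x. h x * h x)"
    by (rule Bochner_Integration.integrable_bound[of _ "\<lambda>x. c\<^sup>2 * (g x * g x)"])
       (use g le assms(1) in \<open>auto simp: abs_mult[symmetric]\<close>)
  then show "h \<in> L2 \<mu>" using assms(1) by (simp add: L2_def power2_eq_square)
  have "l2_inner \<mu> h h \<le> (\<integral>x. c\<^sup>2 * (g x * g x) \<partial>\<mu>)"
    unfolding l2_inner_def by (rule integral_mono) (use i g le in auto)
  then show "l2_inner \<mu> h h \<le> c\<^sup>2 * l2_inner \<mu> g g" by (simp add: l2_inner_def)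
qed

lemma closure_nonzero: "a x \<noteq> 0 \<Longrightarrow> x \<in> closure {x. a x \<noteq> 0}"
  using closure_subset[of "{x. a x \<noteq> 0}"] by auto

lemma Cc_I:
  assumes "a \<in> Cc" "b \<in> Cc" "continuous_on UNIV h" "\<And>x. a x = 0 \<Longrightarrow> b x = 0 \<Longrightarrow> h x = 0"
  shows "h \<in> Cc"
proof -
  have "closure {x. h x \<noteq> 0} \<subseteq> closure {x. a x \<noteq> 0} \<union> closure {x. b x \<noteq> 0}"
    unfolding closure_Un[symmetric] by (rule closure_mono) (use assms(4) in auto)
  moreover have "compact (closure {x. a x \<noteq> 0} \<union> closure {x. b x \<noteq> 0})"
    using assms by (auto simp: Cc_def)
  ultimately have "compact (closure {x. h x \<noteq> 0})"
    using compact_Int_closed[of _ "closure {x. h x \<noteq> 0}"] by (metis closed_closure inf.absorb_iff2)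
  then show ?thesis using assms(3) by (simp add: Cc_def)
qed

lemma Cc_bounded:
  assumes "a \<in> Cc"
  obtains K where "0 < K" "\<And>x. \<bar>a x\<bar> \<le> K"
proof -
  have "compact (a ` closure {x. a x \<noteq> 0})"
    using assms by (intro compact_continuous_image) (auto simp: Cc_def intro: continuous_on_subset)
  then obtain K where K: "0 < K" "\<And>y. y \<in> a ` closure {x. a x \<noteq> 0} \<Longrightarrow> norm y \<le> K"
    using compact_imp_bounded bounded_pos by metis
  have "\<bar>a x\<bar> \<le> K" for x
  proof (cases "a x = 0")
    case False
    then have "x \<in> closure {x. a x \<noteq> 0}" by (rule closure_nonzero)
    then show ?thesis using K(2)[of "a x"] by auto
  qed (use K in auto)
  then show ?thesis using K that by auto
qed

context strongly_local_form
begin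

section \<open>Stability of the form domain under truncation and multiplication\<close>

lemma Cc_measurable: "a \<in> Cc \<Longrightarrow> a \<in> borel_measurable \<mu>"
  using sets_mu by (auto simp: Cc_def measurable_cong_sets[OF sets_mu refl] intro: borel_measurable_continuous_onI)

lemma truncate:
  assumes "f \<in> F" "0 < c"
  shows "(\<lambda>x. min c (max 0 (f x))) \<in> F"
    "E (\<lambda>x. min c (max 0 (f x))) (\<lambda>x. min c (max 0 (f x))) \<le> E f f"
proof -
  let ?g = "\<lambda>x. inverse c * f x" and ?t = "\<lambda>x. min 1 (max 0 (inverse c * f x))"
  have g: "?g \<in> F" using assms by (intro mems)
  have "\<forall>f\<in>F. (\<lambda>x. min 1 (max 0 (f x))) \<in> F \<and>
        E (\<lambda>x. min 1 (max 0 (f x))) (\<lambda>x. min 1 (max 0 (f x))) \<le> E f f"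
    using dirichlet unfolding dirichlet_form_def by (elim conjE)
  from bspec[OF this g] have t: "?t \<in> F" "E ?t ?t \<le> E ?g ?g" by auto
  have eq: "(\<lambda>x. min c (max 0 (f x))) = (\<lambda>x. c * ?t x)"
    using assms by (auto simp: fun_eq_iff min_def max_def field_simps)
  show "(\<lambda>x. min c (max 0 (f x))) \<in> F" unfolding eq using t by (intro mems)
  have "E (\<lambda>x. c * ?t x) (\<lambda>x. c * ?t x) = c\<^sup>2 * E ?t ?t" by (rule cmult_both[OF t(1)])
  also have "\<dots> \<le> c\<^sup>2 * E ?g ?g" using t by (intro mult_left_mono) auto
  also have "\<dots> = E f f" using assms by (simp only: cmult_both[OF assms(1)]) (simp add: field_simps)
  finally show "E (\<lambda>x. min c (max 0 (f x))) (\<lambda>x. min c (max 0 (f x))) \<le> E f f" unfolding eq .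
qed

text \<open>The form is only assumed to respect truncation from both sides; under the upper bound K
  a cut at the positive height max K 1 leaves the positive part unchanged.\<close>

lemma positive_part:
  assumes "f \<in> F" "\<And>x. f x \<le> K"
  shows "(\<lambda>x. max 0 (f x)) \<in> F" "E (\<lambda>x. max 0 (f x)) (\<lambda>x. max 0 (f x)) \<le> E f f"
proof -
  have "(\<lambda>x. max 0 (f x)) = (\<lambda>x. min (max K 1) (max 0 (f x)))"
    using assms(2) by (auto simp: fun_eq_iff min_def max_def) (smt (verit))+
  then show "(\<lambda>x. max 0 (f x)) \<in> F" "E (\<lambda>x. max 0 (f x)) (\<lambda>x. max 0 (f x)) \<le> E f f"
    using truncate[of f "max K 1"] assms(1) by auto
qed

text \<open>max 0 (f - s) = f - min s f, so the triangle inequality costs a factor 2; what matters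
  is that the bound does not depend on s.\<close>

lemma excess:
  assumes "f \<in> F" "\<And>x. 0 \<le> f x" "0 \<le> s"
  shows "(\<lambda>x. max 0 (f x - s)) \<in> F"
    "sqrt (E (\<lambda>x. max 0 (f x - s)) (\<lambda>x. max 0 (f x - s))) \<le> 2 * sqrt (E f f)"
proof -
  have "(\<lambda>x. max 0 (f x - s)) \<in> F \<and>
    sqrt (E (\<lambda>x. max 0 (f x - s)) (\<lambda>x. max 0 (f x - s))) \<le> 2 * sqrt (E f f)"
  proof (cases "s = 0")
    case True
    then have "(\<lambda>x. max 0 (f x - s)) = f" using assms by auto
    then show ?thesis using assms nonneg[of f] by simp
  next
    case False
    then have s: "0 < s" using assms by auto
    let ?t = "\<lambda>x. min s (max 0 (f x))"
    have eq: "(\<lambda>x. max 0 (f x - s)) = (\<lambda>x. f x - ?t x)"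
      using assms(2) by (auto simp: fun_eq_iff min_def max_def)
    note t = truncate[OF assms(1) s]
    have "sqrt (E ?t ?t) \<le> sqrt (E f f)" using t(2) by (rule real_sqrt_le_mono)
    then have "sqrt (E (\<lambda>x. f x - ?t x) (\<lambda>x. f x - ?t x)) \<le> 2 * sqrt (E f f)"
      using sqrt_diff_le[OF assms(1) t(1)] by linarith
    then show ?thesis unfolding eq using mems(3)[OF assms(1) t(1)] by simp
  qed
  then show "(\<lambda>x. max 0 (f x - s)) \<in> F"
    "sqrt (E (\<lambda>x. max 0 (f x - s)) (\<lambda>x. max 0 (f x - s))) \<le> 2 * sqrt (E f f)" by auto
qed

text \<open>By \<open>Riemann_sum_square\<close>, f^2 is an L2 limit of 2 h times sums of n excesses
  of f, with n h = m. Their energy norms stay below 2 h * n * 2 * sqrt (E f f) = 4 m * sqrt (E f f),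
  and \<open>energy_lsc\<close> carries this bound to the limit.\<close>

lemma square:
  assumes f: "f \<in> F" and bounds: "\<And>x. 0 \<le> f x" "\<And>x. f x \<le> m" and m: "0 < m"
  shows "(\<lambda>x. f x * f x) \<in> F"
    "sqrt (E (\<lambda>x. f x * f x) (\<lambda>x. f x * f x)) \<le> 4 * m * sqrt (E f f)"
proof -
  have fL: "f \<in> L2 \<mu>" using f by (rule F_L2)
  have fm: "f \<in> borel_measurable \<mu>" using fL by (auto simp: L2_def)
  let ?s = "\<lambda>x. f x * f x"
  have sL: "?s \<in> L2 \<mu>"
    by (rule L2_dominated(1)[OF _ fL, of _ m])
       (use bounds fm in \<open>auto simp: abs_mult intro!: mult_right_mono borel_measurable_times\<close>)
  have "\<exists>g\<in>F. l2_inner \<mu> (\<lambda>x. g x - ?s x) (\<lambda>x. g x - ?s x) \<le> e \<and> E g g \<le> 16 * m\<^sup>2 * E f f"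
    if "e > 0" for e
  proof -
    have l0: "0 \<le> l2_inner \<mu> f f" using fL by (rule L2.nonneg)
    \<comment> \<open>Chosen so that (2 m e')^2 * (l2_inner \<mu> f f + 1) = e; the summand 1 covers
      the case of norm 0.\<close>
    define e' where "e' = sqrt (e / (4 * m\<^sup>2 * (l2_inner \<mu> f f + 1)))"
    have "e' > 0" using that m l0 by (simp add: e'_def)
    then obtain j where j: "inverse (real (Suc j)) < e'" using reals_Archimedean by blast
    define n where "n = Suc j"
    define h where "h = m / real n"
    have n: "real n > 0" by (simp add: n_def)
    have h: "0 < h" "real n * h = m" using m n by (auto simp: h_def)
    let ?g = "\<lambda>x. 2 * h * (\<Sum>k<n. max 0 (f x - real k * h))"
    have su: "(\<lambda>x. \<Sum>k<n. max 0 (f x - real k * h)) \<in> F \<and>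
      sqrt (E (\<lambda>x. \<Sum>k<n. max 0 (f x - real k * h)) (\<lambda>x. \<Sum>k<n. max 0 (f x - real k * h)))
       \<le> real n * (2 * sqrt (E f f))"
      by (rule sum_bound) (use excess[OF f bounds(1)] h in auto)
    then have gF: "?g \<in> F" by (intro mems) auto
    have "sqrt (E ?g ?g) \<le> 2 * h * (real n * (2 * sqrt (E f f)))"
      using su sqrt_cmult[of "\<lambda>x. \<Sum>k<n. max 0 (f x - real k * h)" "2 * h"] h
      by (auto intro: mult_left_mono)
    also have "\<dots> = 4 * m * sqrt (E f f)" using h(2) by (simp add: algebra_simps)
    finally have "(sqrt (E ?g ?g))\<^sup>2 \<le> (4 * m * sqrt (E f f))\<^sup>2"
      using nonneg[OF gF] by (intro power_mono) auto
    then have Eg: "E ?g ?g \<le> 16 * m\<^sup>2 * E f f"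
      using nonneg[OF gF] nonneg[OF f] by (simp add: power_mult_distrib)
    have gm: "?g \<in> borel_measurable \<mu>" using F_L2[OF gF] by (auto simp: L2_def)
    have "l2_inner \<mu> (\<lambda>x. ?g x - ?s x) (\<lambda>x. ?g x - ?s x) \<le> (2 * h)\<^sup>2 * l2_inner \<mu> f f"
      by (rule L2_dominated(2)[OF _ fL])
         (use gm fm bounds h Riemann_sum_square[of "f _" h n] in \<open>auto intro!: borel_measurable_diff borel_measurable_times\<close>)
    also have "\<dots> \<le> (2 * m * e')\<^sup>2 * (l2_inner \<mu> f f + 1)"
    proof (rule mult_mono[OF power_mono])
      have "h \<le> m * e'" unfolding h_def n_def divide_inverse using j m by (intro mult_left_mono) auto
      then show "2 * h \<le> 2 * m * e'" by simp
    qed (use h l0 in auto)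
    also have "\<dots> = 4 * m\<^sup>2 * (e / (4 * m\<^sup>2 * (l2_inner \<mu> f f + 1))) * (l2_inner \<mu> f f + 1)"
      using that m l0 by (simp add: power_mult_distrib e'_def)
    also have "\<dots> = e"
    proof -
      have "4 * m\<^sup>2 * (e / (4 * m\<^sup>2 * c)) * c = e" if "c > 0" for c
        using that m by simp
      then show ?thesis using l0 by simp
    qed
    finally show ?thesis using gF Eg by (intro bexI[of _ ?g] conjI)
  qed
  note lsc = energy_lsc[OF sL this]
  show "?s \<in> F" by (rule lsc(1))
  have "sqrt (E ?s ?s) \<le> sqrt (16 * m\<^sup>2 * E f f)" using lsc(2) by (rule real_sqrt_le_mono)
  then show "sqrt (E ?s ?s) \<le> 4 * m * sqrt (E f f)" using m by (simp add: real_sqrt_mult)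
qed

text \<open>Polarization. The sum f + g is bounded by 2 m, so its square contributes 8 m, and the
  squares of f and g contribute 4 m; half of 12 m is the constant.\<close>

lemma product:
  assumes f: "f \<in> F" "\<And>x. 0 \<le> f x" "\<And>x. f x \<le> m"
    and g: "g \<in> F" "\<And>x. 0 \<le> g x" "\<And>x. g x \<le> m" and m: "0 < m"
  shows "(\<lambda>x. f x * g x) \<in> F"
    "sqrt (E (\<lambda>x. f x * g x) (\<lambda>x. f x * g x)) \<le> 6 * m * (sqrt (E f f) + sqrt (E g g))"
proof -
  note sf = square[OF f m] and sg = square[OF g m]
  let ?h = "\<lambda>x. f x + g x"
  have h: "?h \<in> F" using f g by (intro mems)
  have sh: "(\<lambda>x. ?h x * ?h x) \<in> F" "sqrt (E (\<lambda>x. ?h x * ?h x) (\<lambda>x. ?h x * ?h x)) \<le> 4 * (2 * m) * sqrt (E ?h ?h)"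
  proof -
    have "0 \<le> ?h x" "?h x \<le> 2 * m" for x
      using f(2)[of x] g(2)[of x] f(3)[of x] g(3)[of x] by auto
    then show "(\<lambda>x. ?h x * ?h x) \<in> F" "sqrt (E (\<lambda>x. ?h x * ?h x) (\<lambda>x. ?h x * ?h x)) \<le> 4 * (2 * m) * sqrt (E ?h ?h)"
      using square[OF h, of "2 * m"] m by auto
  qed
  have eq: "(\<lambda>x. f x * g x) = (\<lambda>x. 1/2 * (?h x * ?h x - (f x * f x + g x * g x)))"
    by (auto simp: algebra_simps)
  have fg: "(\<lambda>x. f x * f x + g x * g x) \<in> F" using sf sg by (intro mems)
  have d: "(\<lambda>x. ?h x * ?h x - (f x * f x + g x * g x)) \<in> F" by (rule mems(3)[OF sh(1) fg])
  show "(\<lambda>x. f x * g x) \<in> F" unfolding eq by (rule mems(1)[OF d])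
  have 1: "sqrt (E (\<lambda>x. f x * f x + g x * g x) (\<lambda>x. f x * f x + g x * g x)) \<le> 4 * m * sqrt (E f f) + 4 * m * sqrt (E g g)"
    using sqrt_add_le[OF sf(1) sg(1)] sf(2) sg(2) by linarith
  have "8 * m * sqrt (E ?h ?h) \<le> 8 * m * (sqrt (E f f) + sqrt (E g g))"
    using sqrt_add_le[OF f(1) g(1)] m by (intro mult_left_mono) auto
  then have 2: "sqrt (E (\<lambda>x. ?h x * ?h x) (\<lambda>x. ?h x * ?h x)) \<le> 8 * m * sqrt (E f f) + 8 * m * sqrt (E g g)"
    using sh(2) by (simp add: distrib_left)
  have "sqrt (E (\<lambda>x. f x * g x) (\<lambda>x. f x * g x)) =
    1/2 * sqrt (E (\<lambda>x. ?h x * ?h x - (f x * f x + g x * g x)) (\<lambda>x. ?h x * ?h x - (f x * f x + g x * g x)))"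
    unfolding eq using sqrt_cmult[OF d, of "1/2"] by simp
  also have "\<dots> \<le> 1/2 * (12 * m * sqrt (E f f) + 12 * m * sqrt (E g g))"
    using sqrt_diff_le[OF sh(1) fg] 1 2 by simp
  finally show "sqrt (E (\<lambda>x. f x * g x) (\<lambda>x. f x * g x)) \<le> 6 * m * (sqrt (E f f) + sqrt (E g g))"
    by (simp add: algebra_simps)
qed

text \<open>The energy formula is available for test functions of this kind. For continuous
  functions, moreover, sets such as {0 < b} are open, so strong locality applies to supports read
  off pointwise.\<close>

definition A :: "('a \<Rightarrow> real) set" where "A = F \<inter> Cc"

lemma A_F: "a \<in> A \<Longrightarrow> a \<in> F" and A_Cc: "a \<in> A \<Longrightarrow> a \<in> Cc"
  by (auto simp: A_def)

lemma A_cont: "a \<in> A \<Longrightarrow> continuous_on UNIV a"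
  by (auto simp: A_def Cc_def)

lemma A_zero: "(\<lambda>_. 0) \<in> A"
  by (auto simp: A_def Cc_def zero_mem)

lemma A_comb:
  assumes "a \<in> A" "b \<in> A"
  shows "(\<lambda>x. c * a x + b x) \<in> A"
proof -
  have "(\<lambda>x. c * a x + b x) \<in> Cc"
    by (rule Cc_I[of a b]) (use assms in \<open>auto intro!: continuous_intros simp: A_Cc A_cont\<close>)
  moreover have "(\<lambda>x. c * a x + b x) \<in> F" using assms by (intro comb_mem A_F)
  ultimately show ?thesis by (simp add: A_def)
qed

sublocale A: nonneg_form A E
proof
  show "sym_bilinear_on A E" using bilinear unfolding sym_bilinear_on_def A_def by blast
  show "0 \<le> E f f" if "f \<in> A" for f using nonneg[OF A_F[OF that]] .
qed (rule A_zero, rule A_comb)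

lemma A_pos:
  assumes "a \<in> A"
  shows "(\<lambda>x. max 0 (a x)) \<in> A" "E (\<lambda>x. max 0 (a x)) (\<lambda>x. max 0 (a x)) \<le> E a a"
proof -
  obtain K where "\<And>x. a x \<le> K" using Cc_bounded[OF A_Cc[OF assms]] by (metis abs_le_D1)
  note p = positive_part[OF A_F[OF assms] this]
  show "E (\<lambda>x. max 0 (a x)) (\<lambda>x. max 0 (a x)) \<le> E a a" by (rule p(2))
  have "(\<lambda>x. max 0 (a x)) \<in> Cc"
    by (rule Cc_I[of a a]) (use assms in \<open>auto intro!: continuous_intros simp: A_Cc A_cont\<close>)
  then show "(\<lambda>x. max 0 (a x)) \<in> A" using p(1) by (auto simp: A_def)
qed

lemma A_min:
  assumes "a \<in> A" "\<And>x. 0 \<le> a x" "0 < s"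
  shows "(\<lambda>x. min s (a x)) \<in> A" "E (\<lambda>x. min s (a x)) (\<lambda>x. min s (a x)) \<le> E a a"
    "(\<lambda>x. max 0 (a x - s)) \<in> A"
proof -
  have eq: "(\<lambda>x. min s (a x)) = (\<lambda>x. min s (max 0 (a x)))" using assms by auto
  have "(\<lambda>x. min s (a x)) \<in> Cc"
    by (rule Cc_I[of a a]) (use assms in \<open>auto intro!: continuous_intros simp: A_Cc A_cont\<close>)
  then show 1: "(\<lambda>x. min s (a x)) \<in> A" using truncate[OF A_F[OF assms(1)] assms(3)] by (auto simp: A_def eq)
  show "E (\<lambda>x. min s (a x)) (\<lambda>x. min s (a x)) \<le> E a a"
    using truncate[OF A_F[OF assms(1)] assms(3)] unfolding eq by auto
  have "(\<lambda>x. max 0 (a x - s)) = (\<lambda>x. a x - min s (a x))" by (auto simp: fun_eq_iff min_def max_def)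
  then show "(\<lambda>x. max 0 (a x - s)) \<in> A" using A.mems(3)[OF assms(1) 1] by simp
qed

lemma A_mult:
  assumes "a \<in> A" "b \<in> A"
  shows "(\<lambda>x. a x * b x) \<in> A"
proof -
  have pos: "(\<lambda>x. a x * b x) \<in> A" if ab: "a \<in> A" "b \<in> A" "\<And>x. 0 \<le> a x" "\<And>x. 0 \<le> b x" for a b
  proof -
    obtain K where K: "\<And>x. \<bar>a x\<bar> \<le> K" "0 < K" using Cc_bounded[OF A_Cc[OF ab(1)]] by metis
    obtain K' where K': "\<And>x. \<bar>b x\<bar> \<le> K'" "0 < K'" using Cc_bounded[OF A_Cc[OF ab(2)]] by metis
    have "(\<lambda>x. a x * b x) \<in> F"
    proof (rule product(1)[where m = "max K K'"])
      show "a x \<le> max K K'" "b x \<le> max K K'" for x using K(1)[of x] K'(1)[of x] by auto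
    qed (use ab A_F K in auto)
    moreover have "(\<lambda>x. a x * b x) \<in> Cc"
      by (rule Cc_I[of a b]) (use ab in \<open>auto intro!: continuous_intros simp: A_Cc A_cont\<close>)
    ultimately show ?thesis by (simp add: A_def)
  qed
  let ?p = "\<lambda>a x. max 0 (a x)" and ?n = "\<lambda>a x. max 0 (- 1 * a x)"
  have A: "?p c \<in> A" "?n c \<in> A" if "c \<in> A" for c
    using A_pos(1)[OF that] A_pos(1)[OF A.cmult_mem[OF that, of "- 1"]] by auto
  have eq: "(\<lambda>x. a x * b x) = (\<lambda>x. (?p a x * ?p b x + ?n a x * ?n b x) - (?p a x * ?n b x + ?n a x * ?p b x))"
    by (auto simp: fun_eq_iff max_def)
  show ?thesis unfolding eq using assms by (intro A.mems pos A) auto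
qed

section \<open>Supports, and energies that vanish by strong locality\<close>

lemma compact_measure: "compact K \<Longrightarrow> K \<in> sets \<mu>" "compact K \<Longrightarrow> emeasure \<mu> K < \<infinity>"
  using finite_compact sets_mu borel_compact by auto

lemma ess_supp_subset:
  assumes "closed K" "\<And>x. x \<notin> K \<Longrightarrow> f x = 0"
  shows "ess_supp \<mu> f \<subseteq> K"
proof -
  have "open (- K) \<and> (AE x in \<mu>. x \<in> - K \<longrightarrow> f x = 0)" using assms by auto
  then show ?thesis unfolding ess_supp_def by blast
qed

lemma ess_supp_closed: "closed (ess_supp \<mu> f)"
  unfolding ess_supp_def by auto

lemma Cc_compact_ess_supp: "a \<in> Cc \<Longrightarrow> compact (ess_supp \<mu> a)"
proof -
  assume a: "a \<in> Cc"
  have s: "ess_supp \<mu> a \<subseteq> closure {x. a x \<noteq> 0}"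
    by (rule ess_supp_subset) (use closure_nonzero in fastforce)+
  show ?thesis
    using compact_Int_closed[OF _ ess_supp_closed, of "closure {x. a x \<noteq> 0}" a] a s
    by (simp add: Cc_def Int_absorb1)
qed

text \<open>The truncations \<open>min s b\<close> tend weakly to \<open>0\<close> as \<open>s\<close> tends to \<open>0\<close>, so that no neighbourhood
  of the support of \<open>b\<close> is needed.\<close>

lemma orthogonal:
  assumes a: "a \<in> A" and b: "b \<in> A" "\<And>x. 0 \<le> b x" and const: "\<And>x. 0 < b x \<Longrightarrow> a x = c"
  shows "E a b = 0" "E b a = 0"
proof -
  let ?w = "\<lambda>s x. min s (b x)"
  \<comment> \<open>b is the sum of max 0 (b - s) and min s b. The first has its support in the
    closed set {s \<le> b}, inside the open set {0 < b} where a is constant, so strong locality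
    removes it. Only the low layer of b contributes, whatever s is.\<close>
  have Ew: "E a (?w s) = E a b" if s: "0 < s" for s
  proof -
    let ?v = "\<lambda>x. max 0 (b x - s)"
    have vA: "?v \<in> A" by (rule A_min(3)[OF b s])
    have wA: "?w s \<in> A" by (rule A_min(1)[OF b s])
    have sub: "ess_supp \<mu> ?v \<subseteq> {x. s \<le> b x}"
      by (rule ess_supp_subset) (auto intro!: closed_Collect_le continuous_intros A_cont[OF b(1)])
    have "open {x. 0 < b x}" by (intro open_Collect_less continuous_intros A_cont[OF b(1)])
    then have "\<exists>U c. open U \<and> ess_supp \<mu> ?v \<subseteq> U \<and> (AE x in \<mu>. x \<in> U \<longrightarrow> a x = c)"
      using sub s const by (intro exI[of _ "{x. 0 < b x}"] exI[of _ c]) auto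
    then have "E ?v a = 0"
      using strong_locality Cc_compact_ess_supp[OF A_Cc] vA a A_F unfolding strongly_local_def by blast
    then have "E a ?v = 0" using A.sym[OF a vA] by simp
    moreover have "b = (\<lambda>x. ?v x + ?w s x)" by (auto simp: fun_eq_iff min_def max_def)
    then have "E a b = E a ?v + E a (?w s)" using A.add_right[OF vA wA a] by metis
    ultimately show ?thesis by simp
  qed
  show "E a b = 0"
  proof (rule ccontr)
    assume ne: "E a b \<noteq> 0"
    \<comment> \<open>Perturb a to a - t * min s b. As s tends to 0 this converges to a in L2, while
      its energy stays below K = E a a - 2 t E a b + t^2 E b b. For t close to the minimiser E a b /
      E b b this K is below E a a, against \<open>energy_lsc\<close>; the summand 1 avoids division
      by zero.\<close>
    define t where "t = E a b / (E b b + 1)"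
    have bb: "0 \<le> E b b" using b by (intro A.nonneg)
    define K where "K = E a a - 2 * t * E a b + t\<^sup>2 * E b b"
    have "E a a \<le> K"
    proof (rule energy_lsc(2)[OF F_L2[OF A_F[OF a]]])
      fix e :: real assume e: "e > 0"
      let ?S = "closure {x. b x \<noteq> 0}"
      have S: "compact ?S" using A_Cc[OF b(1)] by (auto simp: Cc_def)
      \<comment> \<open>M and s are matched so that s^2 * M = e, which makes the L2 distance of the
        perturbation from a small; the summand 1 keeps M positive.\<close>
      define M where "M = t\<^sup>2 * measure \<mu> ?S + 1"
      have M: "M > 0" unfolding M_def by (intro add_nonneg_pos mult_nonneg_nonneg) auto
      define s where "s = sqrt (e / M)"
      have s: "0 < s" using e M by (simp add: s_def)
      have wA: "?w s \<in> A" by (rule A_min(1)[OF b s])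
      let ?g = "\<lambda>x. a x - t * ?w s x"
      have "l2_inner \<mu> (?w s) (?w s) \<le> (\<integral>x. s\<^sup>2 * indicator ?S x \<partial>\<mu>)"
        unfolding l2_inner_def
      proof (rule integral_mono)
        show "integrable \<mu> (\<lambda>x. ?w s x * ?w s x)"
          using F_L2[OF A_F[OF wA]] by (intro L2_integrable_mult)
        show "integrable \<mu> (\<lambda>x. s\<^sup>2 * indicator ?S x :: real)"
          using compact_measure[OF S] by auto
        show "?w s x * ?w s x \<le> s\<^sup>2 * indicator ?S x" for x
        proof (cases "b x = 0")
          case False
          then have "x \<in> ?S" by (rule closure_nonzero)
          then show ?thesis using b(2)[of x] s by (auto simp: power2_eq_square intro!: mult_mono)
        qed (use s in auto)
      qed
      then have "l2_inner \<mu> (?w s) (?w s) \<le> s\<^sup>2 * measure \<mu> ?S"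
        using compact_measure[OF S] by simp
      then have "t\<^sup>2 * l2_inner \<mu> (?w s) (?w s) \<le> t\<^sup>2 * (s\<^sup>2 * measure \<mu> ?S)"
        by (rule mult_left_mono) auto
      also have "\<dots> \<le> s\<^sup>2 * M" by (simp add: M_def algebra_simps)
      also have "\<dots> = e" using e M by (simp add: s_def)
      finally have "t\<^sup>2 * l2_inner \<mu> (?w s) (?w s) \<le> e" .
      moreover have "(\<lambda>x. ?g x - a x) = (\<lambda>x. (- t) * ?w s x)" by auto
      ultimately have 1: "l2_inner \<mu> (\<lambda>x. ?g x - a x) (\<lambda>x. ?g x - a x) \<le> e"
        using L2.cmult_both[OF F_L2[OF A_F[OF wA]], of "- t"] by simp
      have "E ?g ?g = E a a - 2 * t * E a (?w s) + t\<^sup>2 * E (?w s) (?w s)"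
        using a wA A.sym[OF a wA] by (simp add: A.lins A.mems power2_eq_square algebra_simps)
      also have "\<dots> \<le> K"
        unfolding K_def Ew[OF s] using A_min(2)[OF b s] by (simp add: mult_left_mono)
      finally show "\<exists>g\<in>F. l2_inner \<mu> (\<lambda>x. g x - a x) (\<lambda>x. g x - a x) \<le> e \<and> E g g \<le> K"
        using 1 A_F a wA by (intro bexI[of _ ?g]) (auto intro!: mems)
    qed
    then have "2 * t * E a b \<le> t\<^sup>2 * E b b" by (simp add: K_def)
    moreover have "E a b = t * (E b b + 1)" using bb by (simp add: t_def)
    ultimately have "2 * (t\<^sup>2 * (E b b + 1)) \<le> t\<^sup>2 * E b b" by (simp add: power2_eq_square)
    then have "t\<^sup>2 * (E b b + 2) \<le> 0" by (simp add: algebra_simps)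
    moreover have "t \<noteq> 0" using ne bb by (simp add: t_def)
    then have "0 < t\<^sup>2 * (E b b + 2)" using bb by (intro mult_pos_pos) auto
    ultimately show False by simp
  qed
  then show "E b a = 0" using A.sym[OF a b(1)] by simp
qed

end


section \<open>The Leibniz rule\<close>

context strongly_local_form
begin

text \<open>The chain rule predicts E(f, f^3) = 3 I and E(f^2, f^2) = 4 I, where I is the integral
  of f^2 d\<Gamma>(f). This is the combination in which I cancels, and it can be formed from E
  alone.\<close>

definition quartic_defect :: "('a \<Rightarrow> real) \<Rightarrow> real" where
  "quartic_defect f = 4 * E f (\<lambda>x. f x * f x * f x) - 3 * E (\<lambda>x. f x * f x) (\<lambda>x. f x * f x)"

text \<open>f1 equals s wherever f2 > 0, so \<open>orthogonal\<close> removes the mixed energies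
  between powers of f1 and powers of f2, and f1 * f2 = s * f2. The remaining cross terms 12 s^2
  E(f2, f2) and 12 s E(f2, f2^2) occur both in 4 E(f, f^3) and in 3 E(f^2, f^2), and cancel.\<close>

lemma quartic_defect_split:
  assumes f: "f \<in> A" "\<And>x. 0 \<le> f x" and s: "0 < s"
  defines "f1 \<equiv> \<lambda>x. min s (f x)" and "f2 \<equiv> \<lambda>x. max 0 (f x - s)"
  shows "quartic_defect f = quartic_defect f1 + quartic_defect f2"
    and "E f f = E f1 f1 + E f2 f2"
proof -
  have A1: "f1 \<in> A" and A2: "f2 \<in> A" using A_min[OF f s] by (auto simp: f1_def f2_def)
  have nn: "0 \<le> f1 x" "0 \<le> f2 x" for x using f(2)[of x] s by (auto simp: f1_def f2_def)
  have s1: "f1 x = s" if "0 < f2 x" for x using that by (auto simp: f1_def f2_def max_def split: if_splits)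
  let ?a2 = "\<lambda>x. f1 x * f1 x" and ?a3 = "\<lambda>x. f1 x * f1 x * f1 x"
  let ?b2 = "\<lambda>x. f2 x * f2 x" and ?b3 = "\<lambda>x. f2 x * f2 x * f2 x"
  have M: "?a2 \<in> A" "?a3 \<in> A" "?b2 \<in> A" "?b3 \<in> A" using A1 A2 by (auto intro!: A_mult)
  have orth: "E f1 f2 = 0" "E f1 ?b2 = 0" "E f1 ?b3 = 0" "E ?a2 f2 = 0" "E ?a2 ?b2 = 0"
    "E f2 f1 = 0" "E ?b2 f1 = 0" "E ?b2 ?a2 = 0" "E f2 ?a2 = 0" "E f2 ?a3 = 0"
  proof -
    have z: "f1 x = s" if "0 < ?b2 x \<or> 0 < ?b3 x" for x
      using that nn(2)[of x] by (intro s1, cases "f2 x = 0") auto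
    have z2: "f1 x * f1 x = s * s" if "0 < f2 x \<or> 0 < ?b2 x" for x
      using that z[of x] s1[of x] by auto
    have z3: "f1 x * f1 x * f1 x = s * s * s" if "0 < f2 x" for x
      using that s1[of x] by auto
    have b: "0 \<le> ?b2 x" "0 \<le> ?b3 x" for x using nn(2)[of x] by auto
    show "E f1 f2 = 0" "E f2 f1 = 0"
      by (rule orthogonal[OF A1 A2 nn(2) s1]; assumption)+
    show "E f1 ?b2 = 0" "E ?b2 f1 = 0"
      by (rule orthogonal[OF A1 M(3) b(1) z[OF disjI1]]; assumption)+
    show "E f1 ?b3 = 0"
      by (rule orthogonal(1)[OF A1 M(4) b(2) z[OF disjI2]])
    show "E ?a2 f2 = 0" "E f2 ?a2 = 0"
      by (rule orthogonal[OF M(1) A2 nn(2) z2[OF disjI1]]; assumption)+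
    show "E f2 ?a3 = 0"
      by (rule orthogonal(2)[OF M(2) A2 nn(2) z3])
    show "E ?a2 ?b2 = 0" "E ?b2 ?a2 = 0"
      by (rule orthogonal[OF M(1) M(3) b(1) z2[OF disjI2]]; assumption)+
  qed
  have fx: "f x = f1 x + f2 x" for x by (auto simp: f1_def f2_def)
  have p: "f1 x * f2 x = s * f2 x" for x using s1[of x] nn(2)[of x] by (cases "f2 x = 0") auto
  have e1: "f = (\<lambda>x. f1 x + f2 x)" using fx by auto
  have e2: "(\<lambda>x. f x * f x) = (\<lambda>x. ?a2 x + (2 * s * f2 x + ?b2 x))"
  proof
    fix x
    have "f x * f x = ?a2 x + 2 * (f1 x * f2 x) + ?b2 x" unfolding fx by algebra
    then show "f x * f x = ?a2 x + (2 * s * f2 x + ?b2 x)" unfolding p by simp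
  qed
  have e3: "(\<lambda>x. f x * f x * f x) = (\<lambda>x. ?a3 x + (3 * s\<^sup>2 * f2 x + (3 * s * ?b2 x + ?b3 x)))"
  proof
    fix x
    have "f x * f x * f x = ?a3 x + 3 * (f1 x * (f1 x * f2 x)) + 3 * (f1 x * f2 x) * f2 x + ?b3 x"
      unfolding fx by algebra
    also have "f1 x * (f1 x * f2 x) = s\<^sup>2 * f2 x" unfolding p using p[of x] by (simp add: power2_eq_square)
    finally show "f x * f x * f x = ?a3 x + (3 * s\<^sup>2 * f2 x + (3 * s * ?b2 x + ?b3 x))"
      unfolding p by simp
  qed
  have b12: "E ?b2 f2 = E f2 ?b2" using A2 M by (intro A.sym)
  show "E f f = E f1 f1 + E f2 f2"
    unfolding e1 using A1 A2 by (simp add: A.lins A.mems orth)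
  have E2: "E (\<lambda>x. f x * f x) (\<lambda>x. f x * f x) = E ?a2 ?a2 + (4 * s\<^sup>2 * E f2 f2 + 4 * s * E f2 ?b2 + E ?b2 ?b2)"
    unfolding e2 using A1 A2 M
    by (simp add: A.lins A.mems orth b12) (simp add: power2_eq_square algebra_simps)
  have "E f (\<lambda>x. f x * f x * f x) = E (\<lambda>x. f1 x + f2 x) (\<lambda>x. ?a3 x + (3 * s\<^sup>2 * f2 x + (3 * s * ?b2 x + ?b3 x)))"
    unfolding e3[symmetric] e1[symmetric] ..
  also have "\<dots> = E f1 ?a3 + (3 * s\<^sup>2 * E f2 f2 + 3 * s * E f2 ?b2 + E f2 ?b3)"
    using A1 A2 M by (simp add: A.lins A.mems orth)
  finally have E3: "E f (\<lambda>x. f x * f x * f x) = E f1 ?a3 + (3 * s\<^sup>2 * E f2 f2 + 3 * s * E f2 ?b2 + E f2 ?b3)" .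
  show "quartic_defect f = quartic_defect f1 + quartic_defect f2"
    unfolding quartic_defect_def E2 E3 by (simp add: algebra_simps)
qed

text \<open>168 = 4 * 30 + 3 * 16. The cube is m * f * (f^2 / m), where both factors are bounded by
  m and f^2 / m has energy norm at most 4 * sqrt (E f f); \<open>product\<close> then yields m * 6 m
  * (1 + 4) = 30 m^2. The halving argument lives on the factor m^2.\<close>

lemma quartic_defect_bound:
  assumes f: "f \<in> A" "\<And>x. 0 \<le> f x" "\<And>x. f x \<le> m" and m: "0 < m"
  shows "\<bar>quartic_defect f\<bar> \<le> 168 * m\<^sup>2 * E f f"
proof -
  note F = A_F[OF f(1)]
  let ?e = "sqrt (E f f)"
  let ?f2 = "\<lambda>x. f x * f x"
  let ?g = "\<lambda>x. inverse m * (f x * f x)"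
  note sq = square[OF F f(2,3) m]
  have g: "?g \<in> F" using sq(1) by (intro mems)
  have sg: "sqrt (E ?g ?g) \<le> 4 * ?e"
  proof (rule mult_left_le_imp_le[OF _ m])
    have "m * sqrt (E ?g ?g) = sqrt (E ?f2 ?f2)"
      unfolding sqrt_cmult[OF sq(1), of "inverse m"] using m by simp
    then show "m * sqrt (E ?g ?g) \<le> m * (4 * ?e)" using sq(2) by simp
  qed
  have gb: "0 \<le> ?g x" "?g x \<le> m" for x
    using f(2,3)[of x] m mult_mono[OF f(3) f(3), of x x] by (auto simp: field_simps)
  note pr = product[OF F f(2,3) g gb m]
  let ?c = "\<lambda>x. f x * f x * f x"
  have c: "?c = (\<lambda>x. m * (f x * ?g x))" using m by (auto simp: fun_eq_iff field_simps)
  have cA: "?c \<in> A" "?f2 \<in> A" using f by (auto intro!: A_mult)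
  have e0: "0 \<le> ?e" using nonneg[OF F] by simp
  have "sqrt (E ?c ?c) = m * sqrt (E (\<lambda>x. f x * ?g x) (\<lambda>x. f x * ?g x))"
    unfolding c using sqrt_cmult[OF pr(1), of m] m by simp
  also have "\<dots> \<le> m * (6 * m * (?e + 4 * ?e))"
    using pr(2) sg m by (intro mult_left_mono order_trans[OF pr(2)]) auto
  finally have sc: "sqrt (E ?c ?c) \<le> 30 * m\<^sup>2 * ?e" by (simp add: power2_eq_square algebra_simps)
  have ee: "?e * ?e = E f f" using nonneg[OF F] by simp
  have "\<bar>E f ?c\<bar> \<le> ?e * (30 * m\<^sup>2 * ?e)"
    using A.Cauchy_Schwarz[OF f(1) cA(1)] mult_left_mono[OF sc e0] by linarith
  also have "\<dots> = 30 * m\<^sup>2 * (?e * ?e)" by (simp add: algebra_simps)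
  finally have 1: "\<bar>E f ?c\<bar> \<le> 30 * m\<^sup>2 * E f f" unfolding ee .
  have E0: "0 \<le> E ?f2 ?f2" by (rule A.nonneg[OF cA(2)])
  have "sqrt (E ?f2 ?f2) * sqrt (E ?f2 ?f2) \<le> (4 * m * ?e) * (4 * m * ?e)"
    using sq(2) E0 m e0 by (intro mult_mono) auto
  also have "\<dots> = 16 * m\<^sup>2 * (?e * ?e)" by (simp add: power2_eq_square algebra_simps)
  finally have 2: "E ?f2 ?f2 \<le> 16 * m\<^sup>2 * E f f" unfolding ee using E0 by simp
  show ?thesis unfolding quartic_defect_def using 1 2 E0 by linarith
qed

text \<open>Cutting \<open>f\<close> at half its height splits the defect and the energy additively, while the bound
  on the defect gains a factor \<open>1/4\<close>.\<close>

lemma quartic_defect_eq_0: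
  assumes "f \<in> A" "\<And>x. 0 \<le> f x"
  shows "quartic_defect f = 0"
proof -
  have bound: "\<bar>quartic_defect f\<bar> \<le> 168 * m\<^sup>2 * E f f * (1/4)^n"
    if "f \<in> A" "\<And>x. 0 \<le> f x" "\<And>x. f x \<le> m" "0 < m" for f m and n
    using that
  proof (induction n arbitrary: f m)
    case 0
    then show ?case using quartic_defect_bound[of f m] by simp
  next
    case (Suc n)
    let ?s = "m / 2"
    let ?f1 = "\<lambda>x. min ?s (f x)" and ?f2 = "\<lambda>x. max 0 (f x - ?s)"
    have s: "0 < ?s" using Suc by simp
    note sp = quartic_defect_split[OF Suc.prems(1,2) s]
    have 1: "\<bar>quartic_defect ?f1\<bar> \<le> 168 * ?s\<^sup>2 * E ?f1 ?f1 * (1/4)^n"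
      by (rule Suc.IH) (use A_min[OF Suc.prems(1,2) s] Suc.prems s in auto)
    have 2: "\<bar>quartic_defect ?f2\<bar> \<le> 168 * ?s\<^sup>2 * E ?f2 ?f2 * (1/4)^n"
    proof (rule Suc.IH)
      show "?f2 x \<le> ?s" for x using Suc.prems(3)[of x] Suc.prems(4) by (intro max.boundedI) auto
    qed (use A_min[OF Suc.prems(1,2) s] s in auto)
    have "\<bar>quartic_defect f\<bar> \<le> 168 * ?s\<^sup>2 * E ?f1 ?f1 * (1/4)^n + 168 * ?s\<^sup>2 * E ?f2 ?f2 * (1/4)^n"
      unfolding sp(1) using 1 2 by linarith
    also have "\<dots> = 168 * m\<^sup>2 * E f f * (1/4)^Suc n"
      unfolding sp(2) by (simp add: power2_eq_square algebra_simps)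
    finally show ?case .
  qed
  obtain m where m: "0 < m" "\<And>x. \<bar>f x\<bar> \<le> m" using Cc_bounded[OF A_Cc[OF assms(1)]] by metis
  have "(\<lambda>n. 168 * m\<^sup>2 * E f f * (1/4)^n) \<longlonglongrightarrow> 168 * m\<^sup>2 * E f f * 0"
    by (intro tendsto_intros LIMSEQ_power_zero) auto
  then have "\<bar>quartic_defect f\<bar> \<le> 168 * m\<^sup>2 * E f f * 0"
    by (rule LIMSEQ_le_const) (use bound[OF assms, of m] m in \<open>auto intro: abs_le_D1\<close>)
  then show ?thesis by simp
qed

text \<open>The coefficient of \<open>t\<^sup>2\<close> in \<open>quartic_defect (f + t g) = 0\<close>.\<close>

lemma Leibniz:
  assumes f: "f \<in> A" "\<And>x. 0 \<le> f x" and g: "g \<in> A" "\<And>x. 0 \<le> g x"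
  shows "2 * E (\<lambda>x. f x * g x) (\<lambda>x. f x * g x) =
    2 * E f (\<lambda>x. g x * g x * f x) + 2 * E g (\<lambda>x. f x * f x * g x) - E (\<lambda>x. f x * f x) (\<lambda>x. g x * g x)"
proof -
  let ?f2 = "\<lambda>x. f x * f x" and ?g2 = "\<lambda>x. g x * g x" and ?fg = "\<lambda>x. f x * g x"
  let ?f3 = "\<lambda>x. f x * f x * f x" and ?g3 = "\<lambda>x. g x * g x * g x"
    and ?ffg = "\<lambda>x. f x * f x * g x" and ?ggf = "\<lambda>x. g x * g x * f x"
  have M: "?f2 \<in> A" "?g2 \<in> A" "?fg \<in> A" "?f3 \<in> A" "?g3 \<in> A" "?ffg \<in> A" "?ggf \<in> A"
    using f g by (auto intro!: A_mult)
  define Q1 where "Q1 = 4 * (3 * E f ?ffg + E g ?f3) - 12 * E ?f2 ?fg"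
  define Q2 where "Q2 = 12 * E f ?ggf + 12 * E g ?ffg - 6 * E ?f2 ?g2 - 12 * E ?fg ?fg"
  define Q3 where "Q3 = 4 * (E f ?g3 + 3 * E g ?ggf) - 12 * E ?fg ?g2"
  \<comment> \<open>t is non-negative because \<open>quartic_defect_eq_0\<close> is about
    non-negative functions. The coefficients of t^0 and t^4 are the defects of f and g
    themselves.\<close>
  have exp: "t * Q1 + t\<^sup>2 * Q2 + t^3 * Q3 = 0" if t: "0 \<le> t" for t
  proof -
    let ?h = "\<lambda>x. f x + t * g x"
    have hA: "?h \<in> A" using f g by (intro A.mems)
    have h0: "0 \<le> ?h x" for x using f(2)[of x] g(2)[of x] t by simp
    have e2: "(\<lambda>x. ?h x * ?h x) = (\<lambda>x. ?f2 x + (2 * t * ?fg x + t\<^sup>2 * ?g2 x))"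
      by (simp add: fun_eq_iff power2_eq_square algebra_simps)
    have e3: "(\<lambda>x. ?h x * ?h x * ?h x) = (\<lambda>x. ?f3 x + (3 * t * ?ffg x + (3 * t\<^sup>2 * ?ggf x + t^3 * ?g3 x)))"
      by (simp add: fun_eq_iff power2_eq_square power3_eq_cube algebra_simps)
    have sy: "E ?fg ?f2 = E ?f2 ?fg" "E ?g2 ?f2 = E ?f2 ?g2" "E ?g2 ?fg = E ?fg ?g2"
      using M by (intro A.sym; simp)+
    have E2: "E (\<lambda>x. ?h x * ?h x) (\<lambda>x. ?h x * ?h x) = E ?f2 ?f2 + 4 * t * E ?f2 ?fg
        + 2 * t\<^sup>2 * E ?f2 ?g2 + 4 * t\<^sup>2 * E ?fg ?fg + 4 * t^3 * E ?fg ?g2 + t^4 * E ?g2 ?g2"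
      unfolding e2 using M by (simp add: A.lins A.mems sy) algebra
    have E3: "E ?h (\<lambda>x. ?h x * ?h x * ?h x) = E f ?f3 + t * (3 * E f ?ffg + E g ?f3)
        + t\<^sup>2 * (3 * E f ?ggf + 3 * E g ?ffg) + t^3 * (E f ?g3 + 3 * E g ?ggf) + t^4 * E g ?g3"
      unfolding e3 using f g M by (simp add: A.lins A.mems)
        (simp add: algebra_simps power2_eq_square power3_eq_cube power4_eq_xxxx)
    have z: "4 * E f ?f3 - 3 * E ?f2 ?f2 = 0" "4 * E g ?g3 - 3 * E ?g2 ?g2 = 0"
      using quartic_defect_eq_0[OF f] quartic_defect_eq_0[OF g] by (auto simp: quartic_defect_def)
    have "0 = quartic_defect ?h" using quartic_defect_eq_0[OF hA h0] by simp
    also have "\<dots> = (4 * E f ?f3 - 3 * E ?f2 ?f2) + t * Q1 + t\<^sup>2 * Q2 + t^3 * Q3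
        + t^4 * (4 * E g ?g3 - 3 * E ?g2 ?g2)"
      unfolding quartic_defect_def E2 E3 Q1_def Q2_def Q3_def by algebra
    finally show ?thesis unfolding z by simp
  qed
  \<comment> \<open>The linear system given by t = 1, 2, 3 has only the zero solution.\<close>
  have "Q2 = 0" using exp[of 1] exp[of 2] exp[of 3] by simp
  then show ?thesis by (simp add: Q2_def)
qed

end


section \<open>Energy measures\<close>

lemma integral_finite_range:
  fixes h :: "'b \<Rightarrow> real"
  assumes "finite_measure \<nu>" "finite R" "\<And>x. x \<in> space \<nu> \<Longrightarrow> p x \<in> R"
    and "\<And>r. r \<in> R \<Longrightarrow> {x \<in> space \<nu>. p x = r} \<in> sets \<nu>"
  shows "(\<integral>x. h (p x) \<partial>\<nu>) = (\<Sum>r\<in>R. h r * measure \<nu> {x \<in> space \<nu>. p x = r})"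
proof -
  interpret finite_measure \<nu> by fact
  have "(\<integral>x. h (p x) \<partial>\<nu>) = (\<integral>x. (\<Sum>r\<in>R. h r * indicator {x \<in> space \<nu>. p x = r} x) \<partial>\<nu>)"
  proof (rule Bochner_Integration.integral_cong)
    fix x assume x: "x \<in> space \<nu>"
    have "(\<Sum>r\<in>R. h r * indicator {x \<in> space \<nu>. p x = r} x) = (\<Sum>r\<in>R. if r = p x then h r else 0)"
      using x by (intro sum.cong) auto
    also have "\<dots> = h (p x)" using assms(2,3) x by simp
    finally show "h (p x) = (\<Sum>r\<in>R. h r * indicator {x \<in> space \<nu>. p x = r} x)" by simp
  qed simp
  also have "\<dots> = (\<Sum>r\<in>R. \<integral>x. h r * indicator {x \<in> space \<nu>. p x = r} x \<partial>\<nu>)"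
    by (rule Bochner_Integration.integral_sum) (use assms(4) in \<open>auto simp: emeasure_eq_measure\<close>)
  also have "\<dots> = (\<Sum>r\<in>R. h r * measure \<nu> {x \<in> space \<nu>. p x = r})"
    by (intro sum.cong) (auto simp: Int_def intro!: arg_cong[where f = "measure \<nu>"])
  finally show ?thesis .
qed

text \<open>\<open>energy_measure\<close> gives bilinearity one Borel set at a time, so inequalities
  between integrals are proved for finitely many values before a limit is taken.
  \<open>Suc n\<close> keeps the mesh defined at n = 0.\<close>

definition discretize :: "nat \<Rightarrow> real \<Rightarrow> real" where
  "discretize n t = real_of_int \<lfloor>real (Suc n) * t\<rfloor> / real (Suc n)"

lemma discretize_error: "\<bar>discretize n t - t\<bar> \<le> inverse (real (Suc n))"
proof -
  have "discretize n t - t = (real_of_int \<lfloor>real (Suc n) * t\<rfloor> - real (Suc n) * t) / real (Suc n)"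
    by (simp add: discretize_def diff_divide_distrib del: of_nat_Suc)
  also have "\<bar>\<dots>\<bar> = \<bar>real_of_int \<lfloor>real (Suc n) * t\<rfloor> - real (Suc n) * t\<bar> / real (Suc n)"
    by (simp del: of_nat_Suc)
  also have "\<dots> \<le> 1 / real (Suc n)"
    by (intro divide_right_mono) linarith+
  finally show ?thesis by (simp add: inverse_eq_divide)
qed

lemma discretize_tendsto: "(\<lambda>n. discretize n t) \<longlonglongrightarrow> t"
proof -
  have "(\<lambda>n. discretize n t - t) \<longlonglongrightarrow> 0"
    by (rule Lim_null_comparison[OF _ LIMSEQ_inverse_real_of_nat])
       (use discretize_error in auto)
  then show ?thesis by (simp add: LIM_zero_iff)
qed

lemma discretize_bound: "\<bar>t\<bar> \<le> K \<Longrightarrow> \<bar>discretize n t\<bar> \<le> K + 1"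
proof -
  assume "\<bar>t\<bar> \<le> K"
  moreover have "inverse (real (Suc n)) \<le> 1" by (simp add: inverse_eq_divide)
  ultimately show ?thesis using discretize_error[of n t] by linarith
qed

locale energy_form = strongly_local_form +
  fixes \<Gamma> :: "('a \<Rightarrow> real) \<Rightarrow> 'a measure"
  assumes energy: "energy_measure \<mu> F E \<Gamma>"
begin

lemma sets_energy: "f \<in> F \<Longrightarrow> sets (\<Gamma> f) = sets borel"
  and finite_energy: "f \<in> F \<Longrightarrow> finite_measure (\<Gamma> f)"
  using energy unfolding energy_measure_def by auto

lemma space_energy: "f \<in> F \<Longrightarrow> space (\<Gamma> f) = UNIV"
  using sets_eq_imp_space_eq[OF sets_energy] by simp

lemma energy_pair_form:
  assumes "S \<in> sets borel"
  shows "nonneg_form F (\<lambda>f g. energy_pair \<Gamma> f g S)"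
    and "f \<in> F \<Longrightarrow> energy_pair \<Gamma> f f S = measure (\<Gamma> f) S"
proof -
  have *: "sym_bilinear_on F (\<lambda>f g. energy_pair \<Gamma> f g S) \<and> (\<forall>f\<in>F. energy_pair \<Gamma> f f S = measure (\<Gamma> f) S)"
    using energy assms unfolding energy_measure_def by blast
  then show "f \<in> F \<Longrightarrow> energy_pair \<Gamma> f f S = measure (\<Gamma> f) S" by blast
  show "nonneg_form F (\<lambda>f g. energy_pair \<Gamma> f g S)"
  proof
    show "sym_bilinear_on F (\<lambda>f g. energy_pair \<Gamma> f g S)" using * by blast
    show "0 \<le> energy_pair \<Gamma> f f S" if "f \<in> F" for f using * that by simp
  qed (rule zero_mem, rule comb_mem)
qed

lemma energy_total: "f \<in> F \<Longrightarrow> measure (\<Gamma> f) UNIV = E f f"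
  using energy energy_pair_form(2)[of UNIV f] unfolding energy_measure_def by simp

lemma energy_Cc_integral:
  fixes K :: real
  assumes "f \<in> F" "\<And>x. \<bar>f x\<bar> \<le> K" "a \<in> A"
  shows "(\<integral>x. a x \<partial>\<Gamma> f) = E f (\<lambda>x. a x * f x) - E (\<lambda>x. f x * f x) a / 2"
proof -
  have "\<forall>f\<in>F. \<forall>\<phi>\<in>F \<inter> Cc. (\<exists>K. AE x in \<mu>. \<bar>f x\<bar> \<le> K) \<longrightarrow>
        (\<integral>x. \<phi> x \<partial>\<Gamma> f) = E f (\<lambda>x. \<phi> x * f x) - E (\<lambda>x. (f x)\<^sup>2) \<phi> / 2"
    using energy unfolding energy_measure_def by (elim conjE)
  from this[rule_format, OF assms(1), of a] assms(2,3) show ?thesis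
    by (auto simp: A_def power2_eq_square)
qed

lemma energy_integrable:
  fixes K :: real
  assumes "f \<in> F" "u \<in> borel_measurable borel" "\<And>x. \<bar>u x\<bar> \<le> K"
  shows "integrable (\<Gamma> f) u"
proof -
  interpret finite_measure "\<Gamma> f" using assms(1) by (rule finite_energy)
  have "u \<in> borel_measurable (\<Gamma> f)"
    using assms(2) measurable_cong_sets[OF sets_energy[OF assms(1)] refl] by blast
  then show ?thesis by (intro integrable_const_bound[of _ K]) (use assms(3) in auto)
qed

text \<open>The left side is twice the integral of u w d\<Gamma>(f, g). On a set where u = i and w =
  j the inequality is the non-negativity of d\<Gamma>(i f - j g, i f - j g); discretizing u and w
  reduces to such sets, and dominated convergence removes the discretization.\<close>

lemma weighted_Cauchy_Schwarz:
  fixes K :: real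
  assumes f: "f \<in> F" and g: "g \<in> F"
    and u: "u \<in> borel_measurable borel" "\<And>x. \<bar>u x\<bar> \<le> K"
    and w: "w \<in> borel_measurable borel" "\<And>x. \<bar>w x\<bar> \<le> K"
  shows "((\<integral>x. u x * w x \<partial>\<Gamma> (\<lambda>x. f x + g x)) - (\<integral>x. u x * w x \<partial>\<Gamma> (\<lambda>x. f x - g x))) / 2
    \<le> (\<integral>x. u x * u x \<partial>\<Gamma> f) + (\<integral>x. w x * w x \<partial>\<Gamma> g)"
proof -
  let ?s = "\<lambda>x. f x + g x" and ?d = "\<lambda>x. f x - g x"
  have sF: "?s \<in> F" and dF: "?d \<in> F" using f g by (auto intro: mems)
  have K: "0 \<le> K" using u(2)[of undefined] by linarith
  let ?u = "\<lambda>n x. discretize n (u x)" and ?w = "\<lambda>n x. discretize n (w x)"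
  have lim: "(\<lambda>n. \<integral>x. discretize n (a x) * discretize n (b x) \<partial>\<Gamma> h) \<longlonglongrightarrow> (\<integral>x. a x * b x \<partial>\<Gamma> h)"
    if h: "h \<in> F" and a: "a \<in> borel_measurable borel" "\<And>x. \<bar>a x\<bar> \<le> K"
      and b: "b \<in> borel_measurable borel" "\<And>x. \<bar>b x\<bar> \<le> K" for h a b
  proof -
    interpret finite_measure "\<Gamma> h" using h by (rule finite_energy)
    have m: "k \<in> borel_measurable (\<Gamma> h) \<longleftrightarrow> k \<in> borel_measurable borel" for k :: "'a \<Rightarrow> real"
      using measurable_cong_sets[OF sets_energy[OF h] refl] by blast
    show ?thesis
    proof (rule integral_dominated_convergence[where w = "\<lambda>_. (K + 1) * (K + 1)"])
      show "(\<lambda>x. a x * b x) \<in> borel_measurable (\<Gamma> h)" unfolding m using a b by measurable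
      show "(\<lambda>x. discretize n (a x) * discretize n (b x)) \<in> borel_measurable (\<Gamma> h)" for n
        unfolding m discretize_def using a b by measurable
      show "AE x in \<Gamma> h. (\<lambda>n. discretize n (a x) * discretize n (b x)) \<longlonglongrightarrow> a x * b x"
        by (intro AE_I2 tendsto_mult discretize_tendsto)
      show "AE x in \<Gamma> h. norm (discretize n (a x) * discretize n (b x)) \<le> (K + 1) * (K + 1)" for n
        unfolding real_norm_def abs_mult
        by (intro AE_I2 mult_mono discretize_bound a b) (use K in auto)
    qed simp
  qed
  define S where "S n = (\<integral>x. ?u n x * ?u n x \<partial>\<Gamma> f) + (\<integral>x. ?w n x * ?w n x \<partial>\<Gamma> g)
      - ((\<integral>x. ?u n x * ?w n x \<partial>\<Gamma> ?s) - (\<integral>x. ?u n x * ?w n x \<partial>\<Gamma> ?d)) / 2" for n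
  have "S n \<ge> 0" for n
  proof -
    define N where "N = \<lceil>real (Suc n) * K\<rceil> + 1"
    let ?I = "\<lambda>t. \<lfloor>real (Suc n) * t\<rfloor>"
    \<comment> \<open>The pair of integer parts cuts the space into finitely many Borel sets
      \<open>T r\<close> on which both discretized weights are constant.\<close>
    define p where "p x = (?I (u x), ?I (w x))" for x
    define R where "R = {- N..N} \<times> {- N..N}"
    define T where "T r = {x. p x = r}" for r
    let ?c = "\<lambda>i. real_of_int i / real (Suc n)"
    have fl: "?I t \<in> {- N..N}" if "\<bar>t\<bar> \<le> K" for t
    proof -
      have "\<bar>real (Suc n) * t\<bar> \<le> real (Suc n) * K"
        unfolding abs_mult using that by (intro mult_mono) auto
      then show ?thesis unfolding N_def atLeastAtMost_iff by linarith
    qed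
    have pR: "p x \<in> R" for x using fl[OF u(2)] fl[OF w(2)] by (auto simp: p_def R_def)
    have Tm: "T r \<in> sets borel" for r
    proof -
      have "T r = {x \<in> space borel. ?I (u x) = fst r \<and> ?I (w x) = snd r}"
        by (auto simp: T_def p_def)
      also have "\<dots> \<in> sets borel" using u(1) w(1) by measurable
      finally show ?thesis .
    qed
    have int: "(\<integral>x. h (p x) \<partial>\<Gamma> k) = (\<Sum>r\<in>R. h r * measure (\<Gamma> k) (T r))" if "k \<in> F" for k and h :: "int \<times> int \<Rightarrow> real"
      using integral_finite_range[OF finite_energy[OF that], of R p h] pR Tm
      by (simp add: space_energy[OF that] sets_energy[OF that] T_def R_def)
    have "S n = (\<Sum>r\<in>R. (?c (fst r) * ?c (fst r)) * measure (\<Gamma> f) (T r) + (?c (snd r) * ?c (snd r)) * measure (\<Gamma> g) (T r)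
       - ((?c (fst r) * ?c (snd r)) * measure (\<Gamma> ?s) (T r) - (?c (fst r) * ?c (snd r)) * measure (\<Gamma> ?d) (T r)) / 2)"
      using int[OF f, of "\<lambda>r. ?c (fst r) * ?c (fst r)"] int[OF g, of "\<lambda>r. ?c (snd r) * ?c (snd r)"]
        int[OF sF, of "\<lambda>r. ?c (fst r) * ?c (snd r)"] int[OF dF, of "\<lambda>r. ?c (fst r) * ?c (snd r)"]
      by (simp only: S_def discretize_def p_def fst_conv snd_conv sum.distrib sum_subtractf sum_divide_distrib[symmetric])
    also have "\<dots> \<ge> 0"
    proof (rule sum_nonneg)
      fix r assume "r \<in> R"
      let ?i = "?c (fst r)" and ?j = "?c (snd r)"
      interpret P: nonneg_form F "\<lambda>f g. energy_pair \<Gamma> f g (T r)" by (rule energy_pair_form(1)[OF Tm])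
      note eq = energy_pair_form(2)[OF Tm]
      have arith: "0 \<le> (i * i) * a + (j * j) * c - ((i * j) * b - (i * j) * b') / 2"
        if "0 \<le> i * i * a + j * j * c - 2 * i * j * ((b - b') / 4)" for i j a b b' c :: real
        using that by (simp add: algebra_simps diff_divide_distrib)
      have expand: "energy_pair \<Gamma> (\<lambda>x. i * f x - j * g x) (\<lambda>x. i * f x - j * g x) (T r)
        = i * i * energy_pair \<Gamma> f f (T r) + j * j * energy_pair \<Gamma> g g (T r)
          - 2 * i * j * energy_pair \<Gamma> f g (T r)" for i j :: real
        using f g P.sym[of g f] by (simp add: P.lins mems) (simp add: algebra_simps)
      have "0 \<le> energy_pair \<Gamma> (\<lambda>x. ?i * f x - ?j * g x) (\<lambda>x. ?i * f x - ?j * g x) (T r)"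
        using f g by (intro P.nonneg mems)
      also have "\<dots> = ?i * ?i * energy_pair \<Gamma> f f (T r) + ?j * ?j * energy_pair \<Gamma> g g (T r)
          - 2 * ?i * ?j * energy_pair \<Gamma> f g (T r)"
        by (rule expand)
      also have "energy_pair \<Gamma> f g (T r) = (measure (\<Gamma> ?s) (T r) - measure (\<Gamma> ?d) (T r)) / 4"
        by (simp add: energy_pair_def)
      finally show "0 \<le> (?i * ?i) * measure (\<Gamma> f) (T r) + (?j * ?j) * measure (\<Gamma> g) (T r)
       - ((?i * ?j) * measure (\<Gamma> ?s) (T r) - (?i * ?j) * measure (\<Gamma> ?d) (T r)) / 2"
        unfolding eq[OF f] eq[OF g] by (rule arith)
    qed
    finally show ?thesis .
  qed
  moreover have "S \<longlonglongrightarrow> (\<integral>x. u x * u x \<partial>\<Gamma> f) + (\<integral>x. w x * w x \<partial>\<Gamma> g)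
      - ((\<integral>x. u x * w x \<partial>\<Gamma> ?s) - (\<integral>x. u x * w x \<partial>\<Gamma> ?d)) / 2"
    unfolding S_def using f g sF dF u w by (intro tendsto_intros lim) auto
  ultimately have "0 \<le> (\<integral>x. u x * u x \<partial>\<Gamma> f) + (\<integral>x. w x * w x \<partial>\<Gamma> g)
      - ((\<integral>x. u x * w x \<partial>\<Gamma> ?s) - (\<integral>x. u x * w x \<partial>\<Gamma> ?d)) / 2"
    by (intro LIMSEQ_le_const) auto
  then show ?thesis by simp
qed

text \<open>\<open>\<integral> a d\<Gamma>(f, g)\<close> expressed through the form.\<close>

definition weighted_form :: "('a \<Rightarrow> real) \<Rightarrow> ('a \<Rightarrow> real) \<Rightarrow> ('a \<Rightarrow> real) \<Rightarrow> real" where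
  "weighted_form a f g = (E f (\<lambda>x. a x * g x) + E g (\<lambda>x. a x * f x) - E (\<lambda>x. f x * g x) a) / 2"

lemma weighted_form_diag:
  assumes "a \<in> A" "f \<in> A"
  shows "weighted_form a f f = (\<integral>x. a x \<partial>\<Gamma> f)"
proof -
  obtain K where "\<And>x. \<bar>f x\<bar> \<le> K" using Cc_bounded[OF A_Cc[OF assms(2)]] by metis
  from energy_Cc_integral[OF A_F[OF assms(2)] this assms(1)] show ?thesis
    by (simp add: weighted_form_def)
qed

lemma weighted_form_bilinear:
  assumes a: "a \<in> A"
  shows "sym_bilinear_on A (weighted_form a)"
  unfolding sym_bilinear_on_def
proof (intro conjI ballI allI)
  fix f g assume "f \<in> A" "g \<in> A"
  have "(\<lambda>x. f x * g x) = (\<lambda>x. g x * f x)" by (simp add: mult.commute)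
  then show "weighted_form a f g = weighted_form a g f" unfolding weighted_form_def by simp
next
  fix f g h c assume A: "f \<in> A" "g \<in> A" "h \<in> A"
  have M: "(\<lambda>x. a x * k x) \<in> A" "(\<lambda>x. k x * h x) \<in> A" if "k \<in> A" for k
    using that a A by (auto intro: A_mult)
  have 1: "(\<lambda>x. a x * (c * f x + g x)) = (\<lambda>x. c * (a x * f x) + a x * g x)"
    "(\<lambda>x. (c * f x + g x) * h x) = (\<lambda>x. c * (f x * h x) + g x * h x)"
    by (auto simp: algebra_simps)
  show "weighted_form a (\<lambda>x. c * f x + g x) h = c * weighted_form a f h + weighted_form a g h"
    unfolding weighted_form_def 1 using a A M[OF A(1)] M[OF A(2)] M[OF A(3)]
    by (simp add: A.lins A.mems) (simp add: algebra_simps add_divide_distrib diff_divide_distrib)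
qed

lemma weighted_form_nonneg:
  assumes a: "a \<in> A" "\<And>x. 0 \<le> a x"
  shows "nonneg_form A (weighted_form a)"
proof
  show "0 \<le> weighted_form a f f" if "f \<in> A" for f
    unfolding weighted_form_diag[OF a(1) that] using a(2) by simp
qed (rule A_zero, rule A_comb, assumption+, rule weighted_form_bilinear[OF a(1)])

lemma A_borel: "a \<in> A \<Longrightarrow> a \<in> borel_measurable borel"
  by (rule borel_measurable_continuous_onI[OF A_cont])

text \<open>Read through the energy formula, \<open>Leibniz\<close> makes E(f g, f g) the sum of the
  integrals of g^2 d\<Gamma>(f), f^2 d\<Gamma>(g) and 2 f g d\<Gamma>(f, g). The mixed one is at
  most the sum of the other two, whence the factors 2.\<close>

lemma energy_product:
  assumes f: "f \<in> A" "\<And>x. 0 \<le> f x" and g: "g \<in> A" "\<And>x. 0 \<le> g x"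
  shows "E (\<lambda>x. f x * g x) (\<lambda>x. f x * g x)
    \<le> 2 * (\<integral>x. g x * g x \<partial>\<Gamma> f) + 2 * (\<integral>x. f x * f x \<partial>\<Gamma> g)"
proof -
  let ?fg = "\<lambda>x. f x * g x" and ?gg = "\<lambda>x. g x * g x" and ?ff = "\<lambda>x. f x * f x"
  have M: "?fg \<in> A" "?gg \<in> A" "?ff \<in> A" using f g by (auto intro: A_mult)
  obtain K where K: "\<And>x. \<bar>f x\<bar> \<le> K" using Cc_bounded[OF A_Cc[OF f(1)]] by metis
  obtain K' where K': "\<And>x. \<bar>g x\<bar> \<le> K'" using Cc_bounded[OF A_Cc[OF g(1)]] by metis
  interpret W: nonneg_form A "weighted_form ?fg"
    by (rule weighted_form_nonneg[OF M(1)]) (use f g in auto)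
  have cs: "((\<integral>x. g x * f x \<partial>\<Gamma> (\<lambda>x. f x + g x)) - (\<integral>x. g x * f x \<partial>\<Gamma> (\<lambda>x. f x - g x))) / 2
    \<le> (\<integral>x. g x * g x \<partial>\<Gamma> f) + (\<integral>x. f x * f x \<partial>\<Gamma> g)"
    by (rule weighted_Cauchy_Schwarz[where K = "max K K'"])
       (use K K' f g in \<open>auto intro: A_F A_borel simp: le_max_iff_disj\<close>)
  have gf: "(\<lambda>x. g x * f x) = ?fg" by (simp add: mult.commute)
  have "(\<integral>x. g x * f x \<partial>\<Gamma> (\<lambda>x. f x + g x)) - (\<integral>x. g x * f x \<partial>\<Gamma> (\<lambda>x. f x - g x))
      = weighted_form ?fg (\<lambda>x. f x + g x) (\<lambda>x. f x + g x) - weighted_form ?fg (\<lambda>x. f x - g x) (\<lambda>x. f x - g x)"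
    unfolding gf using weighted_form_diag[OF M(1)] f g A.mems by simp
  also have "\<dots> = 4 * weighted_form ?fg f g"
    using f g W.sym[of g f] by (simp add: W.lins W.mems)
  finally have 1: "2 * weighted_form ?fg f g \<le> (\<integral>x. g x * g x \<partial>\<Gamma> f) + (\<integral>x. f x * f x \<partial>\<Gamma> g)"
    using cs by simp
  have e: "(\<lambda>x. f x * g x * g x) = (\<lambda>x. g x * g x * f x)" "(\<lambda>x. f x * g x * f x) = (\<lambda>x. f x * f x * g x)"
    by (auto simp: algebra_simps)
  have 2: "2 * weighted_form ?fg f g = E f (\<lambda>x. g x * g x * f x) + E g (\<lambda>x. f x * f x * g x) - E ?fg ?fg"
    unfolding weighted_form_def e by simp
  have 3: "(\<integral>x. g x * g x \<partial>\<Gamma> f) = E f (\<lambda>x. g x * g x * f x) - E ?ff ?gg / 2"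
    "(\<integral>x. f x * f x \<partial>\<Gamma> g) = E g (\<lambda>x. f x * f x * g x) - E ?gg ?ff / 2"
    using energy_Cc_integral[OF A_F[OF f(1)] K M(2)] energy_Cc_integral[OF A_F[OF g(1)] K' M(3)] by auto
  have 4: "E ?gg ?ff = E ?ff ?gg" using M by (intro A.sym)
  show ?thesis using Leibniz[OF f g] 1 2 3 4 by linarith
qed

end


section \<open>Doubling, nets and cutoff functions\<close>

locale doubling_measure =
  fixes \<mu> :: "'a::polish_space measure" and D :: real
  assumes borel_sets: "sets \<mu> = sets borel"
    and ball_finite_pos: "\<And>x r. 0 < r \<Longrightarrow> 0 < emeasure \<mu> (ball x r) \<and> emeasure \<mu> (ball x r) < \<infinity>"
    and D_pos: "0 < D"
    and doubling: "\<And>x r. 0 < r \<Longrightarrow> emeasure \<mu> (ball x (2 * r)) \<le> ennreal D * emeasure \<mu> (ball x r)"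
begin

lemma ball_sets: "ball x r \<in> sets \<mu>"
  using borel_sets by simp

lemma ball_fmeasurable: "ball x r \<in> fmeasurable \<mu>"
  using ball_finite_pos[of r x] ball_sets by (cases "0 < r") (auto simp: fmeasurable_def ball_empty not_less)

lemma ball_measure_pos: "0 < r \<Longrightarrow> 0 < measure \<mu> (ball x r)"
  using ball_finite_pos[of r x] by (auto simp: measure_def enn2real_positive_iff)

lemma iterated_doubling:
  assumes "0 < r"
  shows "measure \<mu> (ball x (2 ^ k * r)) \<le> D ^ k * measure \<mu> (ball x r)"
proof (induction k)
  case (Suc k)
  have e: "emeasure \<mu> (ball x t) = ennreal (measure \<mu> (ball x t))" for t
    using ball_fmeasurable by (intro emeasure_eq_measure2)
  have "ennreal (measure \<mu> (ball x (2 * (2 ^ k * r)))) \<le> ennreal (D * measure \<mu> (ball x (2 ^ k * r)))"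
    using doubling[of "2 ^ k * r" x] assms D_pos unfolding e by (simp add: ennreal_mult)
  then have "measure \<mu> (ball x (2 * (2 ^ k * r))) \<le> D * measure \<mu> (ball x (2 ^ k * r))"
    using D_pos by (subst (asm) ennreal_le_iff) auto
  also have "\<dots> \<le> D * (D ^ k * measure \<mu> (ball x r))"
    using Suc D_pos by (intro mult_left_mono) auto
  finally show ?case by (simp add: algebra_simps)
qed simp

text \<open>The balls of radius s/2 about S are disjoint and lie in U = B(z, \<rho> + s). Conversely
  U lies in B(x, 2 \<rho> + s) for each x in S, so after k doublings each small ball carries at
  least the fraction 1 / D^k of the measure of U.\<close>

lemma packing:
  fixes z :: 'a
  assumes "finite S" and S: "\<And>x. x \<in> S \<Longrightarrow> dist z x < \<rho>"
    and sep: "\<And>x y. x \<in> S \<Longrightarrow> y \<in> S \<Longrightarrow> x \<noteq> y \<Longrightarrow> s \<le> dist x y"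
    and pos: "0 < \<rho>" "0 < s" and k: "2 * \<rho> + s \<le> 2 ^ k * (s / 2)"
  shows "real (card S) \<le> D ^ k"
proof -
  let ?U = "ball z (\<rho> + s)"
  have U: "0 < measure \<mu> ?U" using pos by (intro ball_measure_pos) auto
  have sub: "(\<Union>x\<in>S. ball x (s / 2)) \<subseteq> ?U"
  proof clarify
    fix x y assume "x \<in> S" "y \<in> ball x (s / 2)"
    then show "y \<in> ?U" using S[of x] dist_triangle[of z y x] pos by auto
  qed
  have disj: "disjoint_family_on (\<lambda>x. ball x (s / 2)) S"
  proof (unfold disjoint_family_on_def, intro ballI impI)
    fix x y assume xy: "x \<in> S" "y \<in> S" "x \<noteq> y"
    show "ball x (s / 2) \<inter> ball y (s / 2) = {}"
    proof (rule ccontr)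
      assume "ball x (s / 2) \<inter> ball y (s / 2) \<noteq> {}"
      then obtain w where "dist x w < s / 2" "dist y w < s / 2" by auto
      then have "dist x y < s" using dist_triangle[of x y w] dist_commute[of y w] by linarith
      then show False using sep[OF xy] by linarith
    qed
  qed
  have "real (card S) * measure \<mu> ?U = (\<Sum>x\<in>S. measure \<mu> ?U)" by simp
  also have "\<dots> \<le> (\<Sum>x\<in>S. D ^ k * measure \<mu> (ball x (s / 2)))"
  proof (rule sum_mono)
    fix x assume x: "x \<in> S"
    have "?U \<subseteq> ball x (2 ^ k * (s / 2))"
    proof
      fix y assume "y \<in> ?U"
      then show "y \<in> ball x (2 ^ k * (s / 2))"
        using S[OF x] dist_triangle[of x y z] dist_commute[of x z] k by auto
    qed
    then have "measure \<mu> ?U \<le> measure \<mu> (ball x (2 ^ k * (s / 2)))"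
      by (rule measure_mono_fmeasurable[OF _ ball_sets ball_fmeasurable])
    also have "\<dots> \<le> D ^ k * measure \<mu> (ball x (s / 2))"
      using pos by (intro iterated_doubling) auto
    finally show "measure \<mu> ?U \<le> D ^ k * measure \<mu> (ball x (s / 2))" .
  qed
  also have "\<dots> = D ^ k * (\<Sum>x\<in>S. measure \<mu> (ball x (s / 2)))"
    by (simp add: sum_distrib_left)
  also have "(\<Sum>x\<in>S. measure \<mu> (ball x (s / 2))) = measure \<mu> (\<Union>x\<in>S. ball x (s / 2))"
    using assms(1) disj ball_sets ball_fmeasurable[unfolded fmeasurable_def]
    by (intro measure_finite_Union[symmetric]) (auto simp: less_top)
  also have "D ^ k * measure \<mu> (\<Union>x\<in>S. ball x (s / 2)) \<le> D ^ k * measure \<mu> ?U"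
    using D_pos assms(1) ball_sets
    by (intro mult_left_mono measure_mono_fmeasurable[OF sub _ ball_fmeasurable] sets.finite_UN) auto
  finally show ?thesis using U by simp
qed

lemma packing_exponent:
  fixes \<rho> s :: real
  assumes "0 < s"
  obtains k where "2 * \<rho> + s \<le> 2 ^ k * (s / 2)"
proof -
  obtain k where "(2 * \<rho> + s) / (s / 2) < 2 ^ k" using real_arch_pow[of 2] by auto
  then show ?thesis using assms by (intro that[of k]) (simp add: field_simps)
qed

text \<open>\<open>packing\<close> bounds the size of separated subsets, so one of maximal
  cardinality exists; a point of T at distance at least s from all its members could be added to
  it.\<close>

lemma finite_net:
  fixes z :: 'a
  assumes T: "T \<subseteq> ball z \<rho>" and s: "0 < s"
  obtains S where "finite S" "S \<subseteq> T" "\<forall>x\<in>S. \<forall>y\<in>S. x \<noteq> y \<longrightarrow> s \<le> dist x y"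
    "T \<subseteq> (\<Union>x\<in>S. ball x s)"
proof (cases "T = {}")
  case True
  then show ?thesis using that[of "{}"] by auto
next
  case False
  then have \<rho>: "0 < \<rho>" using T by (metis ball_empty linorder_not_less subset_empty)
  obtain k where k: "2 * \<rho> + s \<le> 2 ^ k * (s / 2)" using packing_exponent[OF s] .
  define P where "P S \<longleftrightarrow> finite S \<and> S \<subseteq> T \<and> (\<forall>x\<in>S. \<forall>y\<in>S. x \<noteq> y \<longrightarrow> s \<le> dist x y)" for S
  have "card S < nat \<lceil>D ^ k\<rceil> + 1" if "P S" for S
  proof -
    have "real (card S) \<le> D ^ k"
      by (rule packing[of S z \<rho> s]) (use that T \<rho> s k in \<open>auto simp: P_def\<close>)
    then show ?thesis by linarith
  qed
  moreover have "P {}" by (simp add: P_def)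
  ultimately obtain S where S: "P S" and max: "\<And>S'. P S' \<Longrightarrow> card S' \<le> card S"
    using ex_has_greatest_nat[of P "{}" card "nat \<lceil>D ^ k\<rceil> + 1"] by blast
  have "T \<subseteq> (\<Union>x\<in>S. ball x s)"
  proof (rule ccontr)
    assume "\<not> T \<subseteq> (\<Union>x\<in>S. ball x s)"
    then obtain y where y: "y \<in> T" "\<And>x. x \<in> S \<Longrightarrow> s \<le> dist x y" unfolding subset_iff UN_iff mem_ball not_less by (auto simp: not_less)
    then have "y \<notin> S" using s by fastforce
    have "P (insert y S)" using S y by (auto simp: P_def dist_commute)
    from max[OF this] show False using \<open>y \<notin> S\<close> S by (simp add: P_def)
  qed
  then show ?thesis using that[of S] S by (auto simp: P_def)
qed

text \<open>Completeness together with the finite nets given by doubling. This makes balls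
  admissible as relatively compact sets in \<open>F_loc\<close> and gives cutoffs compact
  support.\<close>

lemma compact_cball: "compact (cball (x :: 'a) r)"
  unfolding compact_eq_totally_bounded
proof (intro conjI allI impI)
  show "complete (cball x r)" by (simp add: complete_eq_closed)
  fix e :: real assume "0 < e"
  have "cball x r \<subseteq> ball x (r + 1)" by auto
  from finite_net[OF this \<open>0 < e\<close>] obtain k where "finite k" "cball x r \<subseteq> (\<Union>x\<in>k. ball x e)" .
  then show "\<exists>k. finite k \<and> cball x r \<subseteq> (\<Union>x\<in>k. ball x e)" by blast
qed

end

section \<open>Cutoffs and tents built from the distance\<close>

locale energy_space = energy_form +
  assumes proper: "\<And>x r. compact (cball (x :: 'a) r)"
    and dist_F_loc: "\<And>x. (\<lambda>y. dist x y) \<in> F_loc \<mu> F"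
    and dist_energy: "\<And>x. \<exists>\<nu>. loc_energy_measure \<mu> F \<Gamma> (\<lambda>y. dist x y) \<nu> \<and>
             (\<forall>S\<in>sets borel. emeasure \<nu> S \<le> emeasure \<mu> S)"
begin

text \<open>Regularity approximates a continuous cutoff by an element of \<open>A\<close> up to a
  uniform error; truncation restores the exact values 0 and 1. No bound on the energy is
  claimed.\<close>

lemma cutoff_function:
  fixes x :: 'a
  assumes "0 < R" "R < R'"
  obtains w where "w \<in> A" "\<And>y. 0 \<le> w y" "\<And>y. w y \<le> 1" "\<And>y. dist x y \<le> R \<Longrightarrow> w y = 1"
    "\<And>y. R' \<le> dist x y \<Longrightarrow> w y = 0"
proof -
  define \<eta> where "\<eta> y = max 0 (min 1 ((R' - dist x y) / (R' - R)))" for y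
  have c: "continuous_on UNIV \<eta>" unfolding \<eta>_def using assms by (intro continuous_intros) auto
  have "{y. \<eta> y \<noteq> 0} \<subseteq> cball x R'"
    using assms by (auto simp: \<eta>_def max_def min_def divide_simps split: if_splits)
  then have "closure {y. \<eta> y \<noteq> 0} \<subseteq> cball x R'" by (rule closure_minimal) simp
  then have "compact (closure {y. \<eta> y \<noteq> 0})"
    using compact_Int_closed[OF proper closed_closure, of x R' "{y. \<eta> y \<noteq> 0}"] by (simp add: Int_absorb1)
  then have "\<eta> \<in> Cc" using c by (simp add: Cc_def)
  then obtain \<phi> where \<phi>: "\<phi> \<in> A" "\<And>y. \<bar>\<eta> y - \<phi> y\<bar> < 1/4"
    using regular unfolding regular_form_def A_def by (metis zero_less_divide_1_iff zero_less_numeral)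
  \<comment> \<open>Where \<eta> = 1 the approximant exceeds 3/4, and 2 * (3/4 - 1/4) = 1; where
    \<eta> = 0 it is below 1/4 and is cut to 0.\<close>
  let ?a = "\<lambda>y. max 0 (max 0 (\<phi> y) - 1/4)"
  have a: "?a \<in> A" by (rule A_min(3)[OF A_pos(1)[OF \<phi>(1)]]) auto
  let ?b = "\<lambda>y. 2 * ?a y"
  have b: "?b \<in> A" using a by (rule A.mems)
  show ?thesis
  proof (rule that[of "\<lambda>y. min 1 (?b y)"])
    show "(\<lambda>y. min 1 (?b y)) \<in> A" by (rule A_min(1)[OF b]) auto
    show "min 1 (?b y) = 1" if "dist x y \<le> R" for y
    proof -
      have "\<eta> y = 1" using that assms by (simp add: \<eta>_def)
      then show ?thesis using \<phi>(2)[of y] by (auto simp: max_def min_def abs_if split: if_splits)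
    qed
    show "min 1 (?b y) = 0" if "R' \<le> dist x y" for y
    proof -
      have "\<eta> y = 0" using that assms by (auto simp: \<eta>_def max_def min_def divide_simps split: if_splits)
      then show ?thesis using \<phi>(2)[of y] by (auto simp: max_def min_def abs_if split: if_splits)
    qed
  qed auto
qed

text \<open>The comparison with \<mu> is known for \<nu>, the glued measure of the distance, which
  is tied to \<Gamma> g on subsets of the ball. Both \<Gamma> g and \<mu> are therefore restricted
  to the ball by densities, which leaves the integral of a unchanged.\<close>

lemma local_energy_le:
  assumes g: "g \<in> F" "\<And>y. y \<in> ball x R \<Longrightarrow> g y = dist x y"
    and a: "a \<in> A" "\<And>y. 0 \<le> a y" "\<And>y. y \<notin> ball x R \<Longrightarrow> a y = 0"
  shows "(\<integral>y. a y \<partial>\<Gamma> g) \<le> (\<integral>y. a y \<partial>\<mu>)"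
proof -
  let ?G = "ball x R"
  obtain \<nu> where \<nu>: "loc_energy_measure \<mu> F \<Gamma> (\<lambda>y. dist x y) \<nu>"
    "\<And>S. S \<in> sets borel \<Longrightarrow> emeasure \<nu> S \<le> emeasure \<mu> S" using dist_energy by blast
  have "closure ?G \<subseteq> cball x R" by (rule closure_minimal) auto
  then have "compact (closure ?G)"
    using compact_Int_closed[OF proper closed_closure, of x R ?G] by (simp add: Int_absorb1)
  moreover have "AE y in \<mu>. y \<in> ?G \<longrightarrow> dist x y = g y" using g(2) by auto
  ultimately have "emeasure \<nu> S = emeasure (\<Gamma> g) S" if "S \<in> sets borel" "S \<subseteq> ?G" for S
    using \<nu>(1)[unfolded loc_energy_measure_def, THEN conjunct2, rule_format, OF open_ball _ g(1) _ that]
    by blast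
  then have le: "emeasure (\<Gamma> g) S \<le> emeasure \<mu> S" if "S \<in> sets borel" "S \<subseteq> ?G" for S
    using \<nu>(2)[of S] that by simp
  have sG: "sets (\<Gamma> g) = sets borel" by (rule sets_energy[OF g(1)])
  have ms: "sets (density (\<Gamma> g) (indicator ?G)) = sets (density \<mu> (indicator ?G))"
    using sG sets_mu by simp
  have "emeasure (density (\<Gamma> g) (indicator ?G)) S \<le> emeasure (density \<mu> (indicator ?G)) S" for S
  proof (cases "S \<in> sets borel")
    case True
    then have "emeasure (density (\<Gamma> g) (indicator ?G)) S = emeasure (\<Gamma> g) (?G \<inter> S)"
      "emeasure (density \<mu> (indicator ?G)) S = emeasure \<mu> (?G \<inter> S)"
      using sG sets_mu by (auto intro!: emeasure_restricted)
    then show ?thesis using le[of "?G \<inter> S"] True by auto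
  qed (use sG sets_mu in \<open>simp add: emeasure_notin_sets\<close>)
  then have "density (\<Gamma> g) (indicator ?G) \<le> density \<mu> (indicator ?G)"
    using ms sets_eq_imp_space_eq[OF ms] by (simp add: le_measure_iff le_fun_def)
  from nn_integral_mono_measure[OF ms this]
  have "(\<integral>\<^sup>+y. ennreal (a y) \<partial>density (\<Gamma> g) (indicator ?G)) \<le> (\<integral>\<^sup>+y. ennreal (a y) \<partial>density \<mu> (indicator ?G))" .
  moreover have "(\<integral>\<^sup>+y. ennreal (a y) \<partial>density M (indicator ?G)) = (\<integral>\<^sup>+y. ennreal (a y) \<partial>M)"
    if "sets M = sets borel" for M
  proof -
    have "a \<in> borel_measurable M" using A_borel[OF a(1)] measurable_cong_sets[OF that refl] by blast
    then have am: "(\<lambda>y. ennreal (a y)) \<in> borel_measurable M" by simp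
    have "(\<integral>\<^sup>+y. ennreal (a y) \<partial>density M (indicator ?G)) = (\<integral>\<^sup>+y. indicator ?G y * ennreal (a y) \<partial>M)"
    proof (rule nn_integral_density)
      show "indicator ?G \<in> borel_measurable M" by (rule borel_measurable_indicator) (simp add: that)
    qed (rule am)
    also have "\<dots> = (\<integral>\<^sup>+y. ennreal (a y) \<partial>M)"
      by (intro nn_integral_cong) (use a(3) in \<open>auto simp: indicator_def\<close>)
    finally show ?thesis .
  qed
  ultimately have nn: "(\<integral>\<^sup>+y. ennreal (a y) \<partial>\<Gamma> g) \<le> (\<integral>\<^sup>+y. ennreal (a y) \<partial>\<mu>)" using sG sets_mu by simp
  obtain K where K: "0 < K" "\<And>y. \<bar>a y\<bar> \<le> K" using Cc_bounded[OF A_Cc[OF a(1)]] by metis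
  have i1: "integrable (\<Gamma> g) a" by (rule energy_integrable[OF g(1) A_borel[OF a(1)] K(2)])
  let ?S = "closure {y. a y \<noteq> 0}"
  have S: "compact ?S" using A_Cc[OF a(1)] by (simp add: Cc_def)
  have "integrable \<mu> (\<lambda>y. K * indicator ?S y)" using compact_measure[OF S] by auto
  then have i2: "integrable \<mu> a"
  proof (rule Bochner_Integration.integrable_bound)
    have "norm (a y) \<le> norm (K * indicator ?S y)" for y
      using K closure_nonzero[of a y] by (cases "a y = 0") auto
    then show "AE y in \<mu>. norm (a y) \<le> norm (K * indicator ?S y)" by auto
  qed (rule Cc_measurable[OF A_Cc[OF a(1)]])
  have "ennreal (\<integral>y. a y \<partial>\<Gamma> g) \<le> ennreal (\<integral>y. a y \<partial>\<mu>)"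
    using nn nn_integral_eq_integral[OF i1] nn_integral_eq_integral[OF i2] a(2) by simp
  then show ?thesis by (subst (asm) ennreal_le_iff) (use a(2) in \<open>auto intro: integral_nonneg\<close>)
qed

definition tent :: "'a \<Rightarrow> real \<Rightarrow> 'a \<Rightarrow> real" where
  "tent x \<rho> y = max 0 (1 - dist x y / \<rho>)"

text \<open>The constant \<open>1\<close> and the distance need not belong to \<open>F\<close>, so \<open>tent x \<rho>\<close> is written as the
  positive part of \<open>w - g / \<rho>\<close> with compactly supported \<open>w\<close> and \<open>g\<close>, which coincide with \<open>1\<close> and
  with the distance on a larger ball.\<close>

lemma tent:
  assumes \<rho>: "0 < \<rho>"
  shows "tent x \<rho> \<in> A"
    and "f \<in> A \<Longrightarrow> (\<integral>y. f y * f y \<partial>\<Gamma> (tent x \<rho>)) \<le> 2 / \<rho>\<^sup>2 * (\<integral>y. indicator (ball x (2 * \<rho>)) y * (f y * f y) \<partial>\<mu>)"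
proof -
  obtain w where w: "w \<in> A" "\<And>y. 0 \<le> w y" "\<And>y. w y \<le> 1" "\<And>y. dist x y \<le> 2 * \<rho> \<Longrightarrow> w y = 1"
    "\<And>y. 3 * \<rho> \<le> dist x y \<Longrightarrow> w y = 0" using cutoff_function[of "2 * \<rho>" "3 * \<rho>" x] \<rho> by auto
  \<comment> \<open>Within distance 2 \<rho> the cutoff is 1 and 4 \<rho> exceeds the distance, so g
    is the distance there; from 3 \<rho> on, g is 0.\<close>
  define g where "g y = min (dist x y) (4 * \<rho> * w y)" for y
  have cF: "(\<lambda>y. 4 * \<rho> * w y) \<in> A" using w by (intro A.mems)
  have gA: "g \<in> A"
  proof -
    let ?G = "ball x (4 * \<rho>)"
    have "closure ?G \<subseteq> cball x (4 * \<rho>)" by (rule closure_minimal) auto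
    then have "compact (closure ?G)"
      using compact_Int_closed[OF proper closed_closure, of x "4 * \<rho>" ?G] by (simp add: Int_absorb1)
    then obtain g0 where g0: "g0 \<in> F" "AE y in \<mu>. y \<in> ?G \<longrightarrow> dist x y = g0 y"
      using dist_F_loc[of x] unfolding F_loc_def by (auto dest!: spec[of _ ?G])
    let ?t = "\<lambda>y. min (4 * \<rho>) (max 0 (g0 y))"
    have t: "?t \<in> F" using truncate(1)[OF g0(1)] \<rho> by simp
    let ?d = "\<lambda>y. ?t y - 4 * \<rho> * w y"
    have d: "?d \<in> F" by (rule mems(3)[OF t A_F[OF cF]])
    have dp: "(\<lambda>y. max 0 (?d y)) \<in> F"
    proof (rule positive_part(1)[OF d])
      show "?d y \<le> 4 * \<rho>" for y using w(2)[of y] \<rho> by (simp add: min_def) (smt (verit) mult_nonneg_nonneg)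
    qed
    \<comment> \<open>min a b = a - max 0 (a - b). Off the ball of radius 4 \<rho>, where
      \<open>g0\<close> is arbitrary, w = 0 makes both \<open>?m\<close> and g vanish.\<close>
    let ?m = "\<lambda>y. ?t y - max 0 (?d y)"
    have m: "?m \<in> F" using t dp by (rule mems)
    have cont: "continuous_on UNIV g" unfolding g_def using w by (intro continuous_intros A_cont)
    have "g \<in> F"
    proof (rule F_AE_cong[OF m])
      show "g \<in> borel_measurable \<mu>"
        using borel_measurable_continuous_onI[OF cont] measurable_cong_sets[OF sets_mu refl] by blast
      show "AE y in \<mu>. ?m y = g y"
        using g0(2)
      proof eventually_elim
        fix y assume y: "y \<in> ?G \<longrightarrow> dist x y = g0 y"
        show "?m y = g y"
        proof (cases "y \<in> ?G")
          case True
          then have "g0 y = dist x y" "dist x y < 4 * \<rho>" using y by auto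
          then show ?thesis by (auto simp: g_def max_def min_def)
        next
          case False
          then have "w y = 0" using w(5)[of y] \<rho> by auto
          then show ?thesis using \<rho> by (auto simp: g_def max_def min_def)
        qed
      qed
    qed
    moreover have "g \<in> Cc"
      by (rule Cc_I[of w w]) (use w cont in \<open>auto simp: A_Cc g_def\<close>)
    ultimately show ?thesis by (simp add: A_def)
  qed
  let ?h = "\<lambda>y. inverse \<rho> * g y"
  have hA: "?h \<in> A" using gA by (rule A.mems)
  define u where "u y = w y - ?h y" for y
  have uA: "u \<in> A" unfolding u_def using w(1) hA by (rule A.mems)
  have g2: "g y = dist x y" if "dist x y < 2 * \<rho>" for y
    using w(4)[of y] that \<rho> by (simp add: g_def)
  have tu: "tent x \<rho> = (\<lambda>y. max 0 (u y))"
  proof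
    fix y
    show "tent x \<rho> y = max 0 (u y)"
    proof (cases "dist x y < 2 * \<rho>")
      case True
      then show ?thesis using g2[OF True] w(4)[of y] \<rho> by (simp add: tent_def u_def field_simps)
    next
      case False
      then have "1 - dist x y / \<rho> \<le> 0" using \<rho> by (simp add: field_simps)
      moreover have "u y \<le> 0"
      proof -
        have "\<rho> * w y \<le> dist x y" using w(3)[of y] False \<rho> by (smt (verit) mult_left_le)
        moreover have "\<rho> * w y \<le> 4 * \<rho> * w y" using w(2)[of y] \<rho> by simp
        ultimately have "\<rho> * w y \<le> g y" by (simp add: g_def)
        then show ?thesis using \<rho> by (simp add: u_def field_simps)
      qed
      ultimately show ?thesis by (simp add: tent_def)
    qed
  qed
  show TA: "tent x \<rho> \<in> A" unfolding tu by (rule A_pos(1)[OF uA])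
  assume f: "f \<in> A"
  let ?T = "tent x \<rho>"
  have T0: "?T y = 0" if "\<rho> \<le> dist x y" for y using that \<rho> by (simp add: tent_def field_simps)
  \<comment> \<open>Split f^2 into a = f^2 \<zeta> and b = f^2 (1 - \<zeta>). The tent vanishes
    where b > 0, so b does not see its energy, and a lives in the ball where g is the
    distance.\<close>
  obtain \<zeta> where \<zeta>: "\<zeta> \<in> A" "\<And>y. 0 \<le> \<zeta> y" "\<And>y. \<zeta> y \<le> 1" "\<And>y. dist x y \<le> \<rho> \<Longrightarrow> \<zeta> y = 1"
    "\<And>y. 2 * \<rho> \<le> dist x y \<Longrightarrow> \<zeta> y = 0" using cutoff_function[of \<rho> "2 * \<rho>" x] \<rho> by auto
  let ?ff = "\<lambda>y. f y * f y"
  define a where "a y = ?ff y * \<zeta> y" for y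
  define b where "b y = ?ff y - a y" for y
  have ffA: "?ff \<in> A" using f by (intro A_mult)
  have aA: "a \<in> A" unfolding a_def using ffA \<zeta>(1) by (rule A_mult)
  have bA: "b \<in> A" unfolding b_def using ffA aA by (rule A.mems)
  have a0: "0 \<le> a y" for y using \<zeta>(2)[of y] by (simp add: a_def)
  have b0: "0 \<le> b y" for y using mult_left_le[of "\<zeta> y" "?ff y"] \<zeta>(3)[of y] by (simp add: b_def a_def)
  have TTA: "(\<lambda>y. ?T y * ?T y) \<in> A" using TA by (intro A_mult)
  have int: "integrable (\<Gamma> ?T) k" if "k \<in> A" for k
    using Cc_bounded[OF A_Cc[OF that]] energy_integrable[OF A_F[OF TA] A_borel[OF that]] by metis
  have "(\<integral>y. b y \<partial>\<Gamma> ?T) = 0"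
  proof -
    have bT: "b y = 0" if "?T y \<noteq> 0" for y
    proof -
      have "dist x y < \<rho>" using that T0[of y] by linarith
      then show ?thesis using \<zeta>(4)[of y] by (simp add: b_def a_def)
    qed
    have T: "?T y = 0" if "0 < b y" for y using bT[of y] that by fastforce
    have "E (\<lambda>y. ?T y * ?T y) b = 0"
      by (rule orthogonal(1)[OF TTA bA b0, of 0]) (use T in simp)
    moreover have "(\<lambda>y. b y * ?T y) = (\<lambda>y. 0)" using bT by fastforce
    ultimately show ?thesis
      using weighted_form_diag[OF bA TA] A.zero_right[OF TA] by (simp add: weighted_form_def)
  qed
  moreover have "?ff = (\<lambda>y. a y + b y)" by (simp add: b_def)
  ultimately have 1: "(\<integral>y. ?ff y \<partial>\<Gamma> ?T) = (\<integral>y. a y \<partial>\<Gamma> ?T)"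
    using int[OF aA] int[OF bA] by (simp add: Bochner_Integration.integral_add)
  interpret W: nonneg_form A "weighted_form a" by (rule weighted_form_nonneg[OF aA a0])
  \<comment> \<open>The positive and negative parts of u have vanishing mixed energy against a, so
    the weighted energy of the tent is at most that of u.\<close>
  let ?n = "\<lambda>y. max 0 (- 1 * u y)"
  have nA: "?n \<in> A" by (rule A_pos(1)[OF A.cmult_mem[OF uA]])
  have "weighted_form a ?T ?n = 0"
  proof -
    have z: "(\<lambda>y. ?T y * ?n y) = (\<lambda>y. 0)" unfolding tu by (auto simp: max_def)
    have anA: "(\<lambda>y. a y * ?n y) \<in> A" "(\<lambda>y. a y * ?T y) \<in> A" using aA nA TA by (auto intro: A_mult)
    have Tn: "?n y = 0 \<or> ?T y = 0" for y unfolding tu by (auto simp: max_def)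
    have an0: "0 \<le> a y * ?n y" "0 \<le> a y * ?T y" for y using a0[of y] by (auto simp: tu)
    have "E ?T (\<lambda>y. a y * ?n y) = 0"
      by (rule orthogonal(1)[OF TA anA(1) an0(1), of 0]) (metis Tn less_irrefl mult_zero_right)
    moreover have "E ?n (\<lambda>y. a y * ?T y) = 0"
      by (rule orthogonal(1)[OF nA anA(2) an0(2), of 0]) (metis Tn less_irrefl mult_zero_right)
    ultimately show ?thesis unfolding weighted_form_def z using A.zero_left[OF aA] by simp
  qed
  moreover have "u = (\<lambda>y. ?T y - ?n y)" unfolding tu by (auto simp: max_def)
  ultimately have "weighted_form a u u = weighted_form a ?T ?T + weighted_form a ?n ?n"
    using W.parallelogram[OF TA nA] TA nA W.sym[OF TA nA] by (simp add: W.lins W.mems)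
  then have 2: "weighted_form a ?T ?T \<le> weighted_form a u u" using W.nonneg[OF nA] by simp
  have aw: "w y = 1" if "0 < a y" for y
    using that \<zeta>(5)[of y] w(4)[of y] by (force simp: a_def)
  have "weighted_form a w w = 0"
  proof -
    have "(\<lambda>y. a y * w y) = a"
    proof
      show "a y * w y = a y" for y using aw[of y] a0[of y] by (cases "a y = 0") auto
    qed
    moreover have "E w a = 0" by (rule orthogonal(1)[OF w(1) aA a0 aw])
    moreover have "E (\<lambda>y. w y * w y) a = 0"
      by (rule orthogonal(1)[OF A_mult[OF w(1) w(1)] aA a0, of 1]) (use aw in simp)
    ultimately show ?thesis by (simp add: weighted_form_def)
  qed
  \<comment> \<open>w is 1 where a > 0 and has no energy there; the parallelogram law then bounds
    the energy of u by twice that of g / \<rho>, the source of the 2 in the constant.\<close>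
  then have "weighted_form a u u + weighted_form a (\<lambda>y. w y + ?h y) (\<lambda>y. w y + ?h y) = 2 * weighted_form a ?h ?h"
    using W.parallelogram[OF w(1) hA] unfolding u_def by simp
  moreover have "0 \<le> weighted_form a (\<lambda>y. w y + ?h y) (\<lambda>y. w y + ?h y)"
    by (rule W.nonneg, rule A.mems(2)[OF w(1) hA])
  moreover have "weighted_form a ?h ?h = (inverse \<rho>)\<^sup>2 * weighted_form a g g" by (rule W.cmult_both[OF gA])
  ultimately have 3: "weighted_form a u u \<le> 2 * (inverse \<rho>)\<^sup>2 * weighted_form a g g" by simp
  have "weighted_form a g g = (\<integral>y. a y \<partial>\<Gamma> g)" by (rule weighted_form_diag[OF aA gA])
  also have "\<dots> \<le> (\<integral>y. a y \<partial>\<mu>)"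
    by (rule local_energy_le[OF A_F[OF gA] _ aA a0, of x "2 * \<rho>"]) (use g2 \<zeta>(5) in \<open>auto simp: a_def not_less\<close>)
  also have "\<dots> \<le> (\<integral>y. indicator (ball x (2 * \<rho>)) y * ?ff y \<partial>\<mu>)"
  proof (rule integral_mono_AE')
    show "integrable \<mu> (\<lambda>y. indicator (ball x (2 * \<rho>)) y * ?ff y)"
      using integrable_mult_indicator[OF _ L2_integrable_mult[OF F_L2[OF A_F[OF f]] F_L2[OF A_F[OF f]]], of "ball x (2 * \<rho>)"] sets_mu
      by simp
    have "a y \<le> indicator (ball x (2 * \<rho>)) y * ?ff y" for y
      using \<zeta>(5)[of y] b0[of y] by (auto simp: a_def b_def indicator_def not_less)
    then show "AE y in \<mu>. a y \<le> indicator (ball x (2 * \<rho>)) y * ?ff y" by simp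
    show "AE y in \<mu>. 0 \<le> indicator (ball x (2 * \<rho>)) y * ?ff y" by simp
  qed
  finally have 4: "weighted_form a g g \<le> (\<integral>y. indicator (ball x (2 * \<rho>)) y * ?ff y \<partial>\<mu>)" .
  have "(\<integral>y. ?ff y \<partial>\<Gamma> ?T) \<le> 2 * (inverse \<rho>)\<^sup>2 * weighted_form a g g"
    unfolding 1 weighted_form_diag[OF aA TA, symmetric] using 2 3 by linarith
  also have "\<dots> \<le> 2 * (inverse \<rho>)\<^sup>2 * (\<integral>y. indicator (ball x (2 * \<rho>)) y * ?ff y \<partial>\<mu>)"
    using 4 by (intro mult_left_mono) auto
  finally show "(\<integral>y. ?ff y \<partial>\<Gamma> ?T) \<le> 2 / \<rho>\<^sup>2 * (\<integral>y. indicator (ball x (2 * \<rho>)) y * ?ff y \<partial>\<mu>)"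
    by (simp add: power_inverse divide_inverse)
qed

end


section \<open>The inequalities\<close>

text \<open>Summation over the cover and Fatou's lemma act on integrals, not on squared
  norms.\<close>

lemma lp_norm_sq_le_iff:
  assumes "0 < q" "0 \<le> B"
  shows "(lp_norm \<mu> q f)\<^sup>2 \<le> ennreal B \<longleftrightarrow> (\<integral>\<^sup>+x. ennreal (\<bar>f x\<bar> powr q) \<partial>\<mu>) \<le> ennreal (B powr (q / 2))"
proof (cases "\<integral>\<^sup>+x. ennreal (\<bar>f x\<bar> powr q) \<partial>\<mu>")
  case top
  then have "lp_norm \<mu> q f = \<infinity>" by (simp add: lp_norm_def)
  then show ?thesis using top by (simp add: ennreal_top_eq_mult_iff power2_eq_square top_unique)
next
  case (real c)
  have sq: "(c powr (1 / q))\<^sup>2 = c powr (2 / q)"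
    using powr_add[of c "1/q" "1/q"] by (simp add: power2_eq_square)
  have "(lp_norm \<mu> q f)\<^sup>2 = ennreal (c powr (2 / q))"
    unfolding lp_norm_def Let_def real using real by (simp add: ennreal_power sq)
  then have "(lp_norm \<mu> q f)\<^sup>2 \<le> ennreal B \<longleftrightarrow> c powr (2 / q) \<le> B"
    using assms by simp
  also have "\<dots> \<longleftrightarrow> c \<le> B powr (q / 2)"
  proof
    assume "c powr (2 / q) \<le> B"
    then have "(c powr (2 / q)) powr (q / 2) \<le> B powr (q / 2)" using assms by (intro powr_mono2) auto
    then show "c \<le> B powr (q / 2)" using assms real by (simp add: powr_powr)
  next
    assume "c \<le> B powr (q / 2)"
    then have "c powr (2 / q) \<le> (B powr (q / 2)) powr (2 / q)" using assms real by (intro powr_mono2) auto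
    then show "c powr (2 / q) \<le> B" using assms by (simp add: powr_powr)
  qed
  also have "\<dots> \<longleftrightarrow> ennreal c \<le> ennreal (B powr (q / 2))" by simp
  finally show ?thesis using real by simp
qed

text \<open>The complement of the support is a possibly uncountable union of open sets on which f
  vanishes almost everywhere; by Lindelof a countable subfamily has the same union.\<close>

lemma AE_ess_supp:
  fixes \<mu> :: "'a::second_countable_topology measure"
  shows "AE x in \<mu>. x \<notin> ess_supp \<mu> f \<longrightarrow> f x = 0"
proof -
  let ?\<U> = "{U. open U \<and> (AE x in \<mu>. x \<in> U \<longrightarrow> f x = 0)}"
  obtain \<V> where \<V>: "\<V> \<subseteq> ?\<U>" "countable \<V>" "\<Union>\<V> = \<Union>?\<U>" using Lindelof[of ?\<U>] by blast
  have "AE x in \<mu>. \<forall>U\<in>\<V>. x \<in> U \<longrightarrow> f x = 0"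
    by (rule AE_ball_countable[THEN iffD2, OF \<V>(2)]) (use \<V>(1) in blast)
  then show ?thesis
  proof eventually_elim
    fix x assume "\<forall>U\<in>\<V>. x \<in> U \<longrightarrow> f x = 0"
    then show "x \<notin> ess_supp \<mu> f \<longrightarrow> f x = 0" using \<V>(3) unfolding ess_supp_def by blast
  qed
qed

text \<open>Comparison of the l^p and l^1 norms, from e^p \<le> e * (sum)^(p - 1). With p = q/2 it
  adds up the local bounds.\<close>

lemma sum_powr_le:
  fixes e :: "'b \<Rightarrow> real"
  assumes "finite S" "\<And>x. x \<in> S \<Longrightarrow> 0 \<le> e x" "1 \<le> p"
  shows "(\<Sum>x\<in>S. e x powr p) \<le> (\<Sum>x\<in>S. e x) powr p"
proof (cases "(\<Sum>x\<in>S. e x) = 0")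
  case True
  then have "e x = 0" if "x \<in> S" for x using that assms(1,2) by (simp add: sum_nonneg_eq_0_iff)
  then show ?thesis by simp
next
  case False
  let ?s = "\<Sum>x\<in>S. e x"
  have s: "0 < ?s" using False sum_nonneg[of S e] assms(2) by fastforce
  have "e x powr p \<le> e x * ?s powr (p - 1)" if x: "x \<in> S" for x
  proof (cases "e x = 0")
    case False
    then have "0 < e x" using assms(2)[OF x] by simp
    then have "e x powr p = e x * e x powr (p - 1)" by (simp add: powr_mult_base)
    also have "\<dots> \<le> e x * ?s powr (p - 1)"
      using member_le_sum[OF x _ assms(1), of e] assms \<open>0 < e x\<close> by (intro mult_left_mono powr_mono2) auto
    finally show ?thesis .
  qed simp
  then have "(\<Sum>x\<in>S. e x powr p) \<le> (\<Sum>x\<in>S. e x * ?s powr (p - 1))" by (rule sum_mono)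
  also have "\<dots> = ?s * ?s powr (p - 1)" by (simp add: sum_distrib_right)
  also have "\<dots> = ?s powr p" using s by (simp add: powr_mult_base)
  finally show ?thesis .
qed

lemma (in nonneg_form) tendsto_energy:
  assumes "f \<in> V" "\<And>n. g n \<in> V" and lim: "(\<lambda>n. B (\<lambda>x. f x - g n x) (\<lambda>x. f x - g n x)) \<longlonglongrightarrow> 0"
  shows "(\<lambda>n. B (g n) (g n)) \<longlonglongrightarrow> B f f"
proof -
  have d: "(\<lambda>x. f x - g n x) \<in> V" for n using assms by (intro mems)
  have b: "\<bar>sqrt (B (g n) (g n)) - sqrt (B f f)\<bar> \<le> sqrt (B (\<lambda>x. f x - g n x) (\<lambda>x. f x - g n x))" for n
  proof -
    have "sqrt (B f f) \<le> sqrt (B (\<lambda>x. f x - g n x) (\<lambda>x. f x - g n x)) + sqrt (B (g n) (g n))"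
      using sqrt_add_le[OF d[of n] assms(2)[of n]] by simp
    moreover have "sqrt (B (g n) (g n)) \<le> sqrt (B f f) + sqrt (B (\<lambda>x. f x - g n x) (\<lambda>x. f x - g n x))"
      using sqrt_diff_le[OF assms(1) d[of n]] by simp
    ultimately show ?thesis by linarith
  qed
  have "(\<lambda>n. sqrt (B (\<lambda>x. f x - g n x) (\<lambda>x. f x - g n x))) \<longlonglongrightarrow> 0"
    using tendsto_real_sqrt[OF lim] by simp
  then have "(\<lambda>n. sqrt (B (g n) (g n)) - sqrt (B f f)) \<longlonglongrightarrow> 0"
    by (rule Lim_null_comparison[rotated]) (use b in auto)
  then have "(\<lambda>n. sqrt (B (g n) (g n))) \<longlonglongrightarrow> sqrt (B f f)" by (simp add: LIM_zero_iff)
  from tendsto_power[OF this, of 2] show ?thesis using nonneg assms(1,2) by simp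
qed

section \<open>The weight v and the three implications\<close>

locale doubling_energy_space = energy_space + doubling_measure \<mu> D for D +
  fixes v :: "'a \<Rightarrow> real \<Rightarrow> real" and c q :: real
  assumes v_nonneg: "\<And>x r. 0 < r \<Longrightarrow> 0 \<le> v x r"
    and v_measurable: "\<And>r. 0 < r \<Longrightarrow> (\<lambda>x. v x r) \<in> borel_measurable \<mu>"
    and v_AE_pos: "\<And>r. 0 < r \<Longrightarrow> AE x in \<mu>. 0 < v x r"
    and c_pos: "0 < c"
    and v_doubling: "\<And>x y r. 0 < r \<Longrightarrow> dist x y \<le> r \<Longrightarrow> v y r \<le> c * v x r"
    and q: "2 < q"
begin

text \<open>A zero of v at x spreads by \<open>v_doubling\<close> over the ball B(x, r), which has
  positive measure, against positivity almost everywhere. Quotients by powers of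
  \<open>v x r\<close> thus stay real.\<close>

lemma v_pos:
  assumes r: "0 < r"
  shows "0 < v x r"
proof (rule ccontr)
  assume "\<not> 0 < v x r"
  then have x: "v x r = 0" using v_nonneg[OF r, of x] by simp
  have z: "v y r = 0" if "y \<in> ball x r" for y
    using v_doubling[OF r, of x y] v_nonneg[OF r, of y] that x by auto
  have "AE y in \<mu>. y \<notin> ball x r"
    using v_AE_pos[OF r] by eventually_elim (use z in fastforce)
  moreover have "{y \<in> space \<mu>. \<not> y \<notin> ball x r} = ball x r"
    using sets_eq_imp_space_eq[OF sets_mu] by auto
  ultimately have "emeasure \<mu> (ball x r) = 0"
    using AE_iff_measurable[OF ball_sets[of x r], of "\<lambda>y. y \<notin> ball x r"] by blast
  then show False using ball_finite_pos[OF r, of x] by simp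
qed

definition scaled_energy :: "real \<Rightarrow> ('a \<Rightarrow> real) \<Rightarrow> real" where
  "scaled_energy r f = l2_inner \<mu> f f + r\<^sup>2 * E f f"

text \<open>The q-th power of the norm on the left of \<open>GN\<close>; as an integral it is
  additive over positive and negative parts.\<close>

definition weighted_mass :: "real \<Rightarrow> ('a \<Rightarrow> real) \<Rightarrow> ennreal" where
  "weighted_mass r f = (\<integral>\<^sup>+x. ennreal (\<bar>f x * v x r powr (1/2 - 1/q)\<bar> powr q) \<partial>\<mu>)"

lemma scaled_energy_nonneg: "f \<in> F \<Longrightarrow> 0 \<le> scaled_energy r f"
  unfolding scaled_energy_def by (intro add_nonneg_nonneg mult_nonneg_nonneg L2.nonneg F_L2 nonneg) auto

lemma weight_powr:
  assumes "0 < r"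
  shows "\<bar>t * v x r powr (1/2 - 1/q)\<bar> powr q = \<bar>t\<bar> powr q * v x r powr (q / 2 - 1)"
proof -
  have "\<bar>t * v x r powr (1/2 - 1/q)\<bar> = \<bar>t\<bar> * v x r powr (1/2 - 1/q)" by (simp add: abs_mult)
  moreover have "(1/2 - 1/q) * q = q / 2 - 1" using q by (simp add: field_simps)
  ultimately show ?thesis by (simp add: powr_mult powr_powr)
qed

lemma GN_iff:
  "GN \<mu> F E v q \<longleftrightarrow> (\<exists>C>0. \<forall>r>0. \<forall>f\<in>F. weighted_mass r f \<le> ennreal ((C * scaled_energy r f) powr (q / 2)))"
  unfolding GN_def weighted_mass_def scaled_energy_def[symmetric]
  by (intro ex_cong1 conj_cong refl ball_cong imp_cong all_cong1 lp_norm_sq_le_iff)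
     (use q scaled_energy_nonneg in auto)

text \<open>On the support the weight is at least its infimum, and outside it f vanishes almost
  everywhere.\<close>

lemma GN_imp_KGN:
  assumes "GN \<mu> F E v q"
  shows "KGN \<mu> F E v q"
proof -
  obtain C where C: "0 < C" "\<And>r f. 0 < r \<Longrightarrow> f \<in> F \<Longrightarrow> weighted_mass r f \<le> ennreal ((C * scaled_energy r f) powr (q / 2))"
    using assms unfolding GN_iff by blast
  have "(INF z\<in>ess_supp \<mu> f. ennreal (v z r powr (1 - 2/q))) * (lp_norm \<mu> q f)\<^sup>2
       \<le> ennreal (C * scaled_energy r f)" if r: "0 < r" and f: "f \<in> F" for r f
  \<comment> \<open>Over an empty support the infimum is infinite, and the norm is 0. Otherwise the
    infimum is a real number t, and the case t = 0 is split off because t becomes a divisor.\<close>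
  proof (cases "ess_supp \<mu> f = {}")
    case True
    then have "AE x in \<mu>. f x = 0" using AE_ess_supp[of \<mu> f] by simp
    then have "AE x in \<mu>. ennreal (\<bar>f x\<bar> powr q) = 0" by eventually_elim simp
    then have "(\<integral>\<^sup>+x. ennreal (\<bar>f x\<bar> powr q) \<partial>\<mu>) = 0"
      using nn_integral_cong_AE[of "\<lambda>x. ennreal (\<bar>f x\<bar> powr q)" "\<lambda>_. 0" \<mu>] by simp
    then have "lp_norm \<mu> q f = 0" by (simp add: lp_norm_def)
    then show ?thesis by simp
  next
    case False
    define m where "m = (INF z\<in>ess_supp \<mu> f. ennreal (v z r powr (1 - 2/q)))"
    have m_le: "m \<le> ennreal (v z r powr (1 - 2/q))" if "z \<in> ess_supp \<mu> f" for z
      unfolding m_def using that by (rule INF_lower)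
    obtain z where "z \<in> ess_supp \<mu> f" using False by blast
    from m_le[OF this] obtain t where t: "0 \<le> t" "m = ennreal t" by (cases m) (auto simp: top_unique)
    show ?thesis
    proof (cases "t = 0")
      case True
      then show ?thesis using t by (simp add: m_def)
    next
      case False
      then have t0: "0 < t" using t by simp
      have fm: "f \<in> borel_measurable \<mu>" using F_L2[OF f] by (simp add: L2_def)
      let ?B = "C * scaled_energy r f"
      have B: "0 \<le> ?B" using C scaled_energy_nonneg[OF f] by simp
      have "ennreal (t powr (q / 2)) * (\<integral>\<^sup>+x. ennreal (\<bar>f x\<bar> powr q) \<partial>\<mu>)
          = (\<integral>\<^sup>+x. ennreal (t powr (q / 2)) * ennreal (\<bar>f x\<bar> powr q) \<partial>\<mu>)"
        using fm by (intro nn_integral_cmult[symmetric]) measurable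
      also have "\<dots> \<le> weighted_mass r f"
        unfolding weighted_mass_def
      proof (rule nn_integral_mono_AE)
        show "AE x in \<mu>. ennreal (t powr (q / 2)) * ennreal (\<bar>f x\<bar> powr q)
            \<le> ennreal (\<bar>f x * v x r powr (1/2 - 1/q)\<bar> powr q)"
          using AE_ess_supp[of \<mu> f]
        proof eventually_elim
          fix x assume x: "x \<notin> ess_supp \<mu> f \<longrightarrow> f x = 0"
          show "ennreal (t powr (q / 2)) * ennreal (\<bar>f x\<bar> powr q)
            \<le> ennreal (\<bar>f x * v x r powr (1/2 - 1/q)\<bar> powr q)"
          proof (cases "x \<in> ess_supp \<mu> f")
            case True
            then have "t \<le> v x r powr (1 - 2/q)" using m_le[OF True] t by simp
            then have "t powr (q / 2) \<le> (v x r powr (1 - 2/q)) powr (q / 2)"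
              using t q by (intro powr_mono2) auto
            also have "\<dots> = v x r powr (q / 2 - 1)"
            proof -
              have "(1 - 2/q) * (q / 2) = q / 2 - 1" using q by (simp add: field_simps)
              then show ?thesis by (simp only: powr_powr)
            qed
            finally show ?thesis unfolding weight_powr[OF r]
              by (simp add: ennreal_mult[symmetric] mult.commute mult_left_mono)
          qed (use x in simp)
        qed
      qed
      also have "\<dots> \<le> ennreal (?B powr (q / 2))" by (rule C(2)[OF r f])
      finally have 1: "ennreal (t powr (q / 2)) * (\<integral>\<^sup>+x. ennreal (\<bar>f x\<bar> powr q) \<partial>\<mu>) \<le> ennreal (?B powr (q / 2))" .
      have "(\<integral>\<^sup>+x. ennreal (\<bar>f x\<bar> powr q) \<partial>\<mu>) \<le> ennreal ((?B / t) powr (q / 2))"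
      proof (cases "\<integral>\<^sup>+x. ennreal (\<bar>f x\<bar> powr q) \<partial>\<mu>")
        case top
        then show ?thesis using 1 t0 by (simp add: ennreal_mult_top top_unique)
      next
        case (real i)
        then show ?thesis using 1 t0 B
          by (simp add: ennreal_mult[symmetric] powr_divide field_simps)
      qed
      then have "(lp_norm \<mu> q f)\<^sup>2 \<le> ennreal (?B / t)"
        using lp_norm_sq_le_iff[of q "?B / t" \<mu> f] q B t0 by simp
      then have "m * (lp_norm \<mu> q f)\<^sup>2 \<le> ennreal t * ennreal (?B / t)"
        unfolding t(2) by (rule mult_left_mono) simp
      also have "\<dots> = ennreal ?B" using t0 B by (simp add: ennreal_mult[symmetric])
      finally show ?thesis by (simp add: m_def)
    qed
  qed
  then show ?thesis unfolding KGN_def scaled_energy_def[symmetric] using C(1) by blast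
qed

lemma LS_bound_eq:
  assumes "0 < r" "0 < C" "0 \<le> s"
  shows "ennreal C / ennreal (v x r powr (1 - 2/q)) * ennreal s = ennreal (C / v x r powr (1 - 2/q) * s)"
  using assms v_pos[OF assms(1), of x] by (simp add: divide_ennreal ennreal_mult[symmetric])

text \<open>For z in B(x, r) doubling of v gives v z r \<ge> v x r / c, which bounds the infimum
  from below and costs the factor c^(1 - 2/q).\<close>

lemma KGN_imp_LS:
  assumes "KGN \<mu> F E v q"
  shows "LS \<mu> F E v q"
proof -
  let ?\<theta> = "1 - 2/q"
  have \<theta>: "0 < ?\<theta>" using q by simp
  obtain C where C: "0 < C" "\<And>r f. 0 < r \<Longrightarrow> f \<in> F \<Longrightarrow> (INF z\<in>ess_supp \<mu> f. ennreal (v z r powr ?\<theta>)) * (lp_norm \<mu> q f)\<^sup>2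
       \<le> ennreal (C * scaled_energy r f)"
    using assms unfolding KGN_def scaled_energy_def[symmetric] by blast
  let ?C = "C * c powr ?\<theta>"
  have "(lp_norm \<mu> q f)\<^sup>2 \<le> ennreal ?C / ennreal (v x r powr ?\<theta>) * ennreal (scaled_energy r f)"
    if r: "0 < r" and f: "f \<in> F_c \<mu> F (ball x r)" for x r f
  proof -
    have fF: "f \<in> F" and sub: "ess_supp \<mu> f \<subseteq> ball x r" using f by (auto simp: F_c_def)
    let ?t = "(v x r / c) powr ?\<theta>"
    have vx: "0 < v x r" by (rule v_pos[OF r])
    have t: "0 < ?t" using vx c_pos by simp
    have "ennreal ?t \<le> (INF z\<in>ess_supp \<mu> f. ennreal (v z r powr ?\<theta>))"
    proof (rule INF_greatest)
      fix z assume "z \<in> ess_supp \<mu> f"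
      then have "dist z x \<le> r" using sub by (auto simp: dist_commute)
      then have "v x r / c \<le> v z r" using v_doubling[OF r, of z x] c_pos by (simp add: field_simps)
      then show "ennreal ?t \<le> ennreal (v z r powr ?\<theta>)"
        using v_pos[OF r, of x] c_pos \<theta> by (intro ennreal_leI powr_mono2) auto
    qed
    then have "ennreal ?t * (lp_norm \<mu> q f)\<^sup>2 \<le> (INF z\<in>ess_supp \<mu> f. ennreal (v z r powr ?\<theta>)) * (lp_norm \<mu> q f)\<^sup>2"
      by (rule mult_right_mono) simp
    also have "\<dots> \<le> ennreal (C * scaled_energy r f)" by (rule C(2)[OF r fF])
    finally have 1: "ennreal ?t * (lp_norm \<mu> q f)\<^sup>2 \<le> ennreal (C * scaled_energy r f)" .
    have "(lp_norm \<mu> q f)\<^sup>2 = ennreal (1 / ?t) * (ennreal ?t * (lp_norm \<mu> q f)\<^sup>2)"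
      using t by (simp add: mult.assoc[symmetric] ennreal_mult[symmetric])
    also have "\<dots> \<le> ennreal (1 / ?t) * ennreal (C * scaled_energy r f)" using 1 by (rule mult_left_mono) simp
    also have "\<dots> = ennreal (1 / ?t * (C * scaled_energy r f))"
      using C(1) scaled_energy_nonneg[OF fF] by (intro ennreal_mult[symmetric]) auto
    also have "1 / ?t * (C * scaled_energy r f) = ?C / v x r powr ?\<theta> * scaled_energy r f"
      using vx c_pos by (simp add: powr_divide)
    also have "ennreal \<dots> = ennreal ?C / ennreal (v x r powr ?\<theta>) * ennreal (scaled_energy r f)"
      using LS_bound_eq[OF r _ scaled_energy_nonneg[OF fF], of ?C x] C(1) c_pos by simp
    finally show ?thesis .
  qed
  moreover have "0 < ?C" using C(1) c_pos by simp
  ultimately show ?thesis unfolding LS_def scaled_energy_def[symmetric] by blast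
qed

text \<open>\<open>energy_product\<close> is applied to f and each tent, and the sums over S are
  controlled by the overlap D^5. In 17 = 1 + 16 the 1 comes from the L2 part and 16 = r^2 * 2 * 2 /
  (r/2)^2 from the energy of the tents; the coefficient 2 of r^2 * E f f is raised to 17.\<close>

lemma localized_energy_sum:
  assumes f: "f \<in> A" "\<And>x. 0 \<le> f x" and r: "0 < r" and S: "finite S"
    and sep: "\<And>x y. x \<in> S \<Longrightarrow> y \<in> S \<Longrightarrow> x \<noteq> y \<Longrightarrow> r / 4 \<le> dist x y"
  shows "(\<Sum>x\<in>S. scaled_energy r (\<lambda>y. f y * tent x (r / 2) y)) \<le> 17 * D ^ 5 * scaled_energy r f"
proof -
  let ?\<rho> = "r / 2"
  let ?T = "\<lambda>x. tent x ?\<rho>" and ?ff = "\<lambda>y. f y * f y"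
  let ?I = "\<lambda>x. indicator (ball x r) :: 'a \<Rightarrow> real"
  have \<rho>: "0 < ?\<rho>" using r by simp
  have TA: "?T x \<in> A" for x by (rule tent(1)[OF \<rho>])
  have T0: "0 \<le> ?T x y" for x y by (simp add: tent_def)
  have TI: "?T x y * ?T x y \<le> ?I x y" for x y
  proof (cases "dist x y < r")
    case True
    have "?T x y \<le> 1" using \<rho> by (simp add: tent_def)
    then have "?T x y * ?T x y \<le> 1 * 1" using T0 by (intro mult_mono) auto
    then show ?thesis using True by simp
  next
    case False
    then have "?T x y = 0" using r by (simp add: tent_def field_simps)
    then show ?thesis by simp
  qed
  have overlap: "(\<Sum>x\<in>S. ?I x y) \<le> D ^ 5" for y
  proof -
    have "(\<Sum>x\<in>S. ?I x y) = real (card (S \<inter> {x. y \<in> ball x r}))"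
      using S by (simp add: indicator_def sum.If_cases)
    \<comment> \<open>The exponent 5 satisfies 2 r + r/4 \<le> 2^5 * (r/8), as
      \<open>packing\<close> demands.\<close>
    also have "\<dots> \<le> D ^ 5"
      by (rule packing[of _ y r "r / 4"]) (use S sep r in \<open>auto simp: dist_commute\<close>)
    finally show ?thesis .
  qed
  have fL: "f \<in> L2 \<mu>" using f by (intro F_L2 A_F)
  have ffi: "integrable \<mu> ?ff" by (rule L2_integrable_mult[OF fL fL])
  have Ii: "integrable \<mu> (\<lambda>y. ?I x y * ?ff y)" for x
    using integrable_mult_indicator[OF ball_sets ffi, of x r] by simp
  have l2: "(\<Sum>x\<in>S. \<integral>y. ?I x y * ?ff y \<partial>\<mu>) \<le> D ^ 5 * l2_inner \<mu> f f"
  proof -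
    have "(\<Sum>x\<in>S. \<integral>y. ?I x y * ?ff y \<partial>\<mu>) = (\<integral>y. (\<Sum>x\<in>S. ?I x y) * ?ff y \<partial>\<mu>)"
      unfolding sum_distrib_right using Ii by (intro Bochner_Integration.integral_sum[symmetric])
    also have "\<dots> \<le> (\<integral>y. D ^ 5 * ?ff y \<partial>\<mu>)"
    proof (rule integral_mono)
      show "integrable \<mu> (\<lambda>y. (\<Sum>x\<in>S. ?I x y) * ?ff y)"
        using Ii by (simp add: sum_distrib_right)
      show "integrable \<mu> (\<lambda>y. D ^ 5 * ?ff y)" using ffi by simp
      show "(\<Sum>x\<in>S. ?I x y) * ?ff y \<le> D ^ 5 * ?ff y" for y
        using overlap by (intro mult_right_mono) auto
    qed
    finally show ?thesis by (simp add: l2_inner_def)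
  qed
  have energy: "(\<Sum>x\<in>S. \<integral>y. ?T x y * ?T x y \<partial>\<Gamma> f) \<le> D ^ 5 * E f f"
  proof -
    have fF: "f \<in> F" by (rule A_F[OF f(1)])
    interpret finite_measure "\<Gamma> f" by (rule finite_energy[OF fF])
    have TTi: "integrable (\<Gamma> f) (\<lambda>y. ?T x y * ?T x y)" for x
    proof -
      have TT: "(\<lambda>y. ?T x y * ?T x y) \<in> A" by (rule A_mult[OF TA TA])
      obtain K where "\<And>y. \<bar>?T x y * ?T x y\<bar> \<le> K" using Cc_bounded[OF A_Cc[OF TT]] by blast
      then show ?thesis by (rule energy_integrable[OF fF A_borel[OF TT]])
    qed
    have "(\<Sum>x\<in>S. \<integral>y. ?T x y * ?T x y \<partial>\<Gamma> f) = (\<integral>y. (\<Sum>x\<in>S. ?T x y * ?T x y) \<partial>\<Gamma> f)"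
      using TTi by (intro Bochner_Integration.integral_sum[symmetric])
    also have "\<dots> \<le> (\<integral>y. D ^ 5 \<partial>\<Gamma> f)"
    proof (rule integral_mono)
      show "integrable (\<Gamma> f) (\<lambda>y. \<Sum>x\<in>S. ?T x y * ?T x y)" using TTi by simp
      show "(\<Sum>x\<in>S. ?T x y * ?T x y) \<le> D ^ 5" for y
        using sum_mono[of S "\<lambda>x. ?T x y * ?T x y" "\<lambda>x. ?I x y"] TI overlap[of y] by (meson order_trans)
    qed simp
    also have "\<dots> = D ^ 5 * E f f"
      using energy_total[OF fF] space_energy[OF fF] by simp
    finally show ?thesis .
  qed
  have "scaled_energy r (\<lambda>y. f y * ?T x y) \<le> 17 * (\<integral>y. ?I x y * ?ff y \<partial>\<mu>) + 2 * r\<^sup>2 * (\<integral>y. ?T x y * ?T x y \<partial>\<Gamma> f)" for x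
  proof -
    have fTA: "(\<lambda>y. f y * ?T x y) \<in> A" using f TA by (intro A_mult)
    have "l2_inner \<mu> (\<lambda>y. f y * ?T x y) (\<lambda>y. f y * ?T x y) \<le> (\<integral>y. ?I x y * ?ff y \<partial>\<mu>)"
      unfolding l2_inner_def
    proof (rule integral_mono)
      show "integrable \<mu> (\<lambda>y. f y * ?T x y * (f y * ?T x y))"
        using L2_integrable_mult[OF F_L2[OF A_F[OF fTA]] F_L2[OF A_F[OF fTA]]] .
      show "f y * ?T x y * (f y * ?T x y) \<le> ?I x y * ?ff y" for y
        using mult_right_mono[OF TI[of x y], of "?ff y"] by (simp add: algebra_simps)
    qed (rule Ii)
    moreover have "r\<^sup>2 * E (\<lambda>y. f y * ?T x y) (\<lambda>y. f y * ?T x y)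
      \<le> r\<^sup>2 * (2 * (\<integral>y. ?T x y * ?T x y \<partial>\<Gamma> f) + 2 * (2 / ?\<rho>\<^sup>2 * (\<integral>y. ?I x y * ?ff y \<partial>\<mu>)))"
      using energy_product[OF f TA T0, of x] tent(2)[OF \<rho> f(1), of x] by (intro mult_left_mono) auto
    moreover have "r\<^sup>2 * (2 * a + 2 * (2 / ?\<rho>\<^sup>2 * b)) = 2 * r\<^sup>2 * a + 16 * b" for a b
      using r by (simp add: field_simps power2_eq_square)
    ultimately show ?thesis unfolding scaled_energy_def by simp
  qed
  then have "(\<Sum>x\<in>S. scaled_energy r (\<lambda>y. f y * ?T x y))
    \<le> (\<Sum>x\<in>S. 17 * (\<integral>y. ?I x y * ?ff y \<partial>\<mu>) + 2 * r\<^sup>2 * (\<integral>y. ?T x y * ?T x y \<partial>\<Gamma> f))"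
    by (rule sum_mono)
  also have "\<dots> = 17 * (\<Sum>x\<in>S. \<integral>y. ?I x y * ?ff y \<partial>\<mu>) + 2 * r\<^sup>2 * (\<Sum>x\<in>S. \<integral>y. ?T x y * ?T x y \<partial>\<Gamma> f)"
    by (simp add: sum.distrib sum_distrib_left)
  also have "\<dots> \<le> 17 * (D ^ 5 * l2_inner \<mu> f f) + 2 * r\<^sup>2 * (D ^ 5 * E f f)"
    using l2 energy by (intro add_mono mult_left_mono) auto
  also have "\<dots> \<le> 17 * (D ^ 5 * l2_inner \<mu> f f) + 17 * r\<^sup>2 * (D ^ 5 * E f f)"
    using A.nonneg[OF f(1)] D_pos by (intro add_left_mono mult_right_mono) auto
  also have "\<dots> = 17 * D ^ 5 * scaled_energy r f" by (simp add: scaled_energy_def algebra_simps)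
  finally show ?thesis .
qed

text \<open>Each y with f y \<noteq> 0 is within r/4 of a centre x whose tent is at least 1/2 at y,
  and v y r \<le> c * v x r; this costs 2^q and c^(q/2 - 1). The weight at x then cancels against
  the one in \<open>LS\<close>.\<close>

lemma LS_imp_bound_nonneg:
  assumes C: "0 < C" and LS: "\<And>x f. f \<in> F_c \<mu> F (ball x r) \<Longrightarrow> 
      (lp_norm \<mu> q f)\<^sup>2 \<le> ennreal C / ennreal (v x r powr (1 - 2/q)) * ennreal (scaled_energy r f)"
    and r: "0 < r" and f: "f \<in> A" "\<And>x. 0 \<le> f x"
  shows "weighted_mass r f \<le> ennreal (c powr (q / 2 - 1) * 2 powr q * (C * (17 * D ^ 5 * scaled_energy r f)) powr (q / 2))"
proof -
  let ?\<theta> = "1 - 2/q" and ?p = "q / 2 - 1"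
  let ?\<rho> = "r / 2"
  have \<rho>: "0 < ?\<rho>" using r by simp
  let ?T = "\<lambda>x. tent x ?\<rho>"
  let ?K = "{x. f x \<noteq> 0}"
  have "bounded (closure ?K)" using A_Cc[OF f(1)] by (auto simp: Cc_def intro: compact_imp_bounded)
  then have "bounded ?K" by (rule bounded_subset) (rule closure_subset)
  then obtain z R where K: "?K \<subseteq> ball z R" by (meson bounded_subset_ballD)
  have r4: "0 < r / 4" using r by simp
  \<comment> \<open>The support is bounded, so the cover is finite and so are all sums
    below.\<close>
  from finite_net[OF K r4] obtain S where S0: "finite S" "S \<subseteq> ?K"
    "\<forall>x\<in>S. \<forall>y\<in>S. x \<noteq> y \<longrightarrow> r / 4 \<le> dist x y" "?K \<subseteq> (\<Union>x\<in>S. ball x (r / 4))"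
    .
  note S = S0(1) S0(3)[rule_format] S0(4)
  define e where "e x = scaled_energy r (\<lambda>y. f y * ?T x y)" for x
  have TA: "?T x \<in> A" for x by (rule tent(1)[OF \<rho>])
  have T0: "0 \<le> ?T x y" for x y by (simp add: tent_def)
  have fTA: "(\<lambda>y. f y * ?T x y) \<in> A" for x using f TA by (intro A_mult)
  have e0: "0 \<le> e x" for x unfolding e_def by (rule scaled_energy_nonneg[OF A_F[OF fTA]])
  define w where "w x = (c * v x r) powr ?p * 2 powr q" for x
  have w0: "0 \<le> w x" for x by (simp add: w_def)
  have piece: "(\<integral>\<^sup>+y. ennreal (\<bar>f y * ?T x y\<bar> powr q) \<partial>\<mu>) \<le> ennreal ((C / v x r powr ?\<theta> * e x) powr (q / 2))" for x
  proof -
    \<comment> \<open>The tent radius r/2 keeps the closed support inside the open ball B(x, r), as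
      \<open>F_c\<close> requires.\<close>
    have sub: "ess_supp \<mu> (\<lambda>y. f y * ?T x y) \<subseteq> cball x ?\<rho>"
      by (rule ess_supp_subset) (use r in \<open>auto simp: tent_def field_simps\<close>)
    have "(\<lambda>y. f y * ?T x y) \<in> F_c \<mu> F (ball x r)"
      unfolding F_c_def using Cc_compact_ess_supp[OF A_Cc[OF fTA]] A_F[OF fTA] sub r by fastforce
    from LS[OF this] have "(lp_norm \<mu> q (\<lambda>y. f y * ?T x y))\<^sup>2 \<le> ennreal (C / v x r powr ?\<theta> * e x)"
      unfolding LS_bound_eq[OF r C e0[of x, unfolded e_def]] e_def .
    then show ?thesis using q C e0[of x] by (subst (asm) lp_norm_sq_le_iff) auto
  qed
  have m: "(\<lambda>y. ennreal (\<bar>f y * ?T x y\<bar> powr q)) \<in> borel_measurable \<mu>" for x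
    using Cc_measurable[OF A_Cc[OF fTA[of x]]] by measurable
  have "weighted_mass r f \<le> (\<integral>\<^sup>+y. (\<Sum>x\<in>S. ennreal (w x) * ennreal (\<bar>f y * ?T x y\<bar> powr q)) \<partial>\<mu>)"
    unfolding weighted_mass_def
  proof (rule nn_integral_mono)
    fix y
    show "ennreal (\<bar>f y * v y r powr (1/2 - 1/q)\<bar> powr q) \<le> (\<Sum>x\<in>S. ennreal (w x) * ennreal (\<bar>f y * ?T x y\<bar> powr q))"
    proof (cases "f y = 0")
      case False
      then obtain x where x: "x \<in> S" "dist x y < r / 4" using S(3) by auto
      have "1 / 2 \<le> ?T x y" using x r by (simp add: tent_def field_simps)
      then have "f y * (1 / 2) \<le> f y * ?T x y" using f(2) by (intro mult_left_mono) auto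
      then have fy: "f y \<le> 2 * (f y * ?T x y)" by simp
      have vy: "v y r \<le> c * v x r" using v_doubling[OF r, of x y] x r by simp
      have "\<bar>f y\<bar> powr q * v y r powr ?p \<le> (2 * \<bar>f y * ?T x y\<bar>) powr q * (c * v x r) powr ?p"
        using fy vy f(2)[of y] T0[of x y] q v_pos[OF r, of y] by (intro mult_mono powr_mono2) auto
      also have "\<dots> = w x * \<bar>f y * ?T x y\<bar> powr q" by (simp add: w_def powr_mult)
      finally have "ennreal (\<bar>f y * v y r powr (1/2 - 1/q)\<bar> powr q) \<le> ennreal (w x) * ennreal (\<bar>f y * ?T x y\<bar> powr q)"
        unfolding weight_powr[OF r] using w0 by (simp add: ennreal_mult[symmetric] ennreal_leI)
      also have "\<dots> \<le> (\<Sum>x\<in>S. ennreal (w x) * ennreal (\<bar>f y * ?T x y\<bar> powr q))"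
        by (rule member_le_sum[OF x(1) _ S(1)]) simp
      finally show ?thesis .
    qed simp
  qed
  also have "\<dots> = (\<Sum>x\<in>S. ennreal (w x) * (\<integral>\<^sup>+y. ennreal (\<bar>f y * ?T x y\<bar> powr q) \<partial>\<mu>))"
    using m by (simp add: nn_integral_sum nn_integral_cmult)
  also have "\<dots> \<le> (\<Sum>x\<in>S. ennreal (c powr ?p * 2 powr q * C powr (q / 2) * e x powr (q / 2)))"
  proof (rule sum_mono)
    fix x
    have "ennreal (w x) * (\<integral>\<^sup>+y. ennreal (\<bar>f y * ?T x y\<bar> powr q) \<partial>\<mu>)
        \<le> ennreal (w x) * ennreal ((C / v x r powr ?\<theta> * e x) powr (q / 2))"
      using piece by (rule mult_left_mono) simp
    also have "\<dots> = ennreal (w x * (C / v x r powr ?\<theta> * e x) powr (q / 2))"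
      using w0 by (simp add: ennreal_mult[symmetric])
    \<comment> \<open>(1 - 2/q) * (q/2) = q/2 - 1, so the powers of \<open>v x r\<close> cancel and
      a constant independent of x remains.\<close>
    also have "w x * (C / v x r powr ?\<theta> * e x) powr (q / 2) = c powr ?p * 2 powr q * C powr (q / 2) * e x powr (q / 2)"
    proof -
      have vx: "0 < v x r" by (rule v_pos[OF r])
      have "(v x r powr ?\<theta>) powr (q / 2) = v x r powr ?p"
      proof -
        have "?\<theta> * (q / 2) = ?p" using q by (simp add: field_simps)
        then show ?thesis by (simp only: powr_powr)
      qed
      then have "(C / v x r powr ?\<theta> * e x) powr (q / 2) = C powr (q / 2) / v x r powr ?p * e x powr (q / 2)"
        by (simp add: powr_mult powr_divide)
      moreover have "w x = c powr ?p * v x r powr ?p * 2 powr q" by (simp add: w_def powr_mult)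
      ultimately show ?thesis using vx by simp
    qed
    finally show "ennreal (w x) * (\<integral>\<^sup>+y. ennreal (\<bar>f y * ?T x y\<bar> powr q) \<partial>\<mu>)
      \<le> ennreal (c powr ?p * 2 powr q * C powr (q / 2) * e x powr (q / 2))" .
  qed
  also have "\<dots> = ennreal (c powr ?p * 2 powr q * C powr (q / 2) * (\<Sum>x\<in>S. e x powr (q / 2)))"
    by (simp add: sum_distrib_left)
  also have "\<dots> \<le> ennreal (c powr ?p * 2 powr q * (C * (17 * D ^ 5 * scaled_energy r f)) powr (q / 2))"
  proof (rule ennreal_leI)
    have "(\<Sum>x\<in>S. e x powr (q / 2)) \<le> (\<Sum>x\<in>S. e x) powr (q / 2)"
      by (rule sum_powr_le) (use S e0 q in auto)
    also have "\<dots> \<le> (17 * D ^ 5 * scaled_energy r f) powr (q / 2)"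
    proof (rule powr_mono2)
      show "(\<Sum>x\<in>S. e x) \<le> 17 * D ^ 5 * scaled_energy r f"
        unfolding e_def by (rule localized_energy_sum[OF f r S(1,2)])
      show "0 \<le> (\<Sum>x\<in>S. e x)" using e0 by (intro sum_nonneg)
    qed (use q in simp)
    finally have "c powr ?p * 2 powr q * C powr (q / 2) * (\<Sum>x\<in>S. e x powr (q / 2))
      \<le> c powr ?p * 2 powr q * C powr (q / 2) * (17 * D ^ 5 * scaled_energy r f) powr (q / 2)"
      by (rule mult_left_mono) simp
    then show "c powr ?p * 2 powr q * C powr (q / 2) * (\<Sum>x\<in>S. e x powr (q / 2))
      \<le> c powr ?p * 2 powr q * (C * (17 * D ^ 5 * scaled_energy r f)) powr (q / 2)"
      by (simp add: powr_mult mult.assoc)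
  qed
  finally show ?thesis .
qed

text \<open>At each point one of the two parts is 0. This reduces signed functions to
  \<open>LS_imp_bound_nonneg\<close>.\<close>

lemma weighted_mass_pos_neg:
  assumes "0 < r" "f \<in> A"
  shows "weighted_mass r f = weighted_mass r (\<lambda>x. max 0 (f x)) + weighted_mass r (\<lambda>x. max 0 (- 1 * f x))"
proof -
  have m: "(\<lambda>x. ennreal (\<bar>g x * v x r powr (1/2 - 1/q)\<bar> powr q)) \<in> borel_measurable \<mu>" if "g \<in> A" for g
    using Cc_measurable[OF A_Cc[OF that]] v_measurable[OF assms(1)] by measurable
  note p = A_pos(1)[OF assms(2)] and n = A_pos(1)[OF A.cmult_mem[OF assms(2), of "- 1"]]
  show ?thesis
    unfolding weighted_mass_def nn_integral_add[OF m[OF p] m[OF n], symmetric]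
  proof (rule nn_integral_cong)
    fix x
    have "max 0 (f x) = f x \<and> max 0 (- 1 * f x) = 0 \<or> max 0 (f x) = 0 \<and> max 0 (- 1 * f x) = - f x"
      by (auto simp: max_def)
    then show "ennreal (\<bar>f x * v x r powr (1/2 - 1/q)\<bar> powr q) =
        ennreal (\<bar>max 0 (f x) * v x r powr (1/2 - 1/q)\<bar> powr q) +
        ennreal (\<bar>max 0 (- 1 * f x) * v x r powr (1/2 - 1/q)\<bar> powr q)"
      by (elim disjE conjE) (simp_all only: mult_zero_left abs_zero powr_0 ennreal_0 add_0_right add_0_left minus_mult_left[symmetric] abs_minus_cancel)
  qed
qed

lemma scaled_energy_pos_part:
  assumes "f \<in> A"
  shows "scaled_energy r (\<lambda>x. max 0 (f x)) \<le> scaled_energy r f"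
proof -
  have "l2_inner \<mu> (\<lambda>x. max 0 (f x)) (\<lambda>x. max 0 (f x)) \<le> 1\<^sup>2 * l2_inner \<mu> f f"
    by (rule L2_dominated(2)) (use Cc_measurable[OF A_Cc[OF A_pos(1)[OF assms]]] F_L2[OF A_F[OF assms]] in auto)
  moreover have "r\<^sup>2 * E (\<lambda>x. max 0 (f x)) (\<lambda>x. max 0 (f x)) \<le> r\<^sup>2 * E f f"
    using A_pos(2)[OF assms] by (rule mult_left_mono) simp
  ultimately show ?thesis unfolding scaled_energy_def by simp
qed

text \<open>Elements of \<open>A\<close> approximate f in the form norm; the right side converges
  along them, and the left side is lower semicontinuous by Fatou's lemma.\<close>

lemma LS_imp_GN:
  assumes "LS \<mu> F E v q"
  shows "GN \<mu> F E v q"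
proof -
  obtain C where C: "0 < C" and LS: "\<And>x r f. 0 < r \<Longrightarrow> f \<in> F_c \<mu> F (ball x r) \<Longrightarrow>
      (lp_norm \<mu> q f)\<^sup>2 \<le> ennreal C / ennreal (v x r powr (1 - 2/q)) * ennreal (scaled_energy r f)"
    using assms unfolding LS_def scaled_energy_def[symmetric] by blast
  \<comment> \<open>The leading 2 pays for the positive and the negative part.\<close>
  define M where "M = 2 * (c powr (q / 2 - 1) * 2 powr q)"
  define L where "L = C * (17 * D ^ 5)"
  have M: "0 < M" and L: "0 < L" using c_pos C D_pos by (auto simp: M_def L_def)
  have A_bound: "weighted_mass r f \<le> ennreal (M * (L * scaled_energy r f) powr (q / 2))" if r: "0 < r" and f: "f \<in> A" for r f
  proof -
    have part: "weighted_mass r (\<lambda>x. max 0 (g x)) \<le> ennreal (M / 2 * (L * scaled_energy r f) powr (q / 2))"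
      if g: "g \<in> A" and le: "scaled_energy r g \<le> scaled_energy r f" for g
    proof -
      have gp: "(\<lambda>x. max 0 (g x)) \<in> A" by (rule A_pos(1)[OF g])
      have "weighted_mass r (\<lambda>x. max 0 (g x)) \<le> ennreal (c powr (q / 2 - 1) * 2 powr q * (C * (17 * D ^ 5 * scaled_energy r (\<lambda>x. max 0 (g x)))) powr (q / 2))"
        by (rule LS_imp_bound_nonneg[OF C LS[OF r] r gp]) auto
      also have "\<dots> = ennreal (M / 2 * (L * scaled_energy r (\<lambda>x. max 0 (g x))) powr (q / 2))"
        by (simp add: M_def L_def mult.assoc)
      also have "\<dots> \<le> ennreal (M / 2 * (L * scaled_energy r f) powr (q / 2))"
      proof (intro ennreal_leI mult_left_mono powr_mono2)
        show "scaled_energy r (\<lambda>x. max 0 (g x)) \<le> scaled_energy r f" using scaled_energy_pos_part[OF g, of r] le by linarith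
        show "0 \<le> L * scaled_energy r (\<lambda>x. max 0 (g x))" using L scaled_energy_nonneg[OF A_F[OF gp]] by simp
      qed (use L M q in auto)
      finally show ?thesis .
    qed
    have neg: "(\<lambda>x. - 1 * f x) \<in> A" using f by (rule A.mems)
    have sn: "scaled_energy r (\<lambda>x. - 1 * f x) = scaled_energy r f"
      unfolding scaled_energy_def A.cmult_both[OF f] L2.cmult_both[OF F_L2[OF A_F[OF f]]] by simp
    have "weighted_mass r f \<le> ennreal (M / 2 * (L * scaled_energy r f) powr (q / 2)) + ennreal (M / 2 * (L * scaled_energy r f) powr (q / 2))"
      unfolding weighted_mass_pos_neg[OF r f] by (intro add_mono part f neg) (simp_all only: sn order_refl)
    also have "\<dots> = ennreal (M * (L * scaled_energy r f) powr (q / 2))"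
      using M by (simp add: ennreal_plus[symmetric] del: ennreal_plus)
    finally show ?thesis .
  qed
  have F_bound: "weighted_mass r f \<le> ennreal (M * (L * scaled_energy r f) powr (q / 2))" if r: "0 < r" and f: "f \<in> F" for r f
  proof -
    have "\<exists>g\<in>A. form_norm_sq \<mu> E (\<lambda>x. f x - g x) < inverse (real (Suc n))" for n
      using regular f unfolding regular_form_def A_def by (meson inverse_Suc)
    then obtain g where gA: "\<And>n. g n \<in> A" and g: "\<And>n. form_norm_sq \<mu> E (\<lambda>x. f x - g n x) < inverse (real (Suc n))"
      by metis
    have gF: "g n \<in> F" for n by (rule A_F[OF gA])
    have dF: "(\<lambda>x. f x - g n x) \<in> F" for n using f gF by (intro mems)
    have dL: "(\<lambda>x. f x - g n x) \<in> L2 \<mu>" for n by (rule F_L2[OF dF])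
    have lim: "(\<lambda>n. l2_inner \<mu> (\<lambda>x. f x - g n x) (\<lambda>x. f x - g n x)) \<longlonglongrightarrow> 0"
      "(\<lambda>n. E (\<lambda>x. f x - g n x) (\<lambda>x. f x - g n x)) \<longlonglongrightarrow> 0"
    proof -
      have "norm (l2_inner \<mu> (\<lambda>x. f x - g n x) (\<lambda>x. f x - g n x)) \<le> inverse (real (Suc n))"
        "norm (E (\<lambda>x. f x - g n x) (\<lambda>x. f x - g n x)) \<le> inverse (real (Suc n))" for n
        using g[of n] L2.nonneg[OF dL[of n]] nonneg[OF dF[of n]] unfolding form_norm_sq_def real_norm_def by linarith+
      then show "(\<lambda>n. l2_inner \<mu> (\<lambda>x. f x - g n x) (\<lambda>x. f x - g n x)) \<longlonglongrightarrow> 0"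
        "(\<lambda>n. E (\<lambda>x. f x - g n x) (\<lambda>x. f x - g n x)) \<longlonglongrightarrow> 0"
        by (auto intro!: Lim_null_comparison[OF _ LIMSEQ_inverse_real_of_nat])
    qed
    have "(\<lambda>n. \<integral>x. norm ((f x - g n x) * (f x - g n x)) \<partial>\<mu>) \<longlonglongrightarrow> 0"
      using lim(1) by (simp add: l2_inner_def abs_mult)
    \<comment> \<open>Fatou's lemma asks for pointwise convergence; the squared differences tend to
      0 in L1, hence almost everywhere along a subsequence.\<close>
    from tendsto_L1_AE_subseq[OF L2_integrable_mult[OF dL dL] this]
    obtain s where s: "strict_mono s" and ae: "AE x in \<mu>. (\<lambda>n. (f x - g (s n) x) * (f x - g (s n) x)) \<longlonglongrightarrow> 0"
      by blast
    have lim_scaled: "(\<lambda>n. scaled_energy r (g (s n))) \<longlonglongrightarrow> scaled_energy r f"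
    proof -
      have "(\<lambda>n. scaled_energy r (g n)) \<longlonglongrightarrow> scaled_energy r f"
        unfolding scaled_energy_def using f gF lim
        by (intro tendsto_intros tendsto_energy L2.tendsto_energy F_L2) auto
      then show ?thesis using LIMSEQ_subseq_LIMSEQ[OF _ s] by (force simp: o_def)
    qed
    let ?J = "\<lambda>h x. ennreal (\<bar>h x * v x r powr (1/2 - 1/q)\<bar> powr q)"
    have "weighted_mass r f = (\<integral>\<^sup>+x. liminf (\<lambda>n. ?J (g (s n)) x) \<partial>\<mu>)"
      unfolding weighted_mass_def
    proof (rule nn_integral_cong_AE)
      show "AE x in \<mu>. ?J f x = liminf (\<lambda>n. ?J (g (s n)) x)"
        using ae
      proof eventually_elim
        fix x assume "(\<lambda>n. (f x - g (s n) x) * (f x - g (s n) x)) \<longlonglongrightarrow> 0"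
        from tendsto_real_sqrt[OF this] have "(\<lambda>n. \<bar>f x - g (s n) x\<bar>) \<longlonglongrightarrow> 0" by simp
        then have "(\<lambda>n. f x - g (s n) x) \<longlonglongrightarrow> 0" by (rule tendsto_rabs_zero_cancel)
        from tendsto_diff[OF tendsto_const[of "f x"] this] have "(\<lambda>n. g (s n) x) \<longlonglongrightarrow> f x" by simp
        then have "(\<lambda>n. \<bar>g (s n) x * v x r powr (1/2 - 1/q)\<bar> powr q) \<longlonglongrightarrow> \<bar>f x * v x r powr (1/2 - 1/q)\<bar> powr q"
          using q by (intro tendsto_powr' tendsto_intros) auto
        then have "(\<lambda>n. ?J (g (s n)) x) \<longlonglongrightarrow> ?J f x" by (rule tendsto_ennrealI)
        then show "?J f x = liminf (\<lambda>n. ?J (g (s n)) x)"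
          by (intro lim_imp_Liminf[symmetric]) auto
      qed
    qed
    also have "\<dots> \<le> liminf (\<lambda>n. weighted_mass r (g (s n)))"
      unfolding weighted_mass_def
    proof (rule nn_integral_liminf)
      show "?J (g (s n)) \<in> borel_measurable \<mu>" for n
        using Cc_measurable[OF A_Cc[OF gA[of "s n"]]] v_measurable[OF r] by measurable
    qed
    also have "\<dots> \<le> liminf (\<lambda>n. ennreal (M * (L * scaled_energy r (g (s n))) powr (q / 2)))"
      by (intro Liminf_mono always_eventually allI A_bound r gA)
    also have "\<dots> = ennreal (M * (L * scaled_energy r f) powr (q / 2))"
    proof (rule lim_imp_Liminf)
      show "(\<lambda>n. ennreal (M * (L * scaled_energy r (g (s n))) powr (q / 2))) \<longlonglongrightarrow> ennreal (M * (L * scaled_energy r f) powr (q / 2))"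
        using lim_scaled q L scaled_energy_nonneg[OF gF]
        by (intro tendsto_ennrealI tendsto_mult tendsto_powr' tendsto_const) auto
    qed simp
    finally show ?thesis .
  qed
  \<comment> \<open>\<open>GN_iff\<close> carries its constant inside the power q/2, hence
    M^(2/q).\<close>
  have "weighted_mass r f \<le> ennreal ((M powr (2 / q) * L * scaled_energy r f) powr (q / 2))" if "0 < r" "f \<in> F" for r f
  proof -
    have "(M powr (2 / q) * L * scaled_energy r f) powr (q / 2) = (M powr (2 / q)) powr (q / 2) * (L * scaled_energy r f) powr (q / 2)"
      by (simp add: powr_mult mult.assoc)
    also have "(M powr (2 / q)) powr (q / 2) = M" using M q by (simp add: powr_powr)
    finally show ?thesis using F_bound[OF that] by simp
  qed
  moreover have "0 < M powr (2 / q) * L" using M L by simp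
  ultimately show ?thesis unfolding GN_iff by blast
qed

end

theorem proposition3p2p3:
  fixes \<mu> :: "'a::polish_space measure"
    and L :: "(('a \<Rightarrow> real) \<times> ('a \<Rightarrow> real)) set"
    and \<Gamma> :: "('a \<Rightarrow> real) \<Rightarrow> 'a measure"
    and v :: "'a \<Rightarrow> real \<Rightarrow> real"
    and q :: real
  assumes "condition_H \<mu> L \<Gamma>"
    and "volume_finite_pos \<mu>"
    and "volume_doubling \<mu>"
    and "condition_A \<mu> v"
    and "condition_D' v"
    and "q > 2"
  shows "(GN \<mu> (form_domain \<mu> L) (form_of \<mu> L) v q \<longleftrightarrow> KGN \<mu> (form_domain \<mu> L) (form_of \<mu> L) v q) \<and>
         (KGN \<mu> (form_domain \<mu> L) (form_of \<mu> L) v q \<longleftrightarrow> LS \<mu> (form_domain \<mu> L) (form_of \<mu> L) v q)"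
proof -
  let ?F = "form_domain \<mu> L" and ?E = "form_of \<mu> L"
  note H = assms(1)[unfolded condition_H_def]
  obtain D where D: "0 < D" "\<And>x r. 0 < r \<Longrightarrow> volume \<mu> x (2 * r) \<le> ennreal D * volume \<mu> x r"
    using assms(3) unfolding volume_doubling_def by blast
  obtain c where c: "0 < c" "\<And>x y r. 0 < r \<Longrightarrow> dist x y \<le> r \<Longrightarrow> v y r \<le> c * v x r"
    using assms(5) unfolding condition_D'_def by blast
  \<comment> \<open>This interpretation precedes the other because its \<open>compact_cball\<close>
    discharges the assumption \<open>proper\<close> there.\<close>
  interpret doubling_measure \<mu> D
    using H D assms(2) by unfold_locales (auto simp: volume_finite_pos_def volume_def)
  interpret doubling_energy_space \<mu> ?F ?E \<Gamma> D v c q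
  proof
    show "(\<lambda>y. dist x y) \<in> F_loc \<mu> ?F"
      "\<exists>\<nu>. loc_energy_measure \<mu> ?F \<Gamma> (\<lambda>y. dist x y) \<nu> \<and> (\<forall>S\<in>sets borel. emeasure \<nu> S \<le> emeasure \<mu> S)" for x
      using H by blast+
    show "compact (cball x r)" for x :: 'a and r by (rule compact_cball)
  qed (use H c assms(4,6) in \<open>auto simp: condition_A_def\<close>)
  show ?thesis using GN_imp_KGN KGN_imp_LS LS_imp_GN by blast
qed

end
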